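(* Let $\mathcal D$ be a Parseval determining set for $L^1(X)$, and let $\mathcal A=\{\varphi_i : i\in I\}$ and $\mathcal A'=\{\psi_i : i\in I\}$ be two countable collections of functions in $L^2(X;\mathcal H)$. Put $\sigma(\mathcal S_{\mathcal D}(\mathcal A)):=\{x\in X : J_{\mathcal A}(x)\neq\{0\}\}$, similarly for $\mathcal A'$, and $\Omega:=\sigma(\mathcal S_{\mathcal D}(\mathcal A))\cap\sigma(\mathcal S_{\mathcal D}(\mathcal A'))$. Then $$\mathfrak S(\mathcal S_{\mathcal D}(\mathcal A),\mathcal S_{\mathcal D}(\mathcal A'))=\operatorname*{ess\,sup}_{x\in\Omega}\ \mathfrak S\big(J_{\mathcal A}(x),J_{\mathcal A'}(x)\big).$$ In addition, if $\mathcal E_{\mathcal D}(\mathcal A)$ and $\mathcal E_{\mathcal D}(\mathcal A')$ are frames for $\mathcal S_{\mathcal D}(\mathcal A)$ and $\mathcal S_{\mathcal D}(\mathcal A')$, respectively, then $$\mathfrak S(\mathcal S_{\mathcal D}(\mathcal A),\mathcal S_{\mathcal D}(\mathcal A'))=\operatorname*{ess\,sup}_{x\in\Omega}\left\|(G_{\mathcal A'}(x)^\dagger)^{1/2}\,G_{\mathcal A,\mathcal A'}(x)\,(G_{\mathcal A}(x)^\dagger)^{1/2}\right\|,$$ where $\dagger$ denotes the (Moore--Penrose) pseudo-inverse.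
   Context: $(X,\mu_X)$ is a $\sigma$-finite complete measure space with $L^2(X)$ separable, $\mathcal H$ is a separable Hilbert space, and $L^2(X;\mathcal H)$ is the Hilbert space of (classes of) measurable $\varphi:X\to\mathcal H$ with $\int_X\|\varphi(x)\|^2\,d\mu_X(x)<\infty$. For $\phi\in L^\infty(X)$, $M_\phi$ is the operator on $L^2(X;\mathcal H)$ given by $(M_\phi f)(x)=\phi(x)f(x)$. Parseval determining set: let $(\mathcal M,\mu_{\mathcal M})$ be a $\sigma$-finite measure space. A set $\mathcal D=\{g_s\in L^\infty(X): s\in\mathcal M\}$ is a Parseval determining set for $L^1(X)$ if for each $f\in L^1(X)$ the map $s\mapsto\int_X f(x)\overline{g_s(x)}\,d\mu_X(x)$ is measurable on $\mathcal M$ and $\int_{\mathcal M}\big|\int_X f\,\overline{g_s}\,d\mu_X\big|^2 d\mu_{\mathcal M}(s)=\int_X|f|^2\,d\mu_X$. For $\mathcal A\subset L^2(X;\mathcal H)$: $\mathcal E_{\mathcal D}(\mathcal A)=\{M_\phi\varphi:\phi\in\mathcal D,\varphi\in\mathcal A\}$ and $\mathcal S_{\mathcal D}(\mathcal A)=\overline{\operatorname{span}}\,\mathcal E_{\mathcal D}(\mathcal A)$. $\mathcal E_{\mathcal D}(\mathcal A)$ is a frame for $\mathcal S_{\mathcal D}(\mathcal A)$ if there are constants $m,M>0$ with $m\|f\|^2\le\sum_{\varphi\in\mathcal A}\int_{\mathcal M}|\langle f,M_{g_s}\varphi\rangle|^2\,d\mu_{\mathcal M}(s)\le M\|f\|^2$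 for all $f\in\mathcal S_{\mathcal D}(\mathcal A)$. For countable $\mathcal A=\{\varphi_i\}_{i\in I}$, $J_{\mathcal A}(x)=\overline{\operatorname{span}}\{\varphi_i(x):i\in I\}\subset\mathcal H$ (defined for a.e. $x$). For closed subspaces $E,F$ of a Hilbert space, the supremum cosine angle is $\mathfrak S(E,F)=\sup\{\|P_Fu\|/\|u\|: u\in E\setminus\{0\}\}=\|P_F|_E\|$, with $P_F$ the orthogonal projection onto $F$; it is $0$ if $E=\{0\}$ or $F=\{0\}$. All essential suprema are of $[0,\infty)$-valued functions, and the essential supremum over a null set is $0$. Gramians: for $\mathcal A=\{\varphi_i\}_{i\in I}$, $\mathcal A'=\{\psi_i\}_{i\in I}$, $G_{\mathcal A}(x)$, $G_{\mathcal A'}(x)$ and $G_{\mathcal A,\mathcal A'}(x)$ are the operators on $\ell^2(I)$ with matrices (row index $i$, column index $j$) $[\langle\varphi_j(x),\varphi_i(x)\rangle]_{i,j}$, $[\langle\psi_j(x),\psi_i(x)\rangle]_{i,j}$ and $[\langle\varphi_j(x),\psi_i(x)\rangle]_{i,j}$; under the frame assumption these are bounded operators for a.e. $x$. *)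

theory Defs
  imports "HOL-Probability.Probability" "HOL-Library.Function_Algebras"
begin

class complex_vector = ab_group_add +
  fixes scaleC :: "complex \<Rightarrow> 'a \<Rightarrow> 'a" (infixr "*\<^sub>C" 75)
  assumes scaleC_add_right: "a *\<^sub>C (x + y) = a *\<^sub>C x + a *\<^sub>C y"
    and scaleC_add_left: "(a + b) *\<^sub>C x = a *\<^sub>C x + b *\<^sub>C x"
    and scaleC_scaleC: "a *\<^sub>C b *\<^sub>C x = (a * b) *\<^sub>C x"
    and scaleC_one: "1 *\<^sub>C x = x"

lemma vector_space_scaleC: "vector_space (scaleC :: complex \<Rightarrow> 'a::complex_vector \<Rightarrow> 'a)"
  by unfold_locales (auto simp: scaleC_add_right scaleC_add_left scaleC_scaleC scaleC_one)

abbreviation cspan :: "'a::complex_vector set \<Rightarrow> 'a set"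
  where "cspan \<equiv> module.span scaleC"

text \<open>Inner products are linear in the first argument and conjugate-linear in the second.\<close>

class complex_hilbert = complex_vector + banach +
  fixes cinner :: "'a \<Rightarrow> 'a \<Rightarrow> complex"
  assumes scaleR_scaleC: "r *\<^sub>R x = complex_of_real r *\<^sub>C x"
    and cinner_commute: "cinner x y = cnj (cinner y x)"
    and cinner_add_left: "cinner (x + y) z = cinner x z + cinner y z"
    and cinner_scaleC_left: "cinner (a *\<^sub>C x) y = a * cinner x y"
    and cinner_self: "cinner x x = complex_of_real ((norm x)\<^sup>2)"

instantiation complex :: complex_hilbert
begin

definition scaleC_complex :: "complex \<Rightarrow> complex \<Rightarrow> complex"
  where "scaleC_complex a x = a * x"

definition cinner_complex :: "complex \<Rightarrow> complex \<Rightarrow> complex"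
  where "cinner_complex x y = x * cnj y"

instance
  by standard
    (auto simp: scaleC_complex_def cinner_complex_def algebra_simps scaleR_conv_of_real
      complex_norm_square[symmetric])

end

instantiation "fun" :: (type, complex_vector) complex_vector
begin

definition scaleC_fun :: "complex \<Rightarrow> ('a \<Rightarrow> 'b) \<Rightarrow> 'a \<Rightarrow> 'b"
  where "scaleC_fun a f = (\<lambda>x. a *\<^sub>C f x)"

instance
  by standard
    (auto simp: scaleC_fun_def plus_fun_def scaleC_add_right scaleC_add_left scaleC_scaleC
      scaleC_one)

end

text \<open>
  An inner product space is given by a carrier \<open>V\<close> and a form \<open>ip\<close> on it.  Instead of forming
  the quotient by almost-everywhere equality, \<open>L\<^sup>2(X;H)\<close> is handled through representatives, so
  \<open>ip\<close> may be degenerate: vectors are equal in the Hilbert space iff their difference has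
  \<open>ip_norm\<close> zero.  All closures, norms, projections and angles below respect this identification.
\<close>

definition ip_norm :: "('v::complex_vector \<Rightarrow> 'v \<Rightarrow> complex) \<Rightarrow> 'v \<Rightarrow> real"
  where "ip_norm ip v = sqrt (Re (ip v v))"

definition ip_separable :: "'v::complex_vector set \<Rightarrow> ('v \<Rightarrow> 'v \<Rightarrow> complex) \<Rightarrow> bool"
  where "ip_separable V ip \<longleftrightarrow>
    (\<exists>Q\<subseteq>V. countable Q \<and> (\<forall>f\<in>V. \<forall>e>0. \<exists>q\<in>Q. ip_norm ip (f - q) < e))"

definition ip_closure ::
    "'v::complex_vector set \<Rightarrow> ('v \<Rightarrow> 'v \<Rightarrow> complex) \<Rightarrow> 'v set \<Rightarrow> 'v set"
  where "ip_closure V ip S = {f\<in>V. \<forall>e>0. \<exists>h\<in>S. ip_norm ip (f - h) < e}"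

text \<open>Unique up to vectors of \<open>ip_norm\<close> zero; for \<open>F\<close> a closed subspace of a Hilbert space.\<close>

definition orth_proj ::
    "('v::complex_vector \<Rightarrow> 'v \<Rightarrow> complex) \<Rightarrow> 'v set \<Rightarrow> 'v \<Rightarrow> 'v"
  where "orth_proj ip F u = (SOME p. p \<in> F \<and> (\<forall>v\<in>F. ip (u - p) v = 0))"

definition sup_cos_angle ::
    "('v::complex_vector \<Rightarrow> 'v \<Rightarrow> complex) \<Rightarrow> 'v set \<Rightarrow> 'v set \<Rightarrow> real"
  where "sup_cos_angle ip E F =
    (if (\<forall>u\<in>E. ip_norm ip u = 0) \<or> (\<forall>v\<in>F. ip_norm ip v = 0) then 0
     else (SUP u\<in>{u\<in>E. ip_norm ip u \<noteq> 0}. ip_norm ip (orth_proj ip F u) / ip_norm ip u))"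

definition bounded_op ::
    "'v::complex_vector set \<Rightarrow> ('v \<Rightarrow> 'v \<Rightarrow> complex) \<Rightarrow> ('v \<Rightarrow> 'v) \<Rightarrow> bool"
  where "bounded_op V ip T \<longleftrightarrow>
    (\<forall>c\<in>V. T c \<in> V) \<and>
    (\<forall>c\<in>V. \<forall>d\<in>V. T (c + d) = T c + T d) \<and>
    (\<forall>a. \<forall>c\<in>V. T (a *\<^sub>C c) = a *\<^sub>C T c) \<and>
    (\<exists>K. \<forall>c\<in>V. ip_norm ip (T c) \<le> K * ip_norm ip c)"

definition op_norm ::
    "'v::complex_vector set \<Rightarrow> ('v \<Rightarrow> 'v \<Rightarrow> complex) \<Rightarrow> ('v \<Rightarrow> 'v) \<Rightarrow> real"
  where "op_norm V ip T = (SUP c\<in>{c\<in>V. ip_norm ip c \<le> 1}. ip_norm ip (T c))"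

definition self_adjoint_op ::
    "'v::complex_vector set \<Rightarrow> ('v \<Rightarrow> 'v \<Rightarrow> complex) \<Rightarrow> ('v \<Rightarrow> 'v) \<Rightarrow> bool"
  where "self_adjoint_op V ip T \<longleftrightarrow> (\<forall>c\<in>V. \<forall>d\<in>V. ip (T c) d = ip c (T d))"

definition positive_op ::
    "'v::complex_vector set \<Rightarrow> ('v \<Rightarrow> 'v \<Rightarrow> complex) \<Rightarrow> ('v \<Rightarrow> 'v) \<Rightarrow> bool"
  where "positive_op V ip T \<longleftrightarrow> (\<forall>c\<in>V. ip (T c) c \<in> \<real>\<^sub>\<ge>\<^sub>0)"

text \<open>
  The next two operators are unique on \<open>V\<close> when they exist (for nondegenerate \<open>ip\<close>); their values
  outside \<open>V\<close> are irrelevant.  The Moore--Penrose inverse is the bounded operator satisfying the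
  four Penrose equations; it exists iff the bounded operator \<open>T\<close> has closed range.
\<close>

definition pseudo_inverse ::
    "'v::complex_vector set \<Rightarrow> ('v \<Rightarrow> 'v \<Rightarrow> complex) \<Rightarrow> ('v \<Rightarrow> 'v) \<Rightarrow> 'v \<Rightarrow> 'v"
  where "pseudo_inverse V ip T = (SOME S. bounded_op V ip S \<and>
    (\<forall>c\<in>V. T (S (T c)) = T c) \<and> (\<forall>c\<in>V. S (T (S c)) = S c) \<and>
    self_adjoint_op V ip (T \<circ> S) \<and> self_adjoint_op V ip (S \<circ> T))"

definition op_sqrt ::
    "'v::complex_vector set \<Rightarrow> ('v \<Rightarrow> 'v \<Rightarrow> complex) \<Rightarrow> ('v \<Rightarrow> 'v) \<Rightarrow> 'v \<Rightarrow> 'v"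
  where "op_sqrt V ip T = (SOME R. bounded_op V ip R \<and> positive_op V ip R \<and>
    (\<forall>c\<in>V. R (R c) = T c))"

definition ell2 :: "'i set \<Rightarrow> ('i \<Rightarrow> complex) set"
  where "ell2 I = {c. (\<forall>i. i \<notin> I \<longrightarrow> c i = 0) \<and> (\<lambda>i. (cmod (c i))\<^sup>2) summable_on I}"

definition ell2_inner :: "'i set \<Rightarrow> ('i \<Rightarrow> complex) \<Rightarrow> ('i \<Rightarrow> complex) \<Rightarrow> complex"
  where "ell2_inner I c d = (\<Sum>\<^sub>\<infinity>i\<in>I. c i * cnj (d i))"

definition matrix_op :: "'i set \<Rightarrow> ('i \<Rightarrow> 'i \<Rightarrow> complex) \<Rightarrow> ('i \<Rightarrow> complex) \<Rightarrow> 'i \<Rightarrow> complex"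
  where "matrix_op I a c = (\<lambda>i. if i \<in> I then \<Sum>\<^sub>\<infinity>j\<in>I. a i j * c j else 0)"

definition L2 :: "'x measure \<Rightarrow> ('x \<Rightarrow> 'h::complex_hilbert) set"
  where "L2 M = {f \<in> borel_measurable M. integrable M (\<lambda>x. (norm (f x))\<^sup>2)}"

definition L2_inner ::
    "'x measure \<Rightarrow> ('x \<Rightarrow> 'h::complex_hilbert) \<Rightarrow> ('x \<Rightarrow> 'h) \<Rightarrow> complex"
  where "L2_inner M f h = (\<integral>x. cinner (f x) (h x) \<partial>M)"

definition Linf :: "'x measure \<Rightarrow> ('x \<Rightarrow> complex) set"
  where "Linf M = {f \<in> borel_measurable M. \<exists>C. AE x in M. cmod (f x) \<le> C}"

definition mult_op :: "('x \<Rightarrow> complex) \<Rightarrow> ('x \<Rightarrow> 'h::complex_hilbert) \<Rightarrow> 'x \<Rightarrow> 'h"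
  where "mult_op \<phi> f = (\<lambda>x. \<phi> x *\<^sub>C f x)"

text \<open>
  The determining set is given as the family \<open>g\<close> indexed by the points of \<open>N\<close>.  The integral of
  \<open>|f|\<^sup>2\<close> may be infinite for \<open>f \<in> L\<^sup>1\<close>, whence the integrals in \<open>[0,\<infinity>]\<close>.
\<close>

definition parseval_determining ::
    "'x measure \<Rightarrow> 's measure \<Rightarrow> ('s \<Rightarrow> 'x \<Rightarrow> complex) \<Rightarrow> bool"
  where "parseval_determining M N g \<longleftrightarrow>
    (\<forall>s\<in>space N. g s \<in> Linf M) \<and>
    (\<forall>f :: 'x \<Rightarrow> complex. integrable M f \<longrightarrow>
      (\<lambda>s. \<integral>x. f x * cnj (g s x) \<partial>M) \<in> borel_measurable N \<and>
      (\<integral>\<^sup>+s. ennreal ((cmod (\<integral>x. f x * cnj (g s x) \<partial>M))\<^sup>2) \<partial>N) =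
      (\<integral>\<^sup>+x. ennreal ((cmod (f x))\<^sup>2) \<partial>M))"

definition generated_system ::
    "'s measure \<Rightarrow> ('s \<Rightarrow> 'x \<Rightarrow> complex) \<Rightarrow> 'i set \<Rightarrow> ('i \<Rightarrow> 'x \<Rightarrow> 'h::complex_hilbert)
      \<Rightarrow> ('x \<Rightarrow> 'h) set"
  where "generated_system N g I \<phi> = {mult_op (g s) (\<phi> i) | s i. s \<in> space N \<and> i \<in> I}"

definition generated_space ::
    "'x measure \<Rightarrow> 's measure \<Rightarrow> ('s \<Rightarrow> 'x \<Rightarrow> complex) \<Rightarrow> 'i set
      \<Rightarrow> ('i \<Rightarrow> 'x \<Rightarrow> 'h::complex_hilbert) \<Rightarrow> ('x \<Rightarrow> 'h) set"
  where "generated_space M N g I \<phi> =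
    ip_closure (L2 M) (L2_inner M) (cspan (generated_system N g I \<phi>))"

text \<open>The sum in the frame inequality runs over the index set, i.e. counts repeated generators.\<close>

definition generates_frame ::
    "'x measure \<Rightarrow> 's measure \<Rightarrow> ('s \<Rightarrow> 'x \<Rightarrow> complex) \<Rightarrow> 'i set
      \<Rightarrow> ('i \<Rightarrow> 'x \<Rightarrow> 'h::complex_hilbert) \<Rightarrow> bool"
  where "generates_frame M N g I \<phi> \<longleftrightarrow>
    (\<exists>m K :: real. 0 < m \<and> 0 < K \<and> (\<forall>f\<in>generated_space M N g I \<phi>.
      let t = (\<Sum>\<^sub>\<infinity>i\<in>I. \<integral>\<^sup>+s. ennreal ((cmod (L2_inner M f (mult_op (g s) (\<phi> i))))\<^sup>2) \<partial>N)
      in ennreal (m * (ip_norm (L2_inner M) f)\<^sup>2) \<le> t \<and>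
         t \<le> ennreal (K * (ip_norm (L2_inner M) f)\<^sup>2)))"

definition range_fun :: "'i set \<Rightarrow> ('i \<Rightarrow> 'x \<Rightarrow> 'h::complex_hilbert) \<Rightarrow> 'x \<Rightarrow> 'h set"
  where "range_fun I \<phi> x = closure (cspan {\<phi> i x | i. i \<in> I})"

definition fiber_support :: "'x measure \<Rightarrow> 'i set \<Rightarrow> ('i \<Rightarrow> 'x \<Rightarrow> 'h::complex_hilbert) \<Rightarrow> 'x set"
  where "fiber_support M I \<phi> = {x \<in> space M. range_fun I \<phi> x \<noteq> {0}}"

text \<open>\<open>gramian I \<phi> \<psi> x\<close> is \<open>G\<^bsub>A,A'\<^esub>(x)\<close> and \<open>gramian I \<phi> \<phi> x\<close> is \<open>G\<^bsub>A\<^esub>(x)\<close>.\<close>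

definition gramian ::
    "'i set \<Rightarrow> ('i \<Rightarrow> 'x \<Rightarrow> 'h::complex_hilbert) \<Rightarrow> ('i \<Rightarrow> 'x \<Rightarrow> 'h) \<Rightarrow> 'x
      \<Rightarrow> ('i \<Rightarrow> complex) \<Rightarrow> 'i \<Rightarrow> complex"
  where "gramian I \<phi> \<psi> x = matrix_op I (\<lambda>i j. cinner (\<phi> j x) (\<psi> i x))"

text \<open>The operator \<open>(T\<^sup>\<dagger>)\<^sup>1\<^sup>/\<^sup>2\<close> on \<open>\<ell>\<^sup>2(I)\<close>.\<close>

definition sqrt_pinv ::
    "'i set \<Rightarrow> (('i \<Rightarrow> complex) \<Rightarrow> 'i \<Rightarrow> complex) \<Rightarrow> ('i \<Rightarrow> complex) \<Rightarrow> 'i \<Rightarrow> complex"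
  where "sqrt_pinv I T =
    op_sqrt (ell2 I) (ell2_inner I) (pseudo_inverse (ell2 I) (ell2_inner I) T)"

text \<open>
  The library's \<open>esssup\<close> taken in \<open>[0,\<infinity>]\<close>: it is \<open>0\<close> over a null set, and \<open>\<infinity>\<close> for
  functions that are not measurable on \<open>\<Omega>\<close>.
\<close>

definition ess_sup_on :: "'x measure \<Rightarrow> 'x set \<Rightarrow> ('x \<Rightarrow> real) \<Rightarrow> ennreal"
  where "ess_sup_on M \<Omega> f = esssup (restrict_space M \<Omega>) (\<lambda>x. ennreal (f x))"

end

theory Submission
  imports Defs
begin

text \<open>
  Everything reduces to one reformulation: for a closed subspace \<open>F\<close>, the supremum cosine angle is
  the least \<open>C \<ge> 0\<close> with \<open>|\<langle>u,v\<rangle>| \<le> C \<parallel>u\<parallel> \<parallel>v\<parallel>\<close> for all \<open>u \<in> E\<close>, \<open>v \<in> F\<close>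
  (\<open>sup_cos_angle_le_iff\<close>, from the projection theorem).  Projections then disappear from the argument.

  The generated space is a space of sections: \<open>f\<close> belongs to it iff \<open>f(x)\<close> lies in \<open>J(x)\<close> for almost
  every \<open>x\<close> (\<open>generated_space_iff\<close>).  Norm limits of sections are sections.  Conversely, subtract
  from a section its projection onto the generated space; the difference is orthogonal to every
  \<open>g\<^sub>s \<phi>\<^sub>i\<close>, so the Parseval identity applied to \<open>x \<mapsto> \<langle>f(x), \<phi>\<^sub>i(x)\<rangle>\<close> makes it
  orthogonal to each \<open>\<phi>\<^sub>i(x)\<close> almost everywhere, while it also takes values in \<open>J(x)\<close>.  Hence it
  vanishes.

  In particular sections may be multiplied by measurable scalars.  Integrating the fibrewise bound
  \<open>|\<langle>u(x),v(x)\<rangle>| \<le> K \<parallel>u(x)\<parallel> \<parallel>v(x)\<parallel>\<close> gives \<open>\<le>\<close> in the first formula.  For \<open>\<ge>\<close> the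
  global bound is applied to sections cut down to arbitrary measurable sets and rescaled pointwise, which
  localises it; countably many sections that are dense in every fibre finish the argument
  (\<open>angle_eq_ess_sup_fibre_angles\<close>).  The same cut-off argument turns the frame inequality, which by
  Parseval reads \<open>m \<parallel>f\<parallel>\<^sup>2 \<le> \<integral>\<Sum>\<^sub>i |\<langle>f(x), \<phi>\<^sub>i(x)\<rangle>|\<^sup>2 \<le> K \<parallel>f\<parallel>\<^sup>2\<close>, into
  frame inequalities for \<open>(\<phi>\<^sub>i(x))\<^sub>i\<close> in almost every fibre (\<open>AE_subspace_frame_fibres\<close>).

  In a single fibre let \<open>A\<close> be the analysis operator, \<open>T\<close> its adjoint (synthesis), \<open>G = A T\<close> the
  Gramian and \<open>R = (G\<^sup>\<dagger>)\<^sup>1\<^sup>/\<^sup>2\<close>.  The frame operator \<open>T A\<close> is invertible on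
  \<open>J\<close>; with \<open>E = (T A)\<^sup>-\<^sup>1\<^sup>/\<^sup>2\<close> the operators \<open>A E\<^sup>4 T\<close> and \<open>A E\<^sup>3 T\<close> are
  \<open>G\<^sup>\<dagger>\<close> and a square root of it.  It follows that \<open>T R\<close> is a partial isometry onto \<open>J\<close>.  The mixed
  Gramian is \<open>A' T\<close>, so \<open>R' (A' T) R = (T' R')\<^sup>* (T R)\<close> has as norm the supremum of
  \<open>|\<langle>u,v\<rangle>|\<close> over the unit balls of \<open>J\<close> and \<open>J'\<close>, which is the angle
  (\<open>op_norm_gramian_eq_angle\<close>).
\<close>

section \<open>Projections and angles in semi-inner product spaces\<close>

lemma module_scaleC: "module (scaleC :: complex \<Rightarrow> 'a::complex_vector \<Rightarrow> 'a)"
  using vector_space_scaleC by (simp add: module_iff_vector_space)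

lemma scaleC_minus_one [simp]: "(-1) *\<^sub>C (x::'a::complex_vector) = - x"
  using module.scale_minus_left[OF module_scaleC, of 1 x] by (simp add: scaleC_one)

lemma scaleC_zero_left [simp]: "0 *\<^sub>C (x::'a::complex_vector) = 0"
  by (rule module.scale_zero_left[OF module_scaleC])

lemma scaleC_zero_right [simp]: "a *\<^sub>C (0::'a::complex_vector) = 0"
  by (rule module.scale_zero_right[OF module_scaleC])

definition csubspace :: "'a::complex_vector set \<Rightarrow> bool"
  where "csubspace F \<longleftrightarrow> 0 \<in> F \<and> (\<forall>x\<in>F. \<forall>y\<in>F. x + y \<in> F) \<and> (\<forall>a. \<forall>x\<in>F. a *\<^sub>C x \<in> F)"

lemma csubspaceD:
  assumes "csubspace F"
  shows "0 \<in> F" "x \<in> F \<Longrightarrow> y \<in> F \<Longrightarrow> x + y \<in> F" "x \<in> F \<Longrightarrow> a *\<^sub>C x \<in> F"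
    "x \<in> F \<Longrightarrow> - x \<in> F" "x \<in> F \<Longrightarrow> y \<in> F \<Longrightarrow> x - y \<in> F"
proof -
  show z: "0 \<in> F" and a: "x \<in> F \<Longrightarrow> y \<in> F \<Longrightarrow> x + y \<in> F" and s: "x \<in> F \<Longrightarrow> a *\<^sub>C x \<in> F" for x y a
    using assms by (auto simp: csubspace_def)
  show m: "x \<in> F \<Longrightarrow> - x \<in> F" for x using s[of x "-1"] by simp
  show "x \<in> F \<Longrightarrow> y \<in> F \<Longrightarrow> x - y \<in> F" using a[OF _ m] by fastforce
qed

lemma csubspace_cspan: "csubspace (cspan S)"
  using module.subspace_span[OF module_scaleC, of S]
  by (simp add: csubspace_def module.subspace_def[OF module_scaleC])

lemma cspan_minimal: "S \<subseteq> F \<Longrightarrow> csubspace F \<Longrightarrow> cspan S \<subseteq> F"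
  using module.span_minimal[OF module_scaleC, of S F]
  by (simp add: csubspace_def module.subspace_def[OF module_scaleC])

text \<open>
  The form may be degenerate: functions in \<open>L\<^sup>2\<close> that agree almost everywhere are kept apart.
\<close>

locale semi_inner_space =
  fixes V :: "'v::complex_vector set" and ip :: "'v \<Rightarrow> 'v \<Rightarrow> complex"
  assumes csubspace: "csubspace V"
    and ip_commute: "x \<in> V \<Longrightarrow> y \<in> V \<Longrightarrow> ip x y = cnj (ip y x)"
    and ip_add_left: "x \<in> V \<Longrightarrow> y \<in> V \<Longrightarrow> z \<in> V \<Longrightarrow> ip (x + y) z = ip x z + ip y z"
    and ip_scaleC_left: "x \<in> V \<Longrightarrow> y \<in> V \<Longrightarrow> ip (a *\<^sub>C x) y = a * ip x y"
    and ip_self_nonneg: "x \<in> V \<Longrightarrow> 0 \<le> Re (ip x x)"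
begin

abbreviation nrm :: "'v \<Rightarrow> real" where "nrm \<equiv> ip_norm ip"

lemmas mem = csubspaceD[OF csubspace]

lemma ip_diff_left: "x \<in> V \<Longrightarrow> y \<in> V \<Longrightarrow> z \<in> V \<Longrightarrow> ip (x - y) z = ip x z - ip y z"
  using ip_add_left[of x "(-1) *\<^sub>C y" z] ip_scaleC_left[of y z "-1"] mem by auto

lemma ip_add_right: "x \<in> V \<Longrightarrow> y \<in> V \<Longrightarrow> z \<in> V \<Longrightarrow> ip z (x + y) = ip z x + ip z y"
  by (metis complex_cnj_add ip_add_left ip_commute mem(2))

lemma ip_scaleC_right: "x \<in> V \<Longrightarrow> y \<in> V \<Longrightarrow> ip x (a *\<^sub>C y) = cnj a * ip x y"
  by (metis complex_cnj_mult ip_scaleC_left ip_commute mem(3))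

lemma ip_diff_right: "x \<in> V \<Longrightarrow> y \<in> V \<Longrightarrow> z \<in> V \<Longrightarrow> ip z (x - y) = ip z x - ip z y"
  by (metis complex_cnj_diff ip_diff_left ip_commute mem(5))

lemma Im_ip_self: "x \<in> V \<Longrightarrow> Im (ip x x) = 0"
  using arg_cong[OF ip_commute[of x x], of Im] by simp

lemma nrm_nonneg [simp]: "0 \<le> nrm x" if "x \<in> V" for x
  using ip_self_nonneg[OF that] by (simp add: ip_norm_def)

lemma nrm_square: "x \<in> V \<Longrightarrow> (nrm x)\<^sup>2 = Re (ip x x)"
  using ip_self_nonneg by (simp add: ip_norm_def)

lemma ip_self: "x \<in> V \<Longrightarrow> ip x x = complex_of_real ((nrm x)\<^sup>2)"
  using Im_ip_self by (simp add: nrm_square complex_eq_iff)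

lemma nrm_square_add:
  "x \<in> V \<Longrightarrow> y \<in> V \<Longrightarrow> (nrm (x + y))\<^sup>2 = (nrm x)\<^sup>2 + 2 * Re (ip x y) + (nrm y)\<^sup>2"
  using ip_commute[of y x] by (simp add: nrm_square mem ip_add_left ip_add_right)

lemma nrm_square_diff:
  "x \<in> V \<Longrightarrow> y \<in> V \<Longrightarrow> (nrm (x - y))\<^sup>2 = (nrm x)\<^sup>2 - 2 * Re (ip x y) + (nrm y)\<^sup>2"
  using ip_commute[of y x] by (simp add: nrm_square mem ip_diff_left ip_diff_right)

lemma nrm_scaleC: "x \<in> V \<Longrightarrow> nrm (a *\<^sub>C x) = cmod a * nrm x"
proof -
  assume x: "x \<in> V"
  have "ip (a *\<^sub>C x) (a *\<^sub>C x) = complex_of_real ((cmod a)\<^sup>2 * (nrm x)\<^sup>2)"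
    using x complex_norm_square[of a]
    by (simp add: ip_scaleC_left ip_scaleC_right mem ip_self[OF x])
  from arg_cong[OF this, of Re] have "(nrm (a *\<^sub>C x))\<^sup>2 = (cmod a * nrm x)\<^sup>2"
    using x by (simp add: nrm_square[of "a *\<^sub>C x"] mem power_mult_distrib)
  then show ?thesis
    using x by (simp add: mem)
qed

lemma nrm_uminus: "x \<in> V \<Longrightarrow> nrm (- x) = nrm x"
  using nrm_scaleC[of x "-1"] by simp

lemma nrm_minus_commute: "x \<in> V \<Longrightarrow> y \<in> V \<Longrightarrow> nrm (x - y) = nrm (y - x)"
  using nrm_uminus[of "x - y"] mem by simp

lemma nrm_zero [simp]: "nrm 0 = 0"
  using nrm_scaleC[of 0 0] mem by simp

text \<open>
  The squared norm of \<open>x - s w y\<close> is a nonnegative quadratic polynomial in the real number \<open>s\<close> once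
  the unit scalar \<open>w\<close> is chosen to make \<open>\<langle>x, w y\<rangle>\<close> nonnegative.
\<close>

lemma Cauchy_Schwarz:
  assumes x: "x \<in> V" and y: "y \<in> V"
  shows "cmod (ip x y) \<le> nrm x * nrm y"
proof -
  define b where "b = cmod (ip x y)"
  define w where "w = (if b = 0 then 1 else ip x y / b)"
  have w: "cmod w = 1" by (simp add: w_def b_def norm_divide)
  have wz: "cnj w * ip x y = b"
  proof (cases "b = 0")
    case False
    have "ip x y * cnj (ip x y) = complex_of_real (b\<^sup>2)"
      unfolding b_def by (rule complex_norm_square[symmetric])
    then show ?thesis using False by (simp add: w_def field_simps power2_eq_square)
  qed (simp add: w_def b_def)
  have *: "2 * s * b \<le> (nrm x)\<^sup>2 + s\<^sup>2 * (nrm y)\<^sup>2" for s :: real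
  proof -
    have "ip x ((complex_of_real s * w) *\<^sub>C y) = s * b"
      using x y wz by (simp add: ip_scaleC_right mult.assoc)
    then have eq: "(nrm (x - (complex_of_real s * w) *\<^sub>C y))\<^sup>2 = (nrm x)\<^sup>2 - 2 * s * b + s\<^sup>2 * (nrm y)\<^sup>2"
      using x y w by (simp add: nrm_square_diff mem nrm_scaleC norm_mult power_mult_distrib)
    show ?thesis
      using zero_le_power2[of "nrm (x - (complex_of_real s * w) *\<^sub>C y)"] unfolding eq by linarith
  qed
  \<comment> \<open>A vector \<open>y\<close> of norm zero need not be \<open>0\<close>; the quadratic is then affine in \<open>s\<close>.\<close>
  show ?thesis
  proof (cases "nrm y = 0")
    case True
    have "b \<le> 0"
    proof (rule ccontr)
      assume "\<not> b \<le> 0"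
      then show False
        using *[of "((nrm x)\<^sup>2 + 1) / b"] True zero_le_power2[of "nrm x"] by simp
    qed
    then show ?thesis using True by (simp add: b_def)
  next
    case False
    define C where "C = (nrm y)\<^sup>2"
    have pos: "0 < C" using False by (simp add: C_def)
    have "2 * (b\<^sup>2 / C) \<le> (nrm x)\<^sup>2 + b\<^sup>2 / C"
      using *[of "b / C", folded C_def] pos by (simp add: power2_eq_square)
    then have "b\<^sup>2 / C \<le> (nrm x)\<^sup>2" by simp
    then have "b\<^sup>2 \<le> (nrm x)\<^sup>2 * (nrm y)\<^sup>2"
      using pos by (simp add: pos_divide_le_eq C_def)
    then have "b\<^sup>2 \<le> (nrm x * nrm y)\<^sup>2" by (simp add: power_mult_distrib)
    then show ?thesis unfolding b_def by (rule power2_le_imp_le) (simp add: x y)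
  qed
qed

lemma nrm_triangle: "x \<in> V \<Longrightarrow> y \<in> V \<Longrightarrow> nrm (x + y) \<le> nrm x + nrm y"
proof -
  assume x: "x \<in> V" and y: "y \<in> V"
  have "Re (ip x y) \<le> nrm x * nrm y"
    using Cauchy_Schwarz[OF x y] complex_Re_le_cmod order_trans by blast
  then have "(nrm (x + y))\<^sup>2 \<le> (nrm x + nrm y)\<^sup>2"
    using x y by (simp add: nrm_square_add power2_sum)
  then show ?thesis
    by (rule power2_le_imp_le) (simp add: x y)
qed

lemma nrm_triangle_sub: "x \<in> V \<Longrightarrow> y \<in> V \<Longrightarrow> z \<in> V \<Longrightarrow> nrm (x - z) \<le> nrm (x - y) + nrm (y - z)"
  using nrm_triangle[of "x - y" "y - z"] mem by simp

lemma ip_closureD: "x \<in> ip_closure V ip S \<Longrightarrow> x \<in> V"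
  by (simp add: ip_closure_def)

lemma ip_closureE:
  assumes "x \<in> ip_closure V ip S" and "0 < e"
  obtains h where "h \<in> S" "nrm (x - h) < e"
  using assms by (auto simp: ip_closure_def)

lemma ip_closure_mono: "S \<subseteq> V \<Longrightarrow> S \<subseteq> ip_closure V ip S"
  by (force simp: ip_closure_def)

lemma ip_closure_subset: "ip_closure V ip S \<subseteq> V"
  by (auto simp: ip_closure_def)

lemma csubspace_ip_closure:
  assumes S: "S \<subseteq> V" "csubspace S"
  shows "csubspace (ip_closure V ip S)"
  unfolding csubspace_def
proof (intro conjI ballI allI)
  show "0 \<in> ip_closure V ip S"
    using ip_closure_mono[OF S(1)] csubspaceD(1)[OF S(2)] by blast
next
  fix x y assume x: "x \<in> ip_closure V ip S" and y: "y \<in> ip_closure V ip S"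
  have "\<exists>h\<in>S. nrm (x + y - h) < e" if e: "e > 0" for e
  proof -
    obtain h where h: "h \<in> S" "nrm (x - h) < e/2"
      using ip_closureE[OF x half_gt_zero[OF e]] by blast
    obtain k where k: "k \<in> S" "nrm (y - k) < e/2"
      using ip_closureE[OF y half_gt_zero[OF e]] by blast
    have "nrm ((x - h) + (y - k)) \<le> nrm (x - h) + nrm (y - k)"
      by (rule nrm_triangle) (use h(1) k(1) S(1) ip_closureD[OF x] ip_closureD[OF y] in \<open>auto intro!: mem\<close>)
    then have "nrm (x + y - (h + k)) < e" using h k by (simp add: algebra_simps)
    then show ?thesis using h k csubspaceD(2)[OF S(2)] by blast
  qed
  then show "x + y \<in> ip_closure V ip S"
    using x y mem by (auto simp: ip_closure_def)
next
  fix a x assume x: "x \<in> ip_closure V ip S"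
  have "\<exists>h\<in>S. nrm (a *\<^sub>C x - h) < e" if e: "e > 0" for e
  proof -
    have "e / (cmod a + 1) > 0" using e by (simp add: add_nonneg_pos)
    then obtain h where h: "h \<in> S" "nrm (x - h) < e/(cmod a + 1)"
      using ip_closureE[OF x] by blast
    have "a *\<^sub>C (x - h) = a *\<^sub>C x - a *\<^sub>C h"
      using module.scale_right_diff_distrib[OF module_scaleC] by blast
    moreover have m: "x - h \<in> V" using h(1) S(1) ip_closureD[OF x] by (auto intro!: mem)
    ultimately have "nrm (a *\<^sub>C x - a *\<^sub>C h) = cmod a * nrm (x - h)"
      by (metis nrm_scaleC)
    also have "\<dots> \<le> (cmod a + 1) * nrm (x - h)" using m by (simp add: mult_right_mono)
    also have "\<dots> < e"
      using h(2) pos_less_divide_eq[of "cmod a + 1"] by (simp add: add_nonneg_pos mult.commute)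
    finally show ?thesis using h csubspaceD(3)[OF S(2)] by blast
  qed
  then show "a *\<^sub>C x \<in> ip_closure V ip S"
    using x mem by (auto simp: ip_closure_def)
qed

lemma ip_closure_idem:
  assumes S: "S \<subseteq> V"
  shows "ip_closure V ip (ip_closure V ip S) \<subseteq> ip_closure V ip S"
proof
  fix x assume x: "x \<in> ip_closure V ip (ip_closure V ip S)"
  have "\<exists>h\<in>S. nrm (x - h) < e" if e: "e > 0" for e
  proof -
    obtain y where y: "y \<in> ip_closure V ip S" "nrm (x - y) < e/2"
      using ip_closureE[OF x half_gt_zero[OF e]] by blast
    obtain h where h: "h \<in> S" "nrm (y - h) < e/2"
      using ip_closureE[OF y(1) half_gt_zero[OF e]] by blast
    have "nrm (x - h) \<le> nrm (x - y) + nrm (y - h)"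
      by (rule nrm_triangle_sub) (use h(1) S ip_closureD[OF x] ip_closureD[OF y(1)] in \<open>auto intro!: mem\<close>)
    then show ?thesis using h y by force
  qed
  then show "x \<in> ip_closure V ip S"
    using x by (auto simp: ip_closure_def)
qed

end

locale semi_hilbert = semi_inner_space +
  assumes complete: "\<And>f :: nat \<Rightarrow> 'a. (\<And>n. f n \<in> V) \<Longrightarrow>
      (\<And>e. e > 0 \<Longrightarrow> \<exists>n0. \<forall>m\<ge>n0. \<forall>n\<ge>n0. ip_norm ip (f m - f n) < e) \<Longrightarrow>
      \<exists>l\<in>V. (\<lambda>n. ip_norm ip (f n - l)) \<longlonglongrightarrow> 0"
begin

definition closed_csubspace :: "'a set \<Rightarrow> bool"
  where "closed_csubspace F \<longleftrightarrow> F \<subseteq> V \<and> csubspace F \<and> ip_closure V ip F \<subseteq> F"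

lemma closed_csubspace_ip_closure:
  "S \<subseteq> V \<Longrightarrow> csubspace S \<Longrightarrow> closed_csubspace (ip_closure V ip S)"
  by (simp add: closed_csubspace_def ip_closure_subset csubspace_ip_closure ip_closure_idem)

text \<open>
  A sequence in \<open>F\<close> that minimises the distance to \<open>u\<close> is Cauchy by the parallelogram law, and its
  limit is the foot of the perpendicular.
\<close>

lemma projection_exists:
  assumes F: "closed_csubspace F" and u: "u \<in> V"
  shows "\<exists>p\<in>F. \<forall>v\<in>F. ip (u - p) v = 0"
proof -
  have FV: "v \<in> V" if "v \<in> F" for v using F that by (auto simp: closed_csubspace_def)
  have subF: "csubspace F" using F by (simp add: closed_csubspace_def)
  note Fm = csubspaceD[OF subF]
  define d where "d = (INF v\<in>F. (nrm (u - v))\<^sup>2)"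
  have bdd: "bdd_below ((\<lambda>v. (nrm (u - v))\<^sup>2) ` F)" by (rule bdd_belowI2[of _ 0]) simp
  have d_le: "d \<le> (nrm (u - v))\<^sup>2" if "v \<in> F" for v
    unfolding d_def by (rule cINF_lower[OF bdd that])
  have "\<exists>v\<in>F. (nrm (u - v))\<^sup>2 < d + 1 / real (Suc n)" for n
  proof -
    have "(INF v\<in>F. (nrm (u - v))\<^sup>2) < d + 1 / real (Suc n)" by (simp add: d_def)
    then show ?thesis using cINF_less_iff[OF _ bdd] Fm(1) by blast
  qed
  then obtain v where vF: "\<And>n. v n \<in> F" and v: "\<And>n. (nrm (u - v n))\<^sup>2 < d + 1 / real (Suc n)"
    by metis
  have cauchy: "(nrm (v m - v n))\<^sup>2 \<le> 2 / real (Suc m) + 2 / real (Suc n)" for m n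
  proof -
    have vm: "u - v m \<in> V" "u - v n \<in> V" using u vF FV mem by auto
    have par: "(nrm ((u - v n) + (u - v m)))\<^sup>2 + (nrm ((u - v n) - (u - v m)))\<^sup>2
        = 2 * (nrm (u - v m))\<^sup>2 + 2 * (nrm (u - v n))\<^sup>2"
      using nrm_square_add[OF vm(2,1)] nrm_square_diff[OF vm(2,1)] by linarith
    \<comment> \<open>The midpoint also lies in \<open>F\<close>, so its distance to \<open>u\<close> is at least the minimal one.\<close>
    define w where "w = (1/2) *\<^sub>C (v n + v m)"
    have wF: "w \<in> F" using vF Fm by (auto simp: w_def)
    have "2 *\<^sub>C w = v n + v m" by (simp add: w_def scaleC_scaleC scaleC_one)
    moreover have "2 *\<^sub>C u = u + u" using scaleC_add_left[of 1 1 u] by (simp add: scaleC_one)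
    moreover have "2 *\<^sub>C (u - w) = 2 *\<^sub>C u - 2 *\<^sub>C w"
      using module.scale_right_diff_distrib[OF module_scaleC] by blast
    ultimately have "(u - v n) + (u - v m) = 2 *\<^sub>C (u - w)" by (simp add: algebra_simps)
    then have "(nrm ((u - v n) + (u - v m)))\<^sup>2 = 4 * (nrm (u - w))\<^sup>2"
      using u FV[OF wF] mem by (simp add: nrm_scaleC power_mult_distrib)
    moreover have "(u - v n) - (u - v m) = v m - v n" by simp
    ultimately show ?thesis
      using par d_le[OF wF] v[of m] v[of n] by simp
  qed
  have "\<exists>p\<in>V. (\<lambda>n. nrm (v n - p)) \<longlonglongrightarrow> 0"
  proof (rule complete)
    show "v n \<in> V" for n using vF FV by auto
  next
    fix e :: real assume e: "e > 0"
    obtain n0 where n0: "4 / real (Suc n0) < e\<^sup>2"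
    proof -
      obtain n where "4 / e\<^sup>2 < real n" using reals_Archimedean2 by blast
      then have "4 / real (Suc n) < e\<^sup>2" using e by (simp add: field_simps) (smt (verit) zero_less_power)
      then show ?thesis using that by blast
    qed
    have "nrm (v m - v n) < e" if "m \<ge> n0" "n \<ge> n0" for m n
    proof -
      have "2 / real (Suc k) \<le> 2 / real (Suc n0)" if "k \<ge> n0" for k
        using that by (intro divide_left_mono) auto
      from this[OF that(1)] this[OF that(2)] have "(nrm (v m - v n))\<^sup>2 < e\<^sup>2"
        using cauchy[of m n] n0 by linarith
      then show ?thesis using e by (simp add: power2_less_imp_less)
    qed
    then show "\<exists>n0. \<forall>m\<ge>n0. \<forall>n\<ge>n0. nrm (v m - v n) < e" by blast
  qed
  then obtain p where p: "p \<in> V" "(\<lambda>n. nrm (v n - p)) \<longlonglongrightarrow> 0" by blast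
  have pF: "p \<in> F"
  proof -
    have "\<exists>h\<in>F. nrm (p - h) < e" if "e > 0" for e
    proof -
      have "\<forall>\<^sub>F n in sequentially. nrm (v n - p) < e" by (rule order_tendstoD(2)[OF p(2) that])
      then obtain n where "nrm (v n - p) < e" by (auto simp: eventually_sequentially)
      then show ?thesis using vF nrm_minus_commute[OF p(1) FV[OF vF]] by metis
    qed
    then have "p \<in> ip_closure V ip F" using p(1) by (simp add: ip_closure_def)
    then show ?thesis using F by (auto simp: closed_csubspace_def)
  qed
  have dp: "(nrm (u - p))\<^sup>2 \<le> d"
  proof -
    have "(nrm (u - p))\<^sup>2 \<le> (sqrt (d + 1 / real (Suc n)) + nrm (v n - p))\<^sup>2" for n
    proof (rule power_mono)
      have "nrm (u - v n) \<le> sqrt (d + 1 / real (Suc n))"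
        using v[of n] by (intro real_le_rsqrt) simp
      then show "nrm (u - p) \<le> sqrt (d + 1 / real (Suc n)) + nrm (v n - p)"
        using nrm_triangle_sub[of u "v n" p] u p FV[OF vF] by fastforce
    qed (use u p mem in auto)
    moreover have "(\<lambda>n. (sqrt (d + 1 / real (Suc n)) + nrm (v n - p))\<^sup>2) \<longlonglongrightarrow> (sqrt (d + 0) + 0)\<^sup>2"
      by (intro tendsto_intros p(2) LIMSEQ_inverse_real_of_nat[unfolded inverse_eq_divide])
    moreover have "0 \<le> d" unfolding d_def by (rule cINF_greatest) (use Fm(1) in auto)
    ultimately show ?thesis
      by (intro LIMSEQ_le_const[where X = "\<lambda>n. (sqrt (d + 1 / real (Suc n)) + nrm (v n - p))\<^sup>2"]) auto
  qed
  have "ip (u - p) w = 0" if w: "w \<in> F" for w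
  proof (rule ccontr)
    assume nz: "ip (u - p) w \<noteq> 0"
    define z where "z = ip (u - p) w"
    have up: "u - p \<in> V" and wV: "w \<in> V" using u p(1) mem w FV by auto
    \<comment> \<open>Moving \<open>p\<close> by \<open>s z w\<close> cannot decrease the distance; a suitable \<open>s > 0\<close> forces \<open>z = 0\<close>.\<close>
    have *: "2 * s * (cmod z)\<^sup>2 \<le> s\<^sup>2 * (cmod z)\<^sup>2 * (nrm w)\<^sup>2" for s :: real
    proof -
      define t where "t = complex_of_real s * z"
      have "p + t *\<^sub>C w \<in> F" using pF w Fm by auto
      then have "d \<le> (nrm (u - (p + t *\<^sub>C w)))\<^sup>2" by (rule d_le)
      also have "u - (p + t *\<^sub>C w) = (u - p) - t *\<^sub>C w" by simp
      also have "(nrm \<dots>)\<^sup>2 = (nrm (u - p))\<^sup>2 - 2 * Re (cnj t * z) + (cmod t)\<^sup>2 * (nrm w)\<^sup>2"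
        using up wV mem by (simp add: nrm_square_diff ip_scaleC_right nrm_scaleC power_mult_distrib z_def)
      also have "cnj t * z = complex_of_real (s * (cmod z)\<^sup>2)"
        using complex_norm_square[of z] by (simp add: t_def mult_ac)
      also have "(cmod t)\<^sup>2 = s\<^sup>2 * (cmod z)\<^sup>2"
        by (simp add: t_def norm_mult power_mult_distrib)
      finally show ?thesis using dp by simp
    qed
    have zpos: "(cmod z)\<^sup>2 > 0" using nz by (simp add: z_def)
    have **: "2 * s \<le> s\<^sup>2 * (nrm w)\<^sup>2" for s :: real
      using *[of s] zpos by (simp add: mult.assoc mult.left_commute[of _ "(cmod z)\<^sup>2"])
    show False
    proof (cases "nrm w = 0")
      case True then show False using **[of 1] by simp
    next
      case False
      define C where "C = (nrm w)\<^sup>2"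
      have "0 < C" using False by (simp add: C_def)
      then show False using **[of "1 / C", folded C_def]
        by (simp add: power2_eq_square divide_le_cancel)
    qed
  qed
  then show ?thesis using pF by blast
qed

lemma orth_proj:
  assumes F: "closed_csubspace F" and u: "u \<in> V"
  shows orth_proj_mem: "orth_proj ip F u \<in> F"
    and orth_proj_orthogonal: "v \<in> F \<Longrightarrow> ip (u - orth_proj ip F u) v = 0"
proof -
  have "\<exists>p. p \<in> F \<and> (\<forall>v\<in>F. ip (u - p) v = 0)"
    using projection_exists[OF assms] by blast
  from someI_ex[OF this]
  show "orth_proj ip F u \<in> F" "v \<in> F \<Longrightarrow> ip (u - orth_proj ip F u) v = 0"
    unfolding orth_proj_def by blast+
qed

lemma ip_orth_proj:
  assumes F: "closed_csubspace F" and u: "u \<in> V" and v: "v \<in> F"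
  shows "ip (orth_proj ip F u) v = ip u v"
proof -
  have "orth_proj ip F u \<in> V" "v \<in> V" using orth_proj_mem[OF F u] F v by (auto simp: closed_csubspace_def)
  then show ?thesis using orth_proj_orthogonal[OF F u v] ip_diff_left[OF u, of _ v] by simp
qed

lemma nrm_orth_proj_le_iff:
  assumes F: "closed_csubspace F" and u: "u \<in> V" and C: "0 \<le> C"
  shows "nrm (orth_proj ip F u) \<le> C * nrm u \<longleftrightarrow> (\<forall>v\<in>F. cmod (ip u v) \<le> C * nrm u * nrm v)"
proof
  let ?p = "orth_proj ip F u"
  have FV: "v \<in> V" if "v \<in> F" for v using F that by (auto simp: closed_csubspace_def)
  have p: "?p \<in> F" "?p \<in> V" using orth_proj_mem[OF F u] FV by auto
  {
    assume *: "nrm ?p \<le> C * nrm u"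
    show "\<forall>v\<in>F. cmod (ip u v) \<le> C * nrm u * nrm v"
    proof
      fix v assume v: "v \<in> F"
      have "cmod (ip u v) = cmod (ip ?p v)" using ip_orth_proj[OF F u v] by simp
      also have "\<dots> \<le> nrm ?p * nrm v" by (rule Cauchy_Schwarz[OF p(2) FV[OF v]])
      also have "\<dots> \<le> C * nrm u * nrm v" by (rule mult_right_mono[OF *]) (simp add: FV v)
      finally show "cmod (ip u v) \<le> C * nrm u * nrm v" .
    qed
  }
  {
    assume *: "\<forall>v\<in>F. cmod (ip u v) \<le> C * nrm u * nrm v"
    have "(nrm ?p)\<^sup>2 = Re (ip u ?p)"
      using p by (simp add: nrm_square ip_orth_proj[OF F u])
    also have "\<dots> \<le> C * nrm u * nrm ?p"
      using * p complex_Re_le_cmod order_trans by blast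
    finally have "nrm ?p * nrm ?p \<le> (C * nrm u) * nrm ?p" by (simp add: power2_eq_square)
    then show "nrm ?p \<le> C * nrm u"
      using p u C nrm_nonneg[OF p(2)] by (cases "nrm ?p = 0") (auto simp: mult_le_cancel_right)
  }
qed

lemma nrm_orth_proj_le:
  assumes F: "closed_csubspace F" and u: "u \<in> V"
  shows "nrm (orth_proj ip F u) \<le> nrm u"
proof -
  have "\<forall>v\<in>F. cmod (ip u v) \<le> 1 * nrm u * nrm v"
    using Cauchy_Schwarz[OF u] F by (auto simp: closed_csubspace_def)
  then show ?thesis using nrm_orth_proj_le_iff[OF F u, of 1] by simp
qed

text \<open>
  The norm of the projection of \<open>u\<close> onto \<open>F\<close> is the supremum of \<open>|\<langle>u,v\<rangle>|\<close> over the unit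
  ball of \<open>F\<close>.  All later statements about angles go through this bilinear form of the definition,
  which also covers the convention for zero subspaces.
\<close>

theorem sup_cos_angle_le_iff:
  assumes E: "E \<subseteq> V" and F: "closed_csubspace F"
  shows "sup_cos_angle ip E F \<le> C \<longleftrightarrow>
    0 \<le> C \<and> (\<forall>u\<in>E. \<forall>v\<in>F. cmod (ip u v) \<le> C * nrm u * nrm v)"
proof -
  have FV: "v \<in> V" if "v \<in> F" for v using F that by (auto simp: closed_csubspace_def)
  have EV: "v \<in> V" if "v \<in> E" for v using E that by auto
  show ?thesis
  proof (cases "(\<forall>u\<in>E. nrm u = 0) \<or> (\<forall>v\<in>F. nrm v = 0)")
    case True
    have "cmod (ip u v) \<le> C * nrm u * nrm v" if "u \<in> E" "v \<in> F" for u v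
    proof -
      have "nrm u = 0 \<or> nrm v = 0" using True that by blast
      then show ?thesis using Cauchy_Schwarz[OF EV[OF that(1)] FV[OF that(2)]] by auto
    qed
    then show ?thesis using True by (simp add: sup_cos_angle_def)
  next
    case False
    let ?E = "{u\<in>E. nrm u \<noteq> 0}"
    let ?r = "\<lambda>u. nrm (orth_proj ip F u) / nrm u"
    have ne: "?E \<noteq> {}" using False by blast
    have pos: "0 < nrm u" if "u \<in> ?E" for u using that EV nrm_nonneg[of u] by (simp add: order_less_le)
    have bdd: "bdd_above (?r ` ?E)"
    proof (rule bdd_aboveI2)
      fix u assume u: "u \<in> ?E"
      then show "?r u \<le> 1" using nrm_orth_proj_le[OF F, of u] EV pos[OF u] by simp
    qed
    have "sup_cos_angle ip E F = (SUP u\<in>?E. ?r u)"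
      unfolding sup_cos_angle_def using False by (rule if_not_P)
    then have 1: "sup_cos_angle ip E F \<le> C \<longleftrightarrow> (\<forall>u\<in>?E. ?r u \<le> C)"
      using cSUP_le_iff[OF ne bdd] by simp
    have r0: "0 \<le> ?r u" if "u \<in> ?E" for u
      using that EV FV orth_proj_mem[OF F, of u] by simp
    have 2: "(\<forall>u\<in>?E. ?r u \<le> C) \<longleftrightarrow> 0 \<le> C \<and> (\<forall>u\<in>?E. nrm (orth_proj ip F u) \<le> C * nrm u)"
    proof (cases "0 \<le> C")
      case True
      then show ?thesis using pos by (simp add: divide_le_eq)
    next
      case False
      then show ?thesis using r0 ne by fastforce
    qed
    have 3: "(\<forall>u\<in>?E. nrm (orth_proj ip F u) \<le> C * nrm u) \<longleftrightarrow>
        (\<forall>u\<in>?E. \<forall>v\<in>F. cmod (ip u v) \<le> C * nrm u * nrm v)" if "0 \<le> C"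
      using nrm_orth_proj_le_iff[OF F _ that] EV by blast
    have 4: "cmod (ip u v) \<le> C * nrm u * nrm v" if "u \<in> E" "v \<in> F" "u \<notin> ?E" for u v
      using Cauchy_Schwarz[OF EV FV, of u v] that by simp
    show ?thesis using 1 2 3 4 by blast
  qed
qed

lemma sup_cos_angle_nonneg: "E \<subseteq> V \<Longrightarrow> closed_csubspace F \<Longrightarrow> 0 \<le> sup_cos_angle ip E F"
  using sup_cos_angle_le_iff by blast

end


section \<open>The fibre Hilbert space\<close>

lemma norm_scaleC: "norm (a *\<^sub>C x) = cmod a * norm (x::'a::complex_hilbert)"
proof -
  have "cinner (a *\<^sub>C x) (a *\<^sub>C x) = a * cnj a * cinner x x"
    using cinner_commute[of x "a *\<^sub>C x"] cinner_commute[of x x] by (simp add: cinner_scaleC_left)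
  then have "complex_of_real ((norm (a *\<^sub>C x))\<^sup>2) = a * cnj a * complex_of_real ((norm x)\<^sup>2)"
    unfolding cinner_self .
  also have "a * cnj a = complex_of_real ((cmod a)\<^sup>2)"
    by (rule complex_norm_square[symmetric])
  finally have "(norm (a *\<^sub>C x))\<^sup>2 = (cmod a * norm x)\<^sup>2"
    unfolding of_real_mult[symmetric] of_real_eq_iff by (simp add: power_mult_distrib)
  then show ?thesis by simp
qed

lemma ip_norm_cinner [simp]: "ip_norm cinner x = norm (x::'a::complex_hilbert)"
  by (simp add: ip_norm_def cinner_self)

interpretation cip: semi_hilbert "UNIV :: 'a::complex_hilbert set" cinner
proof
  show "csubspace (UNIV :: 'a set)" by (simp add: csubspace_def)
  show "cinner x y = cnj (cinner y x)" for x y :: 'a by (rule cinner_commute)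
  show "cinner (x + y) z = cinner x z + cinner y z" for x y z :: 'a by (rule cinner_add_left)
  show "cinner (a *\<^sub>C x) y = a * cinner x y" for a and x y :: 'a by (rule cinner_scaleC_left)
  show "0 \<le> Re (cinner x x)" for x :: 'a by (simp add: cinner_self)
next
  fix f :: "nat \<Rightarrow> 'a"
  assume *: "\<And>e. e > 0 \<Longrightarrow> \<exists>n0. \<forall>m\<ge>n0. \<forall>n\<ge>n0. ip_norm cinner (f m - f n) < e"
  then have "Cauchy f" by (simp add: Cauchy_def dist_norm)
  then obtain l where "f \<longlonglongrightarrow> l" using Cauchy_convergent convergent_def by blast
  then show "\<exists>l\<in>UNIV. (\<lambda>n. ip_norm cinner (f n - l)) \<longlonglongrightarrow> 0"
    by (auto simp: LIM_zero_iff tendsto_norm_zero_iff)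
qed

lemmas cinner_add_right = cip.ip_add_right[simplified]
  and cinner_diff_left = cip.ip_diff_left[simplified]
  and cinner_diff_right = cip.ip_diff_right[simplified]
  and cinner_scaleC_right = cip.ip_scaleC_right[simplified]
  and cinner_Cauchy_Schwarz = cip.Cauchy_Schwarz[simplified]

lemma cinner_zero_left [simp]: "cinner 0 y = 0"
  using cinner_diff_left[of 0 0 y] by simp

lemma cinner_zero_right [simp]: "cinner y 0 = 0"
  using cinner_scaleC_right[of y 0 0] by simp

lemma bounded_bilinear_cinner: "bounded_bilinear (cinner :: 'a::complex_hilbert \<Rightarrow> 'a \<Rightarrow> complex)"
proof
  show "\<exists>K. \<forall>a b. norm (cinner a b) \<le> norm (a::'a) * norm b * K"
    using cinner_Cauchy_Schwarz by (intro exI[of _ 1]) auto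
qed (simp_all add: cinner_add_left cinner_add_right scaleR_scaleC cinner_scaleC_left
    cinner_scaleC_right scaleC_complex_def)

lemma bounded_bilinear_scaleC: "bounded_bilinear (scaleC :: complex \<Rightarrow> 'a::complex_hilbert \<Rightarrow> 'a)"
proof
  show "\<exists>K. \<forall>a b. norm (a *\<^sub>C b) \<le> norm a * norm (b::'a) * K"
    by (intro exI[of _ 1]) (simp add: norm_scaleC)
qed (simp_all add: scaleC_add_left scaleC_add_right scaleR_scaleC scaleC_scaleC mult.commute
    scaleC_complex_def)

lemmas continuous_on_cinner [continuous_intros] =
  bounded_bilinear.continuous_on[OF bounded_bilinear_cinner]
lemmas continuous_on_scaleC [continuous_intros] =
  bounded_bilinear.continuous_on[OF bounded_bilinear_scaleC]

lemma ip_closure_cinner: "ip_closure UNIV cinner S = closure (S :: 'a::complex_hilbert set)"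
  by (auto simp: ip_closure_def closure_approachable dist_norm norm_minus_commute)

lemma cip_closed_csubspace: "cip.closed_csubspace F \<longleftrightarrow> csubspace F \<and> closed F"
  by (auto simp: cip.closed_csubspace_def ip_closure_cinner closure_subset_eq)

lemma csubspace_closure: "csubspace S \<Longrightarrow> csubspace (closure (S :: 'a::complex_hilbert set))"
  using cip.csubspace_ip_closure[of S] by (simp add: ip_closure_cinner)

lemma csubspace_orthogonal: "csubspace {y. cinner z y = 0}"
  by (simp add: csubspace_def cinner_add_right cinner_scaleC_right)

lemma closed_orthogonal: "closed {y. cinner z y = 0}"
  by (intro closed_Collect_eq continuous_intros)

lemma orthogonal_closure_cspan:
  assumes "\<And>y. y \<in> S \<Longrightarrow> cinner z y = 0" and "w \<in> closure (cspan S)"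
  shows "cinner z w = 0"
proof -
  have "closure (cspan S) \<subseteq> {y. cinner z y = 0}"
    using assms(1) by (intro closure_minimal closed_orthogonal cspan_minimal csubspace_orthogonal) auto
  then show ?thesis using assms(2) by blast
qed

section \<open>Square-integrable functions\<close>

lemma borel_measurable_cinner [measurable (raw)]:
  fixes f h :: "'x \<Rightarrow> 'h::{complex_hilbert, second_countable_topology}"
  assumes "f \<in> borel_measurable M" "h \<in> borel_measurable M"
  shows "(\<lambda>x. cinner (f x) (h x)) \<in> borel_measurable M"
  by (rule borel_measurable_continuous_Pair[OF assms]) (intro continuous_intros)

lemma borel_measurable_scaleC [measurable (raw)]:
  fixes h :: "'x \<Rightarrow> 'h::{complex_hilbert, second_countable_topology}"
  assumes "f \<in> borel_measurable M" "h \<in> borel_measurable M"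
  shows "(\<lambda>x. f x *\<^sub>C h x) \<in> borel_measurable M"
  by (rule borel_measurable_continuous_Pair[OF assms]) (intro continuous_intros)

lemma L2_iff:
  "f \<in> L2 M \<longleftrightarrow> f \<in> borel_measurable M \<and> (\<integral>\<^sup>+x. ennreal ((norm (f x))\<^sup>2) \<partial>M) < \<infinity>"
  unfolding L2_def by (auto simp: integrable_iff_bounded)

lemma L2_measurable: "f \<in> L2 M \<Longrightarrow> f \<in> borel_measurable M"
  by (simp add: L2_def)

lemma L2_integrable_norm: "f \<in> L2 M \<Longrightarrow> integrable M (\<lambda>x. (norm (f x))\<^sup>2)"
  by (simp add: L2_def)

lemma L2_dominated:
  fixes f :: "'x \<Rightarrow> 'h::complex_hilbert" and h :: "'x \<Rightarrow> 'k::complex_hilbert"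
  assumes h: "h \<in> L2 M" and f: "f \<in> borel_measurable M"
    and le: "AE x in M. norm (f x) \<le> C * norm (h x)"
  shows "f \<in> L2 M"
proof -
  have "integrable M (\<lambda>x. C\<^sup>2 * (norm (h x))\<^sup>2)" using h by (simp add: L2_def)
  then have "integrable M (\<lambda>x. (norm (f x))\<^sup>2)"
  proof (rule Bochner_Integration.integrable_bound)
    show "(\<lambda>x. (norm (f x))\<^sup>2) \<in> borel_measurable M" using f by measurable
    show "AE x in M. norm ((norm (f x))\<^sup>2) \<le> norm (C\<^sup>2 * (norm (h x))\<^sup>2)"
      using le by eventually_elim (auto simp: power_mult_distrib[symmetric] intro: power_mono)
  qed
  then show ?thesis using f by (simp add: L2_def)
qed

lemma L2_add:
  fixes f h :: "'x \<Rightarrow> 'h::{complex_hilbert, second_countable_topology}"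
  assumes f: "f \<in> L2 M" and h: "h \<in> L2 M"
  shows "f + h \<in> L2 M"
proof -
  note [measurable] = L2_measurable[OF f] L2_measurable[OF h]
  have fh: "f + h \<in> borel_measurable M" unfolding plus_fun_def by measurable
  have "integrable M (\<lambda>x. 2 * (norm (f x))\<^sup>2 + 2 * (norm (h x))\<^sup>2)"
    using f h by (simp add: L2_def)
  then have "integrable M (\<lambda>x. (norm ((f + h) x))\<^sup>2)"
  proof (rule Bochner_Integration.integrable_bound)
    show "(\<lambda>x. (norm ((f + h) x))\<^sup>2) \<in> borel_measurable M" using fh by measurable
    have "(norm (a + b))\<^sup>2 \<le> 2 * (norm a)\<^sup>2 + 2 * (norm b)\<^sup>2" for a b :: 'h
    proof -
      have "(norm (a + b))\<^sup>2 \<le> (norm a + norm b)\<^sup>2" by (intro power_mono norm_triangle_ineq) auto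
      also have "\<dots> \<le> 2 * (norm a)\<^sup>2 + 2 * (norm b)\<^sup>2"
        using zero_le_power2[of "norm a - norm b"] by (simp add: power2_eq_square algebra_simps)
      finally show ?thesis .
    qed
    then show "AE x in M. norm ((norm ((f + h) x))\<^sup>2) \<le> norm (2 * (norm (f x))\<^sup>2 + 2 * (norm (h x))\<^sup>2)"
      by (simp add: plus_fun_def)
  qed
  then show ?thesis using fh by (simp add: L2_def)
qed

lemma integrable_cinner:
  fixes f h :: "'x \<Rightarrow> 'h::{complex_hilbert, second_countable_topology}"
  assumes f: "f \<in> L2 M" and h: "h \<in> L2 M"
  shows "integrable M (\<lambda>x. cinner (f x) (h x))"
proof -
  note [measurable] = L2_measurable[OF f] L2_measurable[OF h]
  have "integrable M (\<lambda>x. (norm (f x))\<^sup>2 + (norm (h x))\<^sup>2)"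
    using f h by (simp add: L2_def)
  then show ?thesis
  proof (rule Bochner_Integration.integrable_bound)
    have "cmod (cinner a b) \<le> (norm a)\<^sup>2 + (norm b)\<^sup>2" for a b :: 'h
      using cinner_Cauchy_Schwarz[of a b] sum_squares_bound[of "norm a" "norm b"]
        mult_nonneg_nonneg[OF norm_ge_zero[of a] norm_ge_zero[of b]] by linarith
    then show "AE x in M. norm (cinner (f x) (h x)) \<le> norm ((norm (f x))\<^sup>2 + (norm (h x))\<^sup>2)"
      by (intro AE_I2) (auto intro: order_trans[OF _ abs_ge_self])
  qed measurable
qed

lemma scaleC_fun_apply [simp]: "(a *\<^sub>C f) x = a *\<^sub>C f x"
  by (simp add: scaleC_fun_def)

lemma csubspace_L2: "csubspace (L2 M :: ('x \<Rightarrow> 'h::{complex_hilbert, second_countable_topology}) set)"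
  unfolding csubspace_def
proof (intro conjI ballI allI)
  show "(0 :: 'x \<Rightarrow> 'h) \<in> L2 M" by (simp add: L2_def zero_fun_def)
  show "a *\<^sub>C f \<in> L2 M" if f: "f \<in> L2 M" for a and f :: "'x \<Rightarrow> 'h"
  proof (rule L2_dominated[OF f, where C = "cmod a"])
    show "a *\<^sub>C f \<in> borel_measurable M"
      using L2_measurable[OF f] unfolding scaleC_fun_def by measurable
  qed (simp add: scaleC_fun_def norm_scaleC)
qed (rule L2_add)

lemma Re_L2_inner_self:
  fixes f :: "'x \<Rightarrow> 'h::complex_hilbert"
  shows "Re (L2_inner M f f) = (\<integral>x. (norm (f x))\<^sup>2 \<partial>M)"
  by (simp add: L2_inner_def cinner_self del: of_real_power)

interpretation L2: semi_inner_space "L2 M :: ('x \<Rightarrow> 'h::{complex_hilbert, second_countable_topology}) set" "L2_inner M"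
  for M
proof
  show "csubspace (L2 M :: ('x \<Rightarrow> 'h) set)" by (rule csubspace_L2)
next
  fix f h :: "'x \<Rightarrow> 'h"
  have "L2_inner M f h = (\<integral>x. cnj (cinner (h x) (f x)) \<partial>M)"
    unfolding L2_inner_def by (metis cinner_commute)
  then show "L2_inner M f h = cnj (L2_inner M h f)" by (simp add: L2_inner_def)
next
  fix f h k :: "'x \<Rightarrow> 'h" assume "f \<in> L2 M" "h \<in> L2 M" "k \<in> L2 M"
  then show "L2_inner M (f + h) k = L2_inner M f k + L2_inner M h k"
    by (simp add: L2_inner_def cinner_add_left integrable_cinner)
next
  fix a and f h :: "'x \<Rightarrow> 'h"
  show "L2_inner M (a *\<^sub>C f) h = a * L2_inner M f h"
    by (simp add: L2_inner_def scaleC_fun_def cinner_scaleC_left)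
next
  show "0 \<le> Re (L2_inner M f f)" for f :: "'x \<Rightarrow> 'h" by (simp add: Re_L2_inner_self)
qed

lemma L2_norm_square:
  fixes f :: "'x \<Rightarrow> 'h::{complex_hilbert, second_countable_topology}"
  assumes "f \<in> L2 M"
  shows "ennreal ((ip_norm (L2_inner M) f)\<^sup>2) = (\<integral>\<^sup>+x. ennreal ((norm (f x))\<^sup>2) \<partial>M)"
  using assms by (simp add: L2.nrm_square Re_L2_inner_self L2_integrable_norm nn_integral_eq_integral)

lemma convergent_if_geometric_steps:
  fixes u :: "nat \<Rightarrow> 'h::banach"
  assumes "\<And>k. norm (u (Suc k) - u k) \<le> C * (1/2) ^ k"
  shows "convergent u"
proof -
  have "summable (\<lambda>k. C * (1/2) ^ k :: real)" by (intro summable_mult summable_geometric) simp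
  then have "summable (\<lambda>k. u (Suc k) - u k)"
    by (rule summable_comparison_test[rotated]) (use assms in auto)
  then obtain s where "(\<lambda>n. \<Sum>k<n. u (Suc k) - u k) \<longlonglongrightarrow> s"
    using summable_LIMSEQ by blast
  then have "(\<lambda>n. u n - u 0) \<longlonglongrightarrow> s" by (simp add: sum_lessThan_telescope)
  then have "(\<lambda>n. (u n - u 0) + u 0) \<longlonglongrightarrow> s + u 0" by (intro tendsto_intros)
  then show ?thesis by (auto simp: convergent_def)
qed

text \<open>
  The heart of the Riesz--Fischer theorem.  The increments satisfy
  \<open>\<Sum>\<^sub>k 4\<^sup>k \<parallel>u\<^sub>k\<^sub>+\<^sub>1 - u\<^sub>k\<parallel>\<^sup>2 < \<infinity>\<close>, so at almost every point
  \<open>\<Sum>\<^sub>k 4\<^sup>k \<parallel>u\<^sub>k\<^sub>+\<^sub>1(x) - u\<^sub>k(x)\<parallel>\<^sup>2\<close> is finite and the pointwise increments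
  decay geometrically.
\<close>

lemma AE_convergent_L2:
  fixes u :: "nat \<Rightarrow> 'x \<Rightarrow> 'h::{complex_hilbert, second_countable_topology}"
  assumes u: "\<And>k. u k \<in> L2 M"
    and steps: "\<And>k. ip_norm (L2_inner M) (u (Suc k) - u k) \<le> (1/4) ^ k"
  shows "AE x in M. convergent (\<lambda>k. u k x)"
proof -
  note [measurable] = L2_measurable[OF u]
  define d where "d k x = ennreal (4 ^ k * (norm (u (Suc k) x - u k x))\<^sup>2)" for k x
  have [measurable]: "d k \<in> borel_measurable M" for k unfolding d_def by measurable
  have int_d: "(\<integral>\<^sup>+x. d k x \<partial>M) \<le> ennreal ((1/2) ^ k)" for k
  proof -
    have m: "u (Suc k) - u k \<in> L2 M" using u by (intro L2.mem)
    have "(\<integral>\<^sup>+x. d k x \<partial>M) = (\<integral>\<^sup>+x. ennreal (4 ^ k) * ennreal ((norm ((u (Suc k) - u k) x))\<^sup>2) \<partial>M)"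
      by (simp add: d_def ennreal_mult')
    also have "\<dots> = ennreal (4 ^ k) * ennreal ((ip_norm (L2_inner M) (u (Suc k) - u k))\<^sup>2)"
      unfolding L2_norm_square[OF m] by (rule nn_integral_cmult) (simp, measurable)
    also have "\<dots> \<le> ennreal (4 ^ k) * ennreal (((1/4) ^ k)\<^sup>2)"
      using steps[of k] m by (intro mult_left_mono ennreal_leI power_mono) auto
    also have "\<dots> = ennreal ((1/4) ^ k)"
      by (simp add: ennreal_mult'[symmetric] power2_eq_square power_divide)
    also have "\<dots> \<le> ennreal ((1/2) ^ k)" by (intro ennreal_leI power_mono) auto
    finally show ?thesis .
  qed
  have "(\<integral>\<^sup>+x. (\<Sum>k. d k x) \<partial>M) = (\<Sum>k. \<integral>\<^sup>+x. d k x \<partial>M)"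
    by (rule nn_integral_suminf) measurable
  also have "\<dots> \<le> (\<Sum>k. ennreal ((1/2) ^ k))"
    by (rule suminf_le[OF int_d]) auto
  also have "\<dots> = ennreal (\<Sum>k. (1/2) ^ k)"
    by (rule suminf_ennreal2) (auto intro: summable_geometric)
  also have "\<dots> < \<infinity>" by simp
  finally have "(\<integral>\<^sup>+x. (\<Sum>k. d k x) \<partial>M) \<noteq> \<infinity>" by simp
  then have "AE x in M. (\<Sum>k. d k x) \<noteq> \<infinity>"
    by (intro nn_integral_PInf_AE) measurable
  then show ?thesis
  proof eventually_elim
    fix x assume "(\<Sum>k. d k x) \<noteq> \<infinity>"
    then obtain C where C: "0 \<le> C" "(\<Sum>k. d k x) = ennreal C"
      by (cases "\<Sum>k. d k x") auto
    have "norm (u (Suc k) x - u k x) \<le> sqrt C * (1/2) ^ k" for k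
    proof -
      have "d k x \<le> ennreal C"
        using sum_le_suminf[of "\<lambda>k. d k x" "{k}"] C(2) by simp
      then have "4 ^ k * (norm (u (Suc k) x - u k x))\<^sup>2 \<le> C" using C(1) by (simp add: d_def)
      moreover have "((2::real) ^ k)\<^sup>2 = 4 ^ k" by (simp add: power2_eq_square flip: power_mult_distrib)
      ultimately have "(2 ^ k * norm (u (Suc k) x - u k x))\<^sup>2 \<le> C"
        by (simp add: power_mult_distrib)
      then have "2 ^ k * norm (u (Suc k) x - u k x) \<le> sqrt C" by (rule real_le_rsqrt)
      then show ?thesis by (simp add: power_divide field_simps)
    qed
    then show "convergent (\<lambda>k. u k x)" by (rule convergent_if_geometric_steps)
  qed
qed

text \<open>
  A subsequence of a Cauchy sequence converges almost everywhere; Fatou's lemma shows that the pointwise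
  limit is the limit in norm of the whole sequence.
\<close>

interpretation L2: semi_hilbert "L2 M :: ('x \<Rightarrow> 'h::{complex_hilbert, second_countable_topology}) set" "L2_inner M"
  for M
proof
  fix f :: "nat \<Rightarrow> 'x \<Rightarrow> 'h"
  assume f: "\<And>n. f n \<in> L2 M"
    and cauchy: "\<And>e. e > 0 \<Longrightarrow> \<exists>n0. \<forall>m\<ge>n0. \<forall>n\<ge>n0. ip_norm (L2_inner M) (f m - f n) < e"
  let ?n = "ip_norm (L2_inner M)"
  have "\<exists>n0. \<forall>m\<ge>n0. \<forall>n\<ge>n0. ?n (f m - f n) < (1/4) ^ k" for k :: nat by (rule cauchy) simp
  then obtain r0 where r0: "\<And>k m n. r0 k \<le> m \<Longrightarrow> r0 k \<le> n \<Longrightarrow> ?n (f m - f n) < (1/4) ^ k"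
    by metis
  \<comment> \<open>Summing makes the indices monotone in \<open>k\<close>, while still \<open>r0 k \<le> r k\<close>.\<close>
  define r where "r k = (\<Sum>j\<le>k. r0 j)" for k
  have r_ge: "r0 j \<le> r k" if "j \<le> k" for j k
    unfolding r_def using that by (intro member_le_sum) auto
  define u where "u k = f (r k)" for k
  have u: "u k \<in> L2 M" for k by (simp add: u_def f)
  note [measurable] = L2_measurable[OF f] L2_measurable[OF u]
  have "?n (u (Suc k) - u k) \<le> (1/4) ^ k" for k
    using r0[of k "r (Suc k)" "r k"] r_ge by (simp add: u_def less_imp_le)
  then have ae: "AE x in M. convergent (\<lambda>k. u k x)" by (rule AE_convergent_L2[OF u])
  define l where "l x = lim (\<lambda>k. u k x)" for x
  have [measurable]: "l \<in> borel_measurable M" unfolding l_def by measurable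
  have bound: "(\<integral>\<^sup>+x. ennreal ((norm (f n x - l x))\<^sup>2) \<partial>M) \<le> ennreal (((1/4) ^ k)\<^sup>2)"
    if "r0 k \<le> n" for n k
  proof -
    have "(\<integral>\<^sup>+x. ennreal ((norm (f n x - l x))\<^sup>2) \<partial>M)
        = (\<integral>\<^sup>+x. liminf (\<lambda>j. ennreal ((norm (f n x - u j x))\<^sup>2)) \<partial>M)"
    proof (rule nn_integral_cong_AE, use ae in eventually_elim)
      fix x assume "convergent (\<lambda>k. u k x)"
      then have "(\<lambda>k. u k x) \<longlonglongrightarrow> l x" by (simp add: l_def convergent_LIMSEQ_iff)
      then have "(\<lambda>j. ennreal ((norm (f n x - u j x))\<^sup>2)) \<longlonglongrightarrow> ennreal ((norm (f n x - l x))\<^sup>2)"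
        by (intro tendsto_intros)
      then show "ennreal ((norm (f n x - l x))\<^sup>2) = liminf (\<lambda>j. ennreal ((norm (f n x - u j x))\<^sup>2))"
        by (rule lim_imp_Liminf[OF sequentially_bot, symmetric])
    qed
    also have "\<dots> \<le> liminf (\<lambda>j. \<integral>\<^sup>+x. ennreal ((norm (f n x - u j x))\<^sup>2) \<partial>M)"
      by (rule nn_integral_liminf) measurable
    also have "\<dots> \<le> liminf (\<lambda>j. ennreal (((1/4) ^ k)\<^sup>2))"
    proof (rule Liminf_mono, unfold eventually_sequentially, intro exI[of _ k] allI impI)
      fix j assume j: "k \<le> j"
      have m: "f n - u j \<in> L2 M" using f u by (intro L2.mem)
      have "ennreal ((?n (f n - u j))\<^sup>2) \<le> ennreal (((1/4) ^ k)\<^sup>2)"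
        using r0[of k n "r j"] that r_ge[OF j] m unfolding u_def
        by (intro ennreal_leI power_mono) (auto simp: less_imp_le)
      then show "(\<integral>\<^sup>+x. ennreal ((norm (f n x - u j x))\<^sup>2) \<partial>M) \<le> ennreal (((1/4) ^ k)\<^sup>2)"
        by (simp add: L2_norm_square[OF m])
    qed
    also have "\<dots> = ennreal (((1/4) ^ k)\<^sup>2)" by (rule Liminf_const) simp
    finally show ?thesis .
  qed
  have fl: "f n - l \<in> L2 M" if "r0 0 \<le> n" for n
    unfolding L2_iff using le_less_trans[OF bound[OF that]] by (simp add: fun_diff_def)
  have l: "l \<in> L2 M"
  proof -
    have "f (r0 0) - (f (r0 0) - l) \<in> L2 M" by (rule L2.mem(5)[OF f fl[OF order_refl]])
    then show ?thesis by simp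
  qed
  have "(\<lambda>n. ?n (f n - l)) \<longlonglongrightarrow> 0"
  proof (rule LIMSEQ_I)
    fix e :: real assume e: "0 < e"
    obtain k :: nat where k: "(1/4) ^ k < e" using real_arch_pow_inv[OF e, of "1/4"] by auto
    have "norm (?n (f n - l) - 0) < e" if n: "r0 k \<le> n" for n
    proof -
      have m: "f n - l \<in> L2 M" using f l by (intro L2.mem)
      have "ennreal ((?n (f n - l))\<^sup>2) \<le> ennreal (((1/4) ^ k)\<^sup>2)"
        using bound[OF n] by (simp add: L2_norm_square[OF m])
      then have "(?n (f n - l))\<^sup>2 \<le> ((1/4) ^ k)\<^sup>2" by simp
      then have "?n (f n - l) \<le> (1/4) ^ k" by (rule power2_le_imp_le) simp
      then show ?thesis using k m by simp
    qed
    then show "\<exists>n0. \<forall>n\<ge>n0. norm (?n (f n - l) - 0) < e" by blast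
  qed
  then show "\<exists>l\<in>L2 M. (\<lambda>n. ?n (f n - l)) \<longlonglongrightarrow> 0" using l by blast
qed

section \<open>Square-summable families\<close>

text \<open>
  Square-summable families are the square-integrable functions for the counting measure, extended by
  \<open>0\<close> outside the index set; the inner product space axioms are inherited.
\<close>

lemma ell2_iff_L2: "c \<in> ell2 I \<longleftrightarrow> (\<forall>i. i \<notin> I \<longrightarrow> c i = 0) \<and> c \<in> L2 (count_space I)"
proof -
  have "(\<lambda>i. (cmod (c i))\<^sup>2) summable_on I \<longleftrightarrow> integrable (count_space I) (\<lambda>i. (cmod (c i))\<^sup>2)"
    using abs_summable_equivalent[of "\<lambda>i. (cmod (c i))\<^sup>2" I]
    by (simp add: Infinite_Set_Sum.abs_summable_on_def)
  then show ?thesis by (simp add: ell2_def L2_def)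
qed

lemma ell2_inner_eq_L2_inner:
  assumes "c \<in> ell2 I" "d \<in> ell2 I"
  shows "ell2_inner I c d = L2_inner (count_space I) c d"
proof -
  have "integrable (count_space I) (\<lambda>i. c i * cnj (d i))"
    using integrable_cinner[of c "count_space I" d] assms by (simp add: ell2_iff_L2 cinner_complex_def)
  then have "Infinite_Set_Sum.abs_summable_on (\<lambda>i. c i * cnj (d i)) I"
    by (simp add: Infinite_Set_Sum.abs_summable_on_def)
  then show ?thesis
    using infsetsum_infsum[of "\<lambda>i. c i * cnj (d i)" I]
    unfolding ell2_inner_def L2_inner_def infsetsum_def
    by (simp add: cinner_complex_def)
qed

interpretation ell2: semi_inner_space "ell2 I" "ell2_inner I" for I :: "'i set"
proof
  show sub: "csubspace (ell2 I)"
    using csubspaceD[OF csubspace_L2[of "count_space I"]]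
    by (auto simp: csubspace_def ell2_iff_L2)
  note mem = csubspaceD[OF sub]
  note ell2_L2 = ell2_inner_eq_L2_inner[where I = I] ell2_iff_L2[of _ I]
  fix c d e :: "'i \<Rightarrow> complex" and a :: complex
  assume c: "c \<in> ell2 I"
  show "0 \<le> Re (ell2_inner I c c)" using c by (simp add: ell2_L2(1) Re_L2_inner_self)
  assume d: "d \<in> ell2 I"
  show "ell2_inner I c d = cnj (ell2_inner I d c)"
    using c d L2.ip_commute[of c "count_space I" d] by (simp add: ell2_L2)
  have "ell2_inner I (a *\<^sub>C c) d = L2_inner (count_space I) (a *\<^sub>C c) d"
    using c d mem by (intro ell2_L2)
  then show "ell2_inner I (a *\<^sub>C c) d = a * ell2_inner I c d"
    using c d L2.ip_scaleC_left[of c "count_space I" d] by (simp add: ell2_L2)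
  assume e: "e \<in> ell2 I"
  have "ell2_inner I (c + d) e = L2_inner (count_space I) (c + d) e"
    using c d e mem by (intro ell2_L2)
  then show "ell2_inner I (c + d) e = ell2_inner I c e + ell2_inner I d e"
    using c d e L2.ip_add_left[of c "count_space I" d e] by (simp add: ell2_L2)
qed

lemma ell2_norm_square:
  assumes "c \<in> ell2 I" shows "(ip_norm (ell2_inner I) c)\<^sup>2 = (\<Sum>\<^sub>\<infinity>i\<in>I. (cmod (c i))\<^sup>2)"
proof -
  have "ell2_inner I c c = (\<Sum>\<^sub>\<infinity>i\<in>I. complex_of_real ((cmod (c i))\<^sup>2))"
    by (simp only: ell2_inner_def complex_norm_square)
  also have "\<dots> = complex_of_real (\<Sum>\<^sub>\<infinity>i\<in>I. (cmod (c i))\<^sup>2)"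
    using assms unfolding ell2_def
    by (intro infsumI has_sum_of_real_iff[THEN iffD2] has_sum_infsum) simp
  finally show ?thesis using ell2.nrm_square[OF assms] by simp
qed


section \<open>Fibres of a generated space\<close>

lemma csubspace_range_fun: "csubspace (range_fun I \<phi> x)"
  unfolding range_fun_def by (intro csubspace_closure csubspace_cspan)

lemma closed_csubspace_range_fun: "cip.closed_csubspace (range_fun I \<phi> x)"
  by (simp add: cip_closed_csubspace csubspace_range_fun) (simp add: range_fun_def)

lemma generator_in_range_fun: "i \<in> I \<Longrightarrow> \<phi> i x \<in> range_fun I \<phi> x"
  unfolding range_fun_def by (intro subsetD[OF closure_subset] module.span_base[OF module_scaleC]) auto

lemma orthogonal_range_fun:
  assumes "\<And>i. i \<in> I \<Longrightarrow> cinner z (\<phi> i x) = 0" and "w \<in> range_fun I \<phi> x"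
  shows "cinner z w = 0"
  using assms orthogonal_closure_cspan[of "{\<phi> i x |i. i \<in> I}" z w] by (auto simp: range_fun_def)

lemma L2_mult_op:
  fixes f :: "'x \<Rightarrow> 'h::{complex_hilbert, second_countable_topology}"
  assumes h: "h \<in> Linf M" and f: "f \<in> L2 M"
  shows "mult_op h f \<in> L2 M"
proof -
  obtain C where C: "AE x in M. cmod (h x) \<le> C" using h by (auto simp: Linf_def)
  show ?thesis
  proof (rule L2_dominated[OF f, where C = C])
    have [measurable]: "h \<in> borel_measurable M" "f \<in> borel_measurable M"
      using h L2_measurable[OF f] by (auto simp: Linf_def)
    show "mult_op h f \<in> borel_measurable M" unfolding mult_op_def by measurable
    show "AE x in M. norm (mult_op h f x) \<le> C * norm (f x)"
      using C by eventually_elim (simp add: mult_op_def norm_scaleC mult_right_mono)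
  qed
qed

lemma L2_inner_mult_op: "L2_inner M f (mult_op h k) = (\<integral>x. cinner (f x) (k x) * cnj (h x) \<partial>M)"
  by (simp add: L2_inner_def mult_op_def cinner_scaleC_right mult.commute)

text \<open>
  The left-hand side of the Parseval identity for the integrable function
  \<open>x \<mapsto> \<langle>f(x),k(x)\<rangle>\<close> is zero.
\<close>

lemma AE_orthogonal_if_orthogonal_multiples:
  fixes f k :: "'x \<Rightarrow> 'h::{complex_hilbert, second_countable_topology}"
  assumes pd: "parseval_determining M N g" and f: "f \<in> L2 M" and k: "k \<in> L2 M"
    and orth: "\<And>s. s \<in> space N \<Longrightarrow> L2_inner M f (mult_op (g s) k) = 0"
  shows "AE x in M. cinner (f x) (k x) = 0"
proof -
  have int: "integrable M (\<lambda>x. cinner (f x) (k x))" by (rule integrable_cinner[OF f k])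
  have "(\<integral>\<^sup>+x. ennreal ((cmod (cinner (f x) (k x)))\<^sup>2) \<partial>M)
      = (\<integral>\<^sup>+s. ennreal ((cmod (\<integral>x. cinner (f x) (k x) * cnj (g s x) \<partial>M))\<^sup>2) \<partial>N)"
    using pd int unfolding parseval_determining_def by simp
  also have "\<dots> = (\<integral>\<^sup>+s. 0 \<partial>N)"
    by (rule nn_integral_cong) (simp add: orth[unfolded L2_inner_mult_op])
  finally have "(\<integral>\<^sup>+x. ennreal ((cmod (cinner (f x) (k x)))\<^sup>2) \<partial>M) = 0" by simp
  then have "AE x in M. ennreal ((cmod (cinner (f x) (k x)))\<^sup>2) = 0"
    using int by (subst (asm) nn_integral_0_iff_AE) auto
  then show ?thesis by eventually_elim simp
qed

lemma cspan_generated_system_subset_L2: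
  fixes \<phi> :: "'i \<Rightarrow> 'x \<Rightarrow> 'h::{complex_hilbert, second_countable_topology}"
  assumes "parseval_determining M N g" and "\<And>i. i \<in> I \<Longrightarrow> \<phi> i \<in> L2 M"
  shows "cspan (generated_system N g I \<phi>) \<subseteq> L2 M"
  by (intro cspan_minimal csubspace_L2)
    (use assms in \<open>auto simp: generated_system_def parseval_determining_def intro!: L2_mult_op\<close>)

lemma closed_csubspace_generated_space:
  fixes \<phi> :: "'i \<Rightarrow> 'x \<Rightarrow> 'h::{complex_hilbert, second_countable_topology}"
  assumes "parseval_determining M N g" and "\<And>i. i \<in> I \<Longrightarrow> \<phi> i \<in> L2 M"
  shows "L2.closed_csubspace M (generated_space M N g I \<phi>)"
  unfolding generated_space_def
  by (intro L2.closed_csubspace_ip_closure cspan_generated_system_subset_L2 csubspace_cspan assms)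

text \<open>
  Elements of the algebraic span take values in the span of the generators at every point.  If \<open>h\<^sub>n\<close>
  are such elements with \<open>h\<^sub>n \<rightarrow> f\<close> in norm, then \<open>\<integral> inf\<^sub>n \<parallel>f - h\<^sub>n\<parallel>\<^sup>2 = 0\<close>, so
  \<open>f(x)\<close> lies almost everywhere in the closure of \<open>{h\<^sub>n(x). n}\<close>.
\<close>

lemma AE_range_fun_if_generated_space:
  fixes \<phi> :: "'i \<Rightarrow> 'x \<Rightarrow> 'h::{complex_hilbert, second_countable_topology}"
  assumes pd: "parseval_determining M N g" and \<phi>: "\<And>i. i \<in> I \<Longrightarrow> \<phi> i \<in> L2 M"
    and f: "f \<in> generated_space M N g I \<phi>"
  shows "AE x in M. f x \<in> range_fun I \<phi> x"
proof -
  let ?S = "cspan (generated_system N g I \<phi>)"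
  have fL2: "f \<in> L2 M" using f by (simp add: generated_space_def ip_closure_def)
  have "?S \<subseteq> {h. \<forall>x. h x \<in> cspan {\<phi> i x |i. i \<in> I}}"
  proof (rule cspan_minimal)
    show "csubspace {h. \<forall>x. h x \<in> cspan {\<phi> i x |i. i \<in> I}}"
      by (auto simp: csubspace_def intro!: csubspaceD(1-3)[OF csubspace_cspan])
    show "generated_system N g I \<phi> \<subseteq> {h. \<forall>x. h x \<in> cspan {\<phi> i x |i. i \<in> I}}"
      by (auto simp: generated_system_def mult_op_def
          intro!: csubspaceD(3)[OF csubspace_cspan module.span_base[OF module_scaleC]])
  qed
  then have S_fibre: "h x \<in> cspan {\<phi> i x |i. i \<in> I}" if "h \<in> ?S" for h x using that by blast
  have "\<exists>h\<in>?S. ip_norm (L2_inner M) (f - h) < 1 / real (Suc n)" for n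
    using f by (simp add: generated_space_def ip_closure_def)
  then obtain h where h: "\<And>n. h n \<in> ?S"
      and fh: "\<And>n. ip_norm (L2_inner M) (f - h n) < 1 / real (Suc n)" by metis
  have "?S \<subseteq> L2 M" by (rule cspan_generated_system_subset_L2[where I = I and \<phi> = \<phi>, OF pd \<phi>])
  then have hL2: "h n \<in> L2 M" for n using h by auto
  note [measurable] = L2_measurable[OF fL2] L2_measurable[OF hL2]
  define e where "e x = (INF n. ennreal ((norm (f x - h n x))\<^sup>2))" for x
  have [measurable]: "e \<in> borel_measurable M"
    unfolding e_def by (intro borel_measurable_INF) (simp, measurable)
  have "(\<integral>\<^sup>+x. e x \<partial>M) \<le> ennreal ((1 / real (Suc n))\<^sup>2)" for n
  proof -
    have d: "f - h n \<in> L2 M" by (rule L2.mem(5)[OF fL2 hL2])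
    have "(\<integral>\<^sup>+x. e x \<partial>M) \<le> (\<integral>\<^sup>+x. ennreal ((norm ((f - h n) x))\<^sup>2) \<partial>M)"
      unfolding e_def by (intro nn_integral_mono INF_lower2[of n]) auto
    also have "\<dots> = ennreal ((ip_norm (L2_inner M) (f - h n))\<^sup>2)" by (rule L2_norm_square[OF d, symmetric])
    also have "\<dots> \<le> ennreal ((1 / real (Suc n))\<^sup>2)"
      using fh[of n] d by (intro ennreal_leI power_mono) auto
    finally show ?thesis .
  qed
  moreover have "(\<lambda>n. ennreal ((1 / real (Suc n))\<^sup>2)) \<longlonglongrightarrow> ennreal (0\<^sup>2)"
    by (intro tendsto_intros LIMSEQ_inverse_real_of_nat[unfolded inverse_eq_divide])
  ultimately have "(\<integral>\<^sup>+x. e x \<partial>M) \<le> ennreal (0\<^sup>2)"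
    by (intro LIMSEQ_le_const[of "\<lambda>n. ennreal ((1 / real (Suc n))\<^sup>2)"]) auto
  then have "AE x in M. e x = 0" by (simp add: nn_integral_0_iff_AE)
  then show ?thesis
  proof eventually_elim
    fix x assume e0: "e x = 0"
    show "f x \<in> range_fun I \<phi> x"
      unfolding range_fun_def closure_approachable
    proof (intro allI impI)
      fix r :: real assume r: "0 < r"
      have "e x < ennreal (r\<^sup>2)" using r by (simp add: e0)
      then obtain n where "ennreal ((norm (f x - h n x))\<^sup>2) < ennreal (r\<^sup>2)"
        by (auto simp: e_def INF_less_iff)
      then have "(norm (f x - h n x))\<^sup>2 < r\<^sup>2" by (simp add: ennreal_less_iff)
      then have "norm (f x - h n x) < r" by (rule power2_less_imp_less) (use r in simp)
      then show "\<exists>y\<in>cspan {\<phi> i x |i. i \<in> I}. dist y (f x) < r"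
        using S_fibre[OF h] by (intro bexI[of _ "h n x"]) (auto simp: dist_norm norm_minus_commute)
    qed
  qed
qed

text \<open>
  The generated space is closed under everything that can be done fibre by fibre, in particular under
  multiplication by measurable scalars as long as the result is square-integrable.  For the direction
  from right to left, the difference of \<open>f\<close> and its projection onto the generated space is
  almost everywhere both in the fibre and orthogonal to it.
\<close>

theorem generated_space_iff:
  fixes \<phi> :: "'i \<Rightarrow> 'x \<Rightarrow> 'h::{complex_hilbert, second_countable_topology}"
  assumes pd: "parseval_determining M N g" and I: "countable I" and \<phi>: "\<And>i. i \<in> I \<Longrightarrow> \<phi> i \<in> L2 M"
  shows "f \<in> generated_space M N g I \<phi> \<longleftrightarrow> f \<in> L2 M \<and> (AE x in M. f x \<in> range_fun I \<phi> x)"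
proof
  assume "f \<in> generated_space M N g I \<phi>"
  then show "f \<in> L2 M \<and> (AE x in M. f x \<in> range_fun I \<phi> x)"
    using AE_range_fun_if_generated_space[where I = I and \<phi> = \<phi>, OF pd \<phi>] by (simp add: generated_space_def ip_closure_def)
next
  assume "f \<in> L2 M \<and> (AE x in M. f x \<in> range_fun I \<phi> x)"
  then have f: "f \<in> L2 M" and f_fibre: "AE x in M. f x \<in> range_fun I \<phi> x" by auto
  let ?S = "generated_space M N g I \<phi>"
  have cl: "L2.closed_csubspace M ?S" by (rule closed_csubspace_generated_space[OF pd \<phi>])
  obtain p where p: "p \<in> ?S" and orth: "\<And>v. v \<in> ?S \<Longrightarrow> L2_inner M (f - p) v = 0"
    using L2.projection_exists[OF cl f] by blast
  have pL2: "p \<in> L2 M" using p by (simp add: generated_space_def ip_closure_def)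
  have d: "f - p \<in> L2 M" by (rule L2.mem(5)[OF f pL2])
  have "mult_op (g s) (\<phi> i) \<in> ?S" if "s \<in> space N" "i \<in> I" for s i
    unfolding generated_space_def
    by (intro subsetD[OF L2.ip_closure_mono[OF cspan_generated_system_subset_L2[where I = I and \<phi> = \<phi>, OF pd \<phi>]]]
        module.span_base[OF module_scaleC]) (use that in \<open>auto simp: generated_system_def\<close>)
  then have "AE x in M. cinner ((f - p) x) (\<phi> i x) = 0" if "i \<in> I" for i
    using that by (intro AE_orthogonal_if_orthogonal_multiples[OF pd d \<phi>] orth)
  then have "AE x in M. \<forall>i\<in>I. cinner ((f - p) x) (\<phi> i x) = 0"
    by (simp add: AE_ball_countable[OF I])
  moreover have "AE x in M. p x \<in> range_fun I \<phi> x"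
    by (rule AE_range_fun_if_generated_space[OF pd \<phi> p])
  ultimately have ae: "AE x in M. norm ((f - p) x) = 0"
    using f_fibre
  proof eventually_elim
    case (elim x)
    have "f x - p x \<in> range_fun I \<phi> x"
      by (rule csubspaceD(5)[OF csubspace_range_fun]) (use elim in auto)
    then have "cinner (f x - p x) (f x - p x) = 0"
      by (rule orthogonal_range_fun[rotated]) (use elim in auto)
    then show ?case by (simp add: cinner_self)
  qed
  have "(\<integral>\<^sup>+x. ennreal ((norm ((f - p) x))\<^sup>2) \<partial>M) = (\<integral>\<^sup>+x. 0 \<partial>M)"
    by (rule nn_integral_cong_AE) (use ae in \<open>eventually_elim, simp\<close>)
  then have 0: "ip_norm (L2_inner M) (f - p) = 0" using L2_norm_square[OF d] by simp
  have "\<exists>h\<in>?S. ip_norm (L2_inner M) (f - h) < e" if "e > 0" for e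
    using 0 p that by (intro bexI[of _ p]) auto
  then have "f \<in> ip_closure (L2 M) (L2_inner M) ?S" using f by (simp add: ip_closure_def)
  then show "f \<in> ?S" using cl by (auto simp: L2.closed_csubspace_def)
qed

text \<open>
  Exceptional null sets can only be collected over countably many sections, whereas a statement about
  the fibre \<open>J(x)\<close> needs a dense set of values at every point.
\<close>

definition dense_sections :: "'x measure \<Rightarrow> 'i set \<Rightarrow> ('i \<Rightarrow> 'x \<Rightarrow> 'h::complex_hilbert) \<Rightarrow> ('x \<Rightarrow> 'h) set \<Rightarrow> bool"
  where "dense_sections M I \<phi> Q \<longleftrightarrow> countable Q \<and> Q \<subseteq> L2 M \<and>
    (\<forall>x. (\<lambda>u. u x) ` Q \<subseteq> range_fun I \<phi> x \<and> range_fun I \<phi> x \<subseteq> closure ((\<lambda>u. u x) ` Q))"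

lemma dense_sectionsD:
  assumes "dense_sections M I \<phi> Q"
  shows "countable Q" "u \<in> Q \<Longrightarrow> u \<in> L2 M" "u \<in> Q \<Longrightarrow> u x \<in> range_fun I \<phi> x"
    "range_fun I \<phi> x \<subseteq> closure ((\<lambda>u. u x) ` Q)"
  using assms by (auto simp: dense_sections_def)

text \<open>
  Take the finite combinations of the generators with coefficients from a countable dense set of complex
  numbers.
\<close>

lemma dense_sections_exist:
  fixes \<phi> :: "'i \<Rightarrow> 'x \<Rightarrow> 'h::{complex_hilbert, second_countable_topology}"
  assumes I: "countable I" and \<phi>: "\<And>i. i \<in> I \<Longrightarrow> \<phi> i \<in> L2 M"
  shows "\<exists>Q. dense_sections M I \<phi> Q"
proof -
  obtain D :: "complex set" where D: "countable D"
      and dense: "\<And>X. open X \<Longrightarrow> X \<noteq> {} \<Longrightarrow> \<exists>d\<in>D. d \<in> X"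
    using countable_dense_setE by blast
  have clD: "closure D = UNIV"
    using dense[of "- closure D"] closure_subset[of D] by blast
  define c where "c xs = (\<Sum>p\<leftarrow>xs. fst p *\<^sub>C \<phi> (snd p))" for xs
  have c_simps [simp]: "c [] x = 0" "c (p # xs) x = fst p *\<^sub>C \<phi> (snd p) x + c xs x" for p xs x
    by (simp_all add: c_def)
  have c_append: "c (xs @ ys) x = c xs x + c ys x" for xs ys x
    by (simp add: c_def)
  define Q where "Q = c ` lists (D \<times> I)"
  have "countable Q" unfolding Q_def using D I by (intro countable_image countable_lists) auto
  moreover have "c xs \<in> L2 M" if "xs \<in> lists (D \<times> I)" for xs
    using that
  proof induction
    case Nil
    have "c [] = 0" by (simp only: c_def list.map sum_list.Nil)
    then show ?case using L2.mem(1) by metis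
  next
    case (Cons p xs)
    then have "fst p *\<^sub>C \<phi> (snd p) \<in> L2 M" using \<phi> by (auto intro!: L2.mem(3))
    moreover have "c (p # xs) = fst p *\<^sub>C \<phi> (snd p) + c xs"
      by (simp only: c_def list.map sum_list.Cons)
    ultimately show ?case using Cons L2.mem(2) by metis
  qed
  then have "Q \<subseteq> L2 M" by (auto simp: Q_def)
  moreover have "c xs x \<in> range_fun I \<phi> x" if "xs \<in> lists (D \<times> I)" for xs x
    using that
  proof induction
    case Nil then show ?case using csubspaceD(1)[OF csubspace_range_fun] by simp
  next
    case (Cons p xs)
    then show ?case
      by (auto intro!: csubspaceD(2,3)[OF csubspace_range_fun] generator_in_range_fun)
  qed
  then have "u x \<in> range_fun I \<phi> x" if "u \<in> Q" for u x using that by (auto simp: Q_def)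
  moreover have "range_fun I \<phi> x \<subseteq> closure ((\<lambda>u. u x) ` Q)" for x
  proof -
    let ?K = "(\<lambda>u. u x) ` Q"
    have "y \<in> closure ?K" if "y \<in> cspan {\<phi> i x |i. i \<in> I}" for y
      using that
    proof (induction rule: module.span_induct_alt[OF module_scaleC, consumes 1, case_names base step])
      case base
      have "c [] \<in> Q" unfolding Q_def by blast
      then have "c [] x \<in> ?K" by blast
      then have "c [] x \<in> closure ?K" by (rule subsetD[OF closure_subset])
      then show ?case by (simp only: c_simps(1))
    next
      case (step a b y)
      then obtain i where i: "i \<in> I" and b: "b = \<phi> i x" by blast
      \<comment> \<open>Approximate the new coefficient and the remaining sum jointly: \<open>h\<close> is continuous and maps \<open>D \<times> K\<close> into \<open>K\<close>.\<close>
      let ?h = "\<lambda>p. fst p *\<^sub>C b + snd p"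
      have "continuous_on (closure (D \<times> ?K)) ?h" by (intro continuous_intros)
      moreover have "?h ` (D \<times> ?K) \<subseteq> closure ?K"
      proof clarify
        fix d u assume "d \<in> D" "u \<in> Q"
        then obtain xs where "u = c xs" "xs \<in> lists (D \<times> I)" by (auto simp: Q_def)
        then have "d *\<^sub>C b + u x = c ((d, i) # xs) x" "c ((d, i) # xs) \<in> Q"
          using \<open>d \<in> D\<close> i by (auto simp: b Q_def)
        then have "d *\<^sub>C b + u x \<in> ?K" by (rule image_eqI)
        then have "d *\<^sub>C b + u x \<in> closure ?K" by (rule subsetD[OF closure_subset])
        then show "fst (d, u x) *\<^sub>C b + snd (d, u x) \<in> closure ?K" by simp
      qed
      ultimately have "?h ` closure (D \<times> ?K) \<subseteq> closure ?K"
        by (intro image_closure_subset) auto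
      moreover have "(a, y) \<in> closure (D \<times> ?K)" using step by (simp add: closure_Times clD)
      ultimately show ?case by force
    qed
    then show ?thesis unfolding range_fun_def by (intro closure_minimal) auto
  qed
  ultimately have "dense_sections M I \<phi> Q" unfolding dense_sections_def by blast
  then show ?thesis ..
qed

lemma sup_cos_angle_range_fun_le_iff:
  fixes \<phi> \<psi> :: "'i \<Rightarrow> 'x \<Rightarrow> 'h::{complex_hilbert, second_countable_topology}"
  assumes Q: "dense_sections M I \<phi> Q" and R: "dense_sections M I \<psi> R"
  shows "sup_cos_angle cinner (range_fun I \<phi> x) (range_fun I \<psi> x) \<le> C \<longleftrightarrow>
    0 \<le> C \<and> (\<forall>u\<in>Q. \<forall>v\<in>R. cmod (cinner (u x) (v x)) \<le> C * (norm (u x) * norm (v x)))"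
proof -
  let ?P = "\<lambda>y z. cmod (cinner y z) \<le> C * (norm y * norm z)"
  have "?P y z" if dense: "\<forall>u\<in>Q. \<forall>v\<in>R. ?P (u x) (v x)"
    and y: "y \<in> range_fun I \<phi> x" and z: "z \<in> range_fun I \<psi> x" for y z
  proof -
    have "closed {p. ?P (fst p) (snd p)}" by (intro closed_Collect_le continuous_intros)
    moreover have "((\<lambda>u. u x) ` Q) \<times> ((\<lambda>v. v x) ` R) \<subseteq> {p. ?P (fst p) (snd p)}" using dense by auto
    ultimately have "closure (((\<lambda>u. u x) ` Q) \<times> ((\<lambda>v. v x) ` R)) \<subseteq> {p. ?P (fst p) (snd p)}"
      by (rule closure_minimal[rotated])
    moreover have "(y, z) \<in> closure (((\<lambda>u. u x) ` Q) \<times> ((\<lambda>v. v x) ` R))"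
      using y z dense_sectionsD(4)[OF Q] dense_sectionsD(4)[OF R] by (auto simp: closure_Times)
    ultimately show ?thesis by auto
  qed
  then show ?thesis
    using cip.sup_cos_angle_le_iff[OF subset_UNIV closed_csubspace_range_fun[of I \<psi> x],
        where E = "range_fun I \<phi> x" and C = C] dense_sectionsD(3)[OF Q] dense_sectionsD(3)[OF R]
    by (simp add: mult.assoc) blast
qed

text \<open>
  Every sublevel set is a countable intersection of sets given by a pair of dense sections.
\<close>

lemma borel_measurable_fibre_angle:
  fixes \<phi> \<psi> :: "'i \<Rightarrow> 'x \<Rightarrow> 'h::{complex_hilbert, second_countable_topology}"
  assumes I: "countable I" and \<phi>: "\<And>i. i \<in> I \<Longrightarrow> \<phi> i \<in> L2 M" and \<psi>: "\<And>i. i \<in> I \<Longrightarrow> \<psi> i \<in> L2 M"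
  shows "(\<lambda>x. sup_cos_angle cinner (range_fun I \<phi> x) (range_fun I \<psi> x)) \<in> borel_measurable M"
proof -
  obtain Q where Q: "dense_sections M I \<phi> Q"
    using dense_sections_exist[where I = I and \<phi> = \<phi>, OF I \<phi>] by blast
  obtain R where R: "dense_sections M I \<psi> R"
    using dense_sections_exist[where I = I and \<phi> = \<psi>, OF I \<psi>] by blast
  show ?thesis
    unfolding borel_measurable_iff_le
  proof
    fix C :: real
    have "{x \<in> space M. sup_cos_angle cinner (range_fun I \<phi> x) (range_fun I \<psi> x) \<le> C}
        = {x \<in> space M. 0 \<le> C \<and> (\<forall>u\<in>Q. \<forall>v\<in>R. cmod (cinner (u x) (v x)) \<le> C * (norm (u x) * norm (v x)))}"
      by (simp only: sup_cos_angle_range_fun_le_iff[OF Q R])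
    also have "\<dots> \<in> sets M"
    proof (intro sets.sets_Collect_conj sets.sets_Collect_const sets.sets_Collect_countable_All' dense_sectionsD(1)[OF Q] dense_sectionsD(1)[OF R])
      fix u v assume "u \<in> Q" "v \<in> R"
      then have [measurable]: "u \<in> borel_measurable M" "v \<in> borel_measurable M"
        using dense_sectionsD(2)[OF Q] dense_sectionsD(2)[OF R] L2_measurable by auto
      show "{x \<in> space M. cmod (cinner (u x) (v x)) \<le> C * (norm (u x) * norm (v x))} \<in> sets M"
        by measurable
    qed
    finally show "{x \<in> space M. sup_cos_angle cinner (range_fun I \<phi> x) (range_fun I \<psi> x) \<le> C} \<in> sets M" .
  qed
qed

lemma fiber_support_sets:
  fixes \<phi> :: "'i \<Rightarrow> 'x \<Rightarrow> 'h::{complex_hilbert, second_countable_topology}"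
  assumes I: "countable I" and \<phi>: "\<And>i. i \<in> I \<Longrightarrow> \<phi> i \<in> L2 M"
  shows "fiber_support M I \<phi> \<in> sets M"
proof -
  have "range_fun I \<phi> x \<noteq> {0} \<longleftrightarrow> (\<exists>i\<in>I. \<phi> i x \<noteq> 0)" for x
  proof
    assume "\<exists>i\<in>I. \<phi> i x \<noteq> 0"
    then show "range_fun I \<phi> x \<noteq> {0}" using generator_in_range_fun[of _ I \<phi> x] by auto
  next
    assume ne: "range_fun I \<phi> x \<noteq> {0}"
    show "\<exists>i\<in>I. \<phi> i x \<noteq> 0"
    proof (rule ccontr)
      assume zero: "\<not> (\<exists>i\<in>I. \<phi> i x \<noteq> 0)"
      have "cinner z w = 0" if "w \<in> range_fun I \<phi> x" for z w
        by (rule orthogonal_range_fun[OF _ that]) (use zero in auto)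
      then have "w = 0" if "w \<in> range_fun I \<phi> x" for w
        using that cinner_self[of w] by fastforce
      then show False using ne csubspaceD(1)[OF csubspace_range_fun[of I \<phi> x]] by auto
    qed
  qed
  then have "fiber_support M I \<phi> = {x \<in> space M. \<exists>i\<in>I. \<phi> i x \<noteq> 0}"
    by (simp add: fiber_support_def)
  also have "\<dots> \<in> sets M"
  proof (intro sets.sets_Collect_countable_Ex' I)
    fix i assume "i \<in> I"
    then have [measurable]: "\<phi> i \<in> borel_measurable M" using \<phi> L2_measurable by auto
    show "{x \<in> space M. \<phi> i x \<noteq> 0} \<in> sets M" by measurable
  qed
  finally show ?thesis .
qed

section \<open>Passing between integrals and fibres\<close>

text \<open>
  Test the hypothesis on the set where \<open>h < f\<close>.
\<close>

lemma AE_le_if_set_integrals_le: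
  fixes f h :: "'x \<Rightarrow> real"
  assumes f: "integrable M f" and h: "integrable M h"
    and le: "\<And>B. B \<in> sets M \<Longrightarrow> (\<integral>x. indicator B x * f x \<partial>M) \<le> (\<integral>x. indicator B x * h x \<partial>M)"
  shows "AE x in M. f x \<le> h x"
proof -
  note [measurable] = borel_measurable_integrable[OF f] borel_measurable_integrable[OF h]
  define B where "B = {x \<in> space M. h x < f x}"
  have B [measurable]: "B \<in> sets M" unfolding B_def by measurable
  have int: "integrable M (\<lambda>x. indicator B x * f x)" "integrable M (\<lambda>x. indicator B x * h x)"
    using integrable_real_mult_indicator[OF B f] integrable_real_mult_indicator[OF B h]
    by (simp_all add: mult.commute)
  let ?d = "\<lambda>x. indicator B x * f x - indicator B x * h x"
  have nonneg: "AE x in M. 0 \<le> ?d x" by (rule AE_I2) (auto simp: B_def indicator_def)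
  have "(\<integral>x. ?d x \<partial>M) \<le> 0" using le[OF B] int by simp
  then have "(\<integral>x. ?d x \<partial>M) = 0" using integral_nonneg_AE[OF nonneg] by simp
  then have "AE x in M. ?d x = 0"
    using integral_nonneg_eq_0_iff_AE[OF _ nonneg] int by simp
  then show ?thesis
    using AE_space by eventually_elim (auto simp: B_def indicator_def split: if_splits)
qed

text \<open>
  Characterises a finite essential supremum as the least almost-everywhere bound among the real numbers,
  so that arguments about angles can stay with real inequalities.
\<close>

lemma ess_sup_on_eqI:
  assumes \<Omega>: "\<Omega> \<in> sets M" and meas: "f \<in> borel_measurable (restrict_space M \<Omega>)" and A: "0 \<le> A"
    and le: "AE x in M. x \<in> \<Omega> \<longrightarrow> f x \<le> A"
    and least: "\<And>K. 0 \<le> K \<Longrightarrow> AE x in M. x \<in> \<Omega> \<longrightarrow> f x \<le> K \<Longrightarrow> A \<le> K"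
  shows "ennreal A = ess_sup_on M \<Omega> f"
proof (rule antisym)
  have AE_\<Omega>: "(AE x in restrict_space M \<Omega>. P x) \<longleftrightarrow> (AE x in M. x \<in> \<Omega> \<longrightarrow> P x)" for P
    using \<Omega> by (intro AE_restrict_space_iff) (simp add: sets.Int_space_eq2)
  have "AE x in restrict_space M \<Omega>. ennreal (f x) \<le> ennreal A"
    unfolding AE_\<Omega> using le by eventually_elim (auto intro: ennreal_leI)
  then show *: "ess_sup_on M \<Omega> f \<le> ennreal A"
    unfolding ess_sup_on_def using meas by (intro esssup_I) auto
  then obtain K where K: "0 \<le> K" "ess_sup_on M \<Omega> f = ennreal K"
    by (cases "ess_sup_on M \<Omega> f") (auto simp: top_unique)
  have "AE x in restrict_space M \<Omega>. ennreal (f x) \<le> ennreal K"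
    using esssup_AE[of "\<lambda>x. ennreal (f x)" "restrict_space M \<Omega>"] K(2) by (simp add: ess_sup_on_def)
  then have "AE x in M. x \<in> \<Omega> \<longrightarrow> f x \<le> K"
    unfolding AE_\<Omega> by eventually_elim (auto simp: ennreal_le_iff[OF K(1)])
  then show "ennreal A \<le> ess_sup_on M \<Omega> f"
    using least K by (auto intro: ennreal_leI)
qed

text \<open>
  The Cauchy--Schwarz inequality for the scalar functions \<open>x \<mapsto> \<parallel>u(x)\<parallel>\<close> and
  \<open>x \<mapsto> \<parallel>v(x)\<parallel>\<close>.
\<close>

lemma integral_norm_mult_le:
  fixes u v :: "'x \<Rightarrow> 'h::{complex_hilbert, second_countable_topology}"
  assumes u: "u \<in> L2 M" and v: "v \<in> L2 M"
  shows "integrable M (\<lambda>x. norm (u x) * norm (v x))"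
    and "(\<integral>x. norm (u x) * norm (v x) \<partial>M) \<le> ip_norm (L2_inner M) u * ip_norm (L2_inner M) v"
proof -
  define U V where "U x = complex_of_real (norm (u x))" and "V x = complex_of_real (norm (v x))" for x
  note [measurable] = L2_measurable[OF u] L2_measurable[OF v]
  have [measurable]: "U \<in> borel_measurable M" "V \<in> borel_measurable M"
    unfolding U_def V_def by measurable
  have UV: "U \<in> L2 M" "V \<in> L2 M"
    using u v by (simp_all add: L2_def U_def V_def)
  have "integrable M (\<lambda>x. complex_of_real (norm (u x) * norm (v x)))"
    using integrable_cinner[OF UV] by (simp add: U_def V_def cinner_complex_def)
  from integrable_Re[OF this] show int: "integrable M (\<lambda>x. norm (u x) * norm (v x))" by simp
  have "L2_inner M U V = (\<integral>x. complex_of_real (norm (u x) * norm (v x)) \<partial>M)"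
    by (simp add: L2_inner_def U_def V_def cinner_complex_def)
  also have "\<dots> = complex_of_real (\<integral>x. norm (u x) * norm (v x) \<partial>M)" by (rule integral_complex_of_real)
  finally have "(\<integral>x. norm (u x) * norm (v x) \<partial>M) \<le> cmod (L2_inner M U V)" by simp
  also have "\<dots> \<le> ip_norm (L2_inner M) U * ip_norm (L2_inner M) V" by (rule L2.Cauchy_Schwarz[OF UV])
  also have "\<dots> = ip_norm (L2_inner M) u * ip_norm (L2_inner M) v"
    by (simp add: ip_norm_def Re_L2_inner_self U_def V_def)
  finally show "(\<integral>x. norm (u x) * norm (v x) \<partial>M) \<le> ip_norm (L2_inner M) u * ip_norm (L2_inner M) v" .
qed

lemma sqrt_quotient_square: "0 \<le> a \<Longrightarrow> 0 \<le> b \<Longrightarrow> (sqrt (b / a) * a)\<^sup>2 = a * b"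
  by (cases "a = 0") (simp_all add: power_mult_distrib, simp add: power2_eq_square)

text \<open>
  The global bound is a statement about products of norms in \<open>L\<^sup>2\<close>, not about integrals of
  products.  To localise it, \<open>u\<close> and \<open>v\<close> are cut down to \<open>B\<close> and rescaled pointwise so that
  both have norm at most \<open>sqrt (\<parallel>u(x)\<parallel> \<parallel>v(x)\<parallel>)\<close> and their inner product becomes
  \<open>|\<langle>u(x),v(x)\<rangle>|\<close>.  The rescaled sections stay in the generated spaces, and the bound for them
  says \<open>\<integral>\<^sub>B |\<langle>u,v\<rangle>| \<le> C \<integral>\<^sub>B \<parallel>u\<parallel> \<parallel>v\<parallel>\<close>.
\<close>

lemma AE_angle_bound_sections:
  fixes \<phi> \<psi> :: "'i \<Rightarrow> 'x \<Rightarrow> 'h::{complex_hilbert, second_countable_topology}"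
  assumes pd: "parseval_determining M N g" and I: "countable I"
    and \<phi>: "\<And>i. i \<in> I \<Longrightarrow> \<phi> i \<in> L2 M" and \<psi>: "\<And>i. i \<in> I \<Longrightarrow> \<psi> i \<in> L2 M"
    and C: "sup_cos_angle (L2_inner M) (generated_space M N g I \<phi>) (generated_space M N g I \<psi>) \<le> C"
    and u: "u \<in> L2 M" "\<And>x. u x \<in> range_fun I \<phi> x"
    and v: "v \<in> L2 M" "\<And>x. v x \<in> range_fun I \<psi> x"
  shows "AE x in M. cmod (cinner (u x) (v x)) \<le> C * (norm (u x) * norm (v x))"
proof (rule AE_le_if_set_integrals_le)
  note [measurable] = L2_measurable[OF u(1)] L2_measurable[OF v(1)]
  note int_uv = integral_norm_mult_le(1)[OF u(1) v(1)]
  show "integrable M (\<lambda>x. cmod (cinner (u x) (v x)))" by (intro integrable_norm integrable_cinner u v)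
  show "integrable M (\<lambda>x. C * (norm (u x) * norm (v x)))" using int_uv by simp
  fix B assume B [measurable]: "B \<in> sets M"
  have int_B: "integrable M (\<lambda>x. indicator B x * (norm (u x) * norm (v x)))"
    using integrable_real_mult_indicator[OF B int_uv] by (simp add: mult.commute)
  \<comment> \<open>Where \<open>u(x) = 0\<close> or \<open>v(x) = 0\<close>, division by zero makes both factors vanish, as it should.\<close>
  define a where "a x = complex_of_real (indicator B x * sqrt (norm (v x) / norm (u x)))
      * (cinner (v x) (u x) / complex_of_real (cmod (cinner (v x) (u x))))" for x
  define b where "b x = complex_of_real (indicator B x * sqrt (norm (u x) / norm (v x)))" for x
  define u' v' where "u' x = a x *\<^sub>C u x" and "v' x = b x *\<^sub>C v x" for x
  have [measurable]: "u' \<in> borel_measurable M" "v' \<in> borel_measurable M"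
    unfolding u'_def v'_def a_def b_def by measurable
  have cinner_vu: "cinner (v x) (u x) = cnj (cinner (u x) (v x))" for x by (rule cinner_commute)
  have a_eq: "a x = complex_of_real (indicator B x * sqrt (norm (v x) / norm (u x)))
      * cnj (sgn (cinner (u x) (v x)))" for x
    by (simp add: a_def cinner_vu sgn_eq)
  have cmod_sgn: "cmod (sgn z) \<le> 1" for z by (simp add: norm_sgn)
  have nu: "(norm (u' x))\<^sup>2 \<le> indicator B x * (norm (u x) * norm (v x))" for x
  proof -
    have "norm (u' x) = cmod (sgn (cinner (u x) (v x))) * (indicator B x * (sqrt (norm (v x) / norm (u x)) * norm (u x)))"
      by (simp add: u'_def a_eq norm_scaleC norm_mult mult_ac)
    then have "(norm (u' x))\<^sup>2 = (cmod (sgn (cinner (u x) (v x))))\<^sup>2 * (indicator B x * (norm (u x) * norm (v x)))"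
      by (simp only: power_mult_distrib[of "cmod _"] power_mult_distrib[of "indicator B x"]
          sqrt_quotient_square norm_ge_zero) (simp add: indicator_def)
    also have "\<dots> \<le> 1 * (indicator B x * (norm (u x) * norm (v x)))"
      by (intro mult_right_mono power_le_one cmod_sgn) auto
    finally show ?thesis by simp
  qed
  have nv: "(norm (v' x))\<^sup>2 \<le> indicator B x * (norm (u x) * norm (v x))" for x
  proof -
    have "norm (v' x) = indicator B x * (sqrt (norm (u x) / norm (v x)) * norm (v x))"
      by (simp add: v'_def b_def norm_scaleC norm_mult mult_ac)
    then have "(norm (v' x))\<^sup>2 = indicator B x * (norm (v x) * norm (u x))"
      by (simp only: power_mult_distrib[of "indicator B x"]
          sqrt_quotient_square norm_ge_zero) (simp add: indicator_def)
    then show ?thesis by (simp add: mult.commute)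
  qed
  have L2': "w \<in> L2 M" "(ip_norm (L2_inner M) w)\<^sup>2 \<le> (\<integral>x. indicator B x * (norm (u x) * norm (v x)) \<partial>M)"
    if [measurable]: "w \<in> borel_measurable M"
      and nw: "\<And>x. (norm (w x))\<^sup>2 \<le> indicator B x * (norm (u x) * norm (v x))" for w :: "'x \<Rightarrow> 'h"
  proof -
    have int: "integrable M (\<lambda>x. (norm (w x))\<^sup>2)"
      by (rule Bochner_Integration.integrable_bound[OF int_B]) (measurable, use nw in auto)
    then show L2: "w \<in> L2 M" by (simp add: L2_def)
    show "(ip_norm (L2_inner M) w)\<^sup>2 \<le> (\<integral>x. indicator B x * (norm (u x) * norm (v x)) \<partial>M)"
      unfolding L2.nrm_square[OF L2] Re_L2_inner_self by (rule integral_mono[OF int int_B nw])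
  qed
  note u' = L2'[OF _ nu, simplified] and v' = L2'[OF _ nv, simplified]
  have "u' x \<in> range_fun I \<phi> x" "v' x \<in> range_fun I \<psi> x" for x
    unfolding u'_def v'_def by (intro csubspaceD(3)[OF csubspace_range_fun] u(2) v(2))+
  then have "u' \<in> generated_space M N g I \<phi>" "v' \<in> generated_space M N g I \<psi>"
    using u'(1) v'(1) generated_space_iff[where I = I and \<phi> = \<phi>, OF pd I \<phi>] generated_space_iff[where I = I and \<phi> = \<psi>, OF pd I \<psi>] by auto
  then have *: "0 \<le> C" "cmod (L2_inner M u' v') \<le> C * ip_norm (L2_inner M) u' * ip_norm (L2_inner M) v'"
    using C L2.sup_cos_angle_le_iff[OF _ closed_csubspace_generated_space[where I = I and \<phi> = \<psi>, OF pd \<psi>],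
        where E = "generated_space M N g I \<phi>" and C = C]
    by (auto simp: generated_space_def L2.ip_closure_subset)
  have pointwise: "cinner (u' x) (v' x) = complex_of_real (indicator B x * cmod (cinner (u x) (v x)))" for x
  proof (cases "u x = 0 \<or> v x = 0 \<or> x \<notin> B \<or> cinner (u x) (v x) = 0")
    case True
    then show ?thesis by (auto simp: u'_def v'_def a_eq b_def cinner_scaleC_left cinner_scaleC_right)
  next
    case False
    let ?z = "cinner (u x) (v x)"
    have "cnj (sgn ?z) * ?z = complex_of_real (cmod ?z)"
      using False complex_norm_square[of ?z]
      by (simp add: sgn_eq field_simps power2_eq_square)
    moreover have "sqrt (norm (v x) / norm (u x)) * sqrt (norm (u x) / norm (v x)) = 1"
      using False by (simp add: real_sqrt_mult[symmetric])
    then have "complex_of_real (sqrt (norm (v x) / norm (u x))) * complex_of_real (sqrt (norm (u x) / norm (v x))) = 1"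
      by (simp only: of_real_mult[symmetric] of_real_1)
    moreover have "cinner (u' x) (v' x) = (complex_of_real (sqrt (norm (v x) / norm (u x)))
        * complex_of_real (sqrt (norm (u x) / norm (v x)))) * (cnj (sgn ?z) * ?z)"
      using False by (simp add: u'_def v'_def a_eq b_def cinner_scaleC_left cinner_scaleC_right mult_ac)
    ultimately show ?thesis using False by simp
  qed
  have eq: "complex_of_real (\<integral>x. indicator B x * cmod (cinner (u x) (v x)) \<partial>M) = L2_inner M u' v'"
    unfolding L2_inner_def pointwise by (rule integral_complex_of_real[symmetric])
  have "(\<integral>x. indicator B x * cmod (cinner (u x) (v x)) \<partial>M) \<le> cmod (L2_inner M u' v')"
    unfolding eq[symmetric] by simp
  also have "\<dots> \<le> C * (ip_norm (L2_inner M) u' * ip_norm (L2_inner M) v')" using *(2) by (simp add: mult.assoc)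
  also have "\<dots> \<le> C * (\<integral>x. indicator B x * (norm (u x) * norm (v x)) \<partial>M)"
  proof (rule mult_left_mono[OF _ *(1)])
    have "2 * (ip_norm (L2_inner M) u' * ip_norm (L2_inner M) v')
        \<le> (ip_norm (L2_inner M) u')\<^sup>2 + (ip_norm (L2_inner M) v')\<^sup>2"
      using sum_squares_bound[of "ip_norm (L2_inner M) u'" "ip_norm (L2_inner M) v'"] by (simp add: mult.assoc)
    then show "ip_norm (L2_inner M) u' * ip_norm (L2_inner M) v' \<le> (\<integral>x. indicator B x * (norm (u x) * norm (v x)) \<partial>M)"
      using u'(2) v'(2) by linarith
  qed
  also have "\<dots> = (\<integral>x. indicator B x * (C * (norm (u x) * norm (v x))) \<partial>M)"
    by (simp add: mult.left_commute[of _ C])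
  finally show "(\<integral>x. indicator B x * cmod (cinner (u x) (v x)) \<partial>M)
      \<le> (\<integral>x. indicator B x * (C * (norm (u x) * norm (v x))) \<partial>M)" .
qed

text \<open>
  A bound for the angle of the generated spaces localises to every pair of dense sections, hence to
  almost every fibre.  An almost-everywhere bound \<open>K\<close> for the fibre angles integrates to one for the
  generated spaces; outside the common support one of the two sections vanishes.
\<close>

theorem angle_eq_ess_sup_fibre_angles:
  fixes \<phi> \<psi> :: "'i \<Rightarrow> 'x \<Rightarrow> 'h::{complex_hilbert, second_countable_topology}"
  assumes pd: "parseval_determining M N g" and I: "countable I"
    and \<phi>: "\<And>i. i \<in> I \<Longrightarrow> \<phi> i \<in> L2 M" and \<psi>: "\<And>i. i \<in> I \<Longrightarrow> \<psi> i \<in> L2 M"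
  shows "ennreal (sup_cos_angle (L2_inner M) (generated_space M N g I \<phi>) (generated_space M N g I \<psi>))
    = ess_sup_on M (fiber_support M I \<phi> \<inter> fiber_support M I \<psi>)
        (\<lambda>x. sup_cos_angle cinner (range_fun I \<phi> x) (range_fun I \<psi> x))"
    (is "ennreal ?A = ess_sup_on M ?\<Omega> ?\<theta>")
proof (rule ess_sup_on_eqI)
  have clV: "L2.closed_csubspace M (generated_space M N g I \<psi>)"
    by (rule closed_csubspace_generated_space[OF pd \<psi>])
  have U: "generated_space M N g I \<phi> \<subseteq> L2 M" by (simp add: generated_space_def L2.ip_closure_subset)
  note angle_le_iff = L2.sup_cos_angle_le_iff[OF U clV]
  show "?\<Omega> \<in> sets M" using fiber_support_sets[OF I] \<phi> \<psi> by blast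
  show "?\<theta> \<in> borel_measurable (restrict_space M ?\<Omega>)"
    by (intro measurable_restrict_space1 borel_measurable_fibre_angle I \<phi> \<psi>)
  show "0 \<le> ?A" by (rule L2.sup_cos_angle_nonneg[OF U clV])
  show "AE x in M. x \<in> ?\<Omega> \<longrightarrow> ?\<theta> x \<le> ?A"
  proof -
    obtain Q where Q: "dense_sections M I \<phi> Q"
      using dense_sections_exist[where I = I and \<phi> = \<phi>, OF I \<phi>] by blast
    obtain R where R: "dense_sections M I \<psi> R"
      using dense_sections_exist[where I = I and \<phi> = \<psi>, OF I \<psi>] by blast
    have "AE x in M. \<forall>u\<in>Q. \<forall>v\<in>R. cmod (cinner (u x) (v x)) \<le> ?A * (norm (u x) * norm (v x))"
      unfolding AE_ball_countable[OF dense_sectionsD(1)[OF Q]] AE_ball_countable[OF dense_sectionsD(1)[OF R]]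
      using dense_sectionsD(2,3)[OF Q] dense_sectionsD(2,3)[OF R]
      by (intro ballI AE_angle_bound_sections[where I = I and \<phi> = \<phi> and \<psi> = \<psi>, OF pd I \<phi> \<psi> order_refl])
    then show ?thesis
      by eventually_elim
        (use sup_cos_angle_range_fun_le_iff[OF Q R] \<open>0 \<le> ?A\<close> in blast)
  qed
  fix K :: real assume K: "0 \<le> K" and \<theta>_le: "AE x in M. x \<in> ?\<Omega> \<longrightarrow> ?\<theta> x \<le> K"
  show "?A \<le> K"
    unfolding angle_le_iff
  proof (intro conjI ballI K)
    fix u v assume u: "u \<in> generated_space M N g I \<phi>" and v: "v \<in> generated_space M N g I \<psi>"
    have uL2: "u \<in> L2 M" and u_fib: "AE x in M. u x \<in> range_fun I \<phi> x"
      using u generated_space_iff[where I = I and \<phi> = \<phi>, OF pd I \<phi>] by auto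
    have vL2: "v \<in> L2 M" and v_fib: "AE x in M. v x \<in> range_fun I \<psi> x"
      using v generated_space_iff[where I = I and \<phi> = \<psi>, OF pd I \<psi>] by auto
    from \<theta>_le u_fib v_fib AE_space
    have ae: "AE x in M. cmod (cinner (u x) (v x)) \<le> K * (norm (u x) * norm (v x))"
    proof eventually_elim
      case (elim x)
      show ?case
      proof (cases "x \<in> ?\<Omega>")
        case True
        then show ?thesis
          using elim cip.sup_cos_angle_le_iff[OF subset_UNIV closed_csubspace_range_fun[of I \<psi> x],
        where E = "range_fun I \<phi> x" and C = K]
          by (simp add: mult.assoc)
      next
        case False
        then have "u x = 0 \<or> v x = 0" using elim by (auto simp: fiber_support_def)
        then show ?thesis by auto
      qed
    qed
    have "cmod (L2_inner M u v) \<le> (\<integral>x. cmod (cinner (u x) (v x)) \<partial>M)"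
      unfolding L2_inner_def by (rule integral_norm_bound)
    also have "\<dots> \<le> (\<integral>x. K * (norm (u x) * norm (v x)) \<partial>M)"
      using integral_norm_mult_le(1)[OF uL2 vL2]
      by (intro integral_mono_AE ae integrable_norm integrable_cinner uL2 vL2) simp
    also have "\<dots> \<le> K * (ip_norm (L2_inner M) u * ip_norm (L2_inner M) v)"
      using integral_norm_mult_le[OF uL2 vL2] K by (simp add: mult_left_mono)
    finally show "cmod (L2_inner M u v) \<le> K * ip_norm (L2_inner M) u * ip_norm (L2_inner M) v"
      by (simp add: mult.assoc)
  qed
qed


section \<open>Inverse square roots of operators\<close>

lemma cinner_ext: "(\<And>v. cinner x v = cinner y v) \<Longrightarrow> x = (y :: 'h::complex_hilbert)"
proof -
  assume "\<And>v. cinner x v = cinner y v"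
  then have "cinner (x - y) (x - y) = 0" by (simp add: cinner_diff_left)
  then show "x = y" by (simp add: cinner_self)
qed

text \<open>
  The equation \<open>2 Y = X + Y\<^sup>2\<close> says that \<open>1 - Y\<close> is a square root of \<open>1 - X\<close>.  The map
  \<open>Y \<mapsto> (X + Y\<^sup>2) / 2\<close> is an \<open>r\<close>-contraction of the ball of radius \<open>r < 1\<close>.  It preserves
  complex linearity, self-adjointness and commutation with the commutant of \<open>X\<close>, all of which are
  closed conditions, so the Banach fixed point has these properties as well.
\<close>

lemma square_root_fixed_point:
  fixes X :: "'h::complex_hilbert \<Rightarrow>\<^sub>L 'h"
  assumes r: "norm X \<le> r" "0 \<le> r" "r < 1"
    and lin: "\<And>a v. X (a *\<^sub>C v) = a *\<^sub>C X v"
    and adj: "\<And>v w. cinner (X v) w = cinner v (X w)"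
  obtains Y :: "'h \<Rightarrow>\<^sub>L 'h" where "norm Y \<le> r" "\<And>a v. Y (a *\<^sub>C v) = a *\<^sub>C Y v"
    "\<And>v w. cinner (Y v) w = cinner v (Y w)" "\<And>B. X o\<^sub>L B = B o\<^sub>L X \<Longrightarrow> Y o\<^sub>L B = B o\<^sub>L Y"
    "\<And>v. 2 *\<^sub>R Y v = X v + Y (Y v)"
proof -
  define S where "S = {Y. norm Y \<le> r \<and> (\<forall>a v. blinfun_apply Y (a *\<^sub>C v) = a *\<^sub>C Y v)
    \<and> (\<forall>v w. cinner (Y v) w = cinner v (Y w)) \<and> (\<forall>B. X o\<^sub>L B = B o\<^sub>L X \<longrightarrow> Y o\<^sub>L B = B o\<^sub>L Y)}"
  define f where "f Y = (1/2) *\<^sub>R (X + (Y o\<^sub>L Y))" for Y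
  have "closed S"
    unfolding S_def
    by (intro closed_Collect_conj closed_Collect_all closed_Collect_imp closed_Collect_le closed_Collect_eq
        open_Collect_const continuous_intros)
  then have "uniform_space_class.complete S" by (simp add: complete_eq_closed)
  moreover have "0 \<in> S" using r(2) by (simp add: S_def)
  then have "S \<noteq> {}" by blast
  moreover have "f ` S \<subseteq> S"
  proof clarify
    fix Y assume "Y \<in> S"
    then have Y: "norm Y \<le> r" and Ylin: "\<And>a v. Y (a *\<^sub>C v) = a *\<^sub>C Y v"
      and Yadj: "\<And>v w. cinner (Y v) w = cinner v (Y w)"
      and Ycom: "\<And>B. X o\<^sub>L B = B o\<^sub>L X \<Longrightarrow> Y o\<^sub>L B = B o\<^sub>L Y"
      unfolding S_def by blast+
    have "norm (f Y) \<le> (1/2) * (norm X + norm (Y o\<^sub>L Y))"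
      unfolding f_def by (simp add: norm_triangle_ineq)
    also have "norm (Y o\<^sub>L Y) \<le> norm Y * norm Y" by (rule norm_blinfun_compose)
    also have "\<dots> \<le> r * 1" using Y r by (intro mult_mono) auto
    finally have 1: "norm (f Y) \<le> r" using r(1) by simp
    have 2: "f Y (a *\<^sub>C v) = a *\<^sub>C f Y v" for a v
      by (simp add: f_def lin Ylin blinfun.add_left blinfun.scaleR_left scaleR_scaleC
          scaleC_scaleC scaleC_add_right mult.commute)
    have 3: "cinner (f Y v) w = cinner v (f Y w)" for v w
      by (simp add: f_def adj Yadj blinfun.add_left blinfun.scaleR_left scaleR_scaleC
          cinner_scaleC_left cinner_scaleC_right cinner_add_left cinner_add_right)
    have 4: "f Y o\<^sub>L B = B o\<^sub>L f Y" if B: "X o\<^sub>L B = B o\<^sub>L X" for B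
    proof (rule blinfun_eqI)
      fix v
      have "X (B v) = B (X v)" using arg_cong[OF B, of "\<lambda>T. blinfun_apply T v"] by simp
      moreover have "Y (B u) = B (Y u)" for u
        using arg_cong[OF Ycom[OF B], of "\<lambda>T. blinfun_apply T u"] by simp
      ultimately show "(f Y o\<^sub>L B) v = (B o\<^sub>L f Y) v"
        by (simp add: f_def blinfun.add_left blinfun.scaleR_left blinfun.add_right blinfun.scaleR_right)
    qed
    show "f Y \<in> S" unfolding S_def using 1 2 3 4 by blast
  qed
  moreover have "dist (f Y) (f Z) \<le> r * dist Y Z" if Y: "Y \<in> S" and Z: "Z \<in> S" for Y Z
  proof -
    have "f Y - f Z = (1/2) *\<^sub>R ((Y o\<^sub>L (Y - Z)) + ((Y - Z) o\<^sub>L Z))"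
      by (rule blinfun_eqI) (simp add: f_def blinfun.add_left blinfun.scaleR_left blinfun.diff_left
          blinfun.diff_right scaleR_diff_right[symmetric] del: scaleR_half_double)
    then have "norm (f Y - f Z) \<le> (1/2) * (norm (Y o\<^sub>L (Y - Z)) + norm ((Y - Z) o\<^sub>L Z))"
      by (simp add: norm_triangle_ineq)
    also have "norm (Y o\<^sub>L (Y - Z)) \<le> r * norm (Y - Z)"
      by (rule order_trans[OF norm_blinfun_compose mult_right_mono]) (use Y in \<open>auto simp: S_def\<close>)
    also have "norm ((Y - Z) o\<^sub>L Z) \<le> norm (Y - Z) * r"
      by (rule order_trans[OF norm_blinfun_compose mult_left_mono]) (use Z in \<open>auto simp: S_def\<close>)
    finally show ?thesis by (simp add: dist_norm)
  qed
  ultimately obtain Y where Y: "Y \<in> S" "f Y = Y"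
    using Banach_fix[of S r f] r by blast
  have "2 *\<^sub>R Y v = X v + Y (Y v)" for v
  proof -
    have "2 *\<^sub>R Y v = 2 *\<^sub>R f Y v" by (simp add: Y(2))
    also have "\<dots> = X v + Y (Y v)" by (simp add: f_def blinfun.scaleR_left blinfun.add_left)
    finally show ?thesis .
  qed
  then show ?thesis using that[of Y] Y(1) unfolding S_def by blast
qed

text \<open>
  With \<open>Y\<close> from the previous lemma, \<open>Q = 1 - Y\<close> satisfies \<open>Q\<^sup>2 = 1 - X\<close>.  It is bounded below by
  \<open>1 - r\<close>, and \<open>Q z = v\<close> is solved by the fixed point of \<open>z \<mapsto> v + Y z\<close>; \<open>E\<close> is its inverse.
\<close>

lemma inverse_square_root:
  fixes X :: "'h::complex_hilbert \<Rightarrow>\<^sub>L 'h"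
  assumes r: "norm X \<le> r" "0 \<le> r" "r < 1"
    and lin: "\<And>a v. X (a *\<^sub>C v) = a *\<^sub>C X v"
    and adj: "\<And>v w. cinner (X v) w = cinner v (X w)"
  obtains E where "\<And>v. E (E (v - X v)) = v" "\<And>v. E (E v) - X (E (E v)) = v"
    "\<And>v w. E (v + w) = E v + E w" "\<And>a v. E (a *\<^sub>C v) = a *\<^sub>C E v"
    "\<And>v. norm (E v) \<le> norm v / (1 - r)"
    "\<And>v w. cinner (E v) w = cinner v (E w)" "\<And>v. 0 \<le> Re (cinner (E v) v)"
    "\<And>B v. X o\<^sub>L B = B o\<^sub>L X \<Longrightarrow> E (B v) = B (E v)"
proof -
  obtain Y :: "'h \<Rightarrow>\<^sub>L 'h" where Y: "norm Y \<le> r" and Ylin: "\<And>a v. Y (a *\<^sub>C v) = a *\<^sub>C Y v"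
    and Yadj: "\<And>v w. cinner (Y v) w = cinner v (Y w)"
    and Ycom: "\<And>B. X o\<^sub>L B = B o\<^sub>L X \<Longrightarrow> Y o\<^sub>L B = B o\<^sub>L Y"
    and Yfix: "\<And>v. 2 *\<^sub>R Y v = X v + Y (Y v)"
    using square_root_fixed_point[OF assms] by metis
  define Q where "Q v = v - Y v" for v
  have Q2: "Q (Q v) = v - X v" for v
    using Yfix[of v] by (simp add: Q_def blinfun.diff_right scaleR_2 algebra_simps)
  have nY: "norm (Y v) \<le> r * norm v" for v
    using norm_blinfun[of Y v] Y mult_right_mono[OF Y, of "norm v"] by simp
  have nQ: "(1 - r) * norm v \<le> norm (Q v)" for v
    using norm_triangle_ineq2[of v "Y v"] nY[of v] by (simp add: Q_def left_diff_distrib)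
  have Qdiff: "Q (v - w) = Q v - Q w" for v w by (simp add: Q_def blinfun.diff_right)
  have Qinj: "v = w" if "Q v = Q w" for v w
  proof -
    have "(1 - r) * norm (v - w) \<le> 0" using nQ[of "v - w"] that by (simp add: Qdiff)
    then show ?thesis using r(3) by (simp add: mult_le_0_iff)
  qed
  have "\<exists>z. Q z = v" for v
  proof -
    have "dist (v + Y x) (v + Y y) \<le> r * dist x y" for x y
      using nY[of "x - y"] by (simp add: dist_norm blinfun.diff_right)
    then have "\<exists>!z. v + Y z = z" using r by (intro banach_fix_type) auto
    then obtain z where "v + Y z = z" by blast
    then have "Q z = v" unfolding Q_def by (metis add_diff_cancel_right')
    then show ?thesis ..
  qed
  then obtain E where QE: "\<And>v. Q (E v) = v" by metis
  have EQ: "E (Q v) = v" for v by (rule Qinj) (rule QE)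
  have Qadj: "cinner (Q v) w = cinner v (Q w)" for v w
    by (simp add: Q_def cinner_diff_left cinner_diff_right Yadj)
  show ?thesis
  proof
    fix v w :: 'h and a :: complex and B :: "'h \<Rightarrow>\<^sub>L 'h"
    show "E (E (v - X v)) = v" by (simp add: Q2[symmetric] EQ)
    show "E (E v) - X (E (E v)) = v" by (simp add: Q2[symmetric] QE)
    have "Q (E v + E w) = Q (E v) + Q (E w)" by (simp add: Q_def blinfun.add_right)
    then show "E (v + w) = E v + E w" by (metis QE Qinj)
    have "Q (a *\<^sub>C E v) = a *\<^sub>C Q (E v)"
      by (simp add: Q_def Ylin module.scale_right_diff_distrib[OF module_scaleC])
    then show "E (a *\<^sub>C v) = a *\<^sub>C E v" by (metis QE Qinj)
    show "norm (E v) \<le> norm v / (1 - r)"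
      using nQ[of "E v"] r(3) by (simp add: QE field_simps)
    show "cinner (E v) w = cinner v (E w)"
      using Qadj[of "E v" "E w"] by (simp add: QE)
    have "cinner (E v) v = cinner (E v) (Q (E v))" by (simp add: QE)
    then have eq: "Re (cinner (E v) v) = (norm (E v))\<^sup>2 - Re (cinner (E v) (Y (E v)))"
      by (simp add: Q_def cinner_diff_right cinner_self del: of_real_power)
    have "Re (cinner (E v) (Y (E v))) \<le> norm (E v) * norm (Y (E v))"
      using cinner_Cauchy_Schwarz complex_Re_le_cmod order_trans by blast
    also have "\<dots> \<le> norm (E v) * (1 * norm (E v))"
      using r(3) by (intro mult_left_mono[OF order_trans[OF nY mult_right_mono]]) auto
    finally show "0 \<le> Re (cinner (E v) v)" unfolding eq by (simp add: power2_eq_square)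
    assume B: "X o\<^sub>L B = B o\<^sub>L X"
    have "Y (B u) = B (Y u)" for u
      using arg_cong[OF Ycom[OF B], of "\<lambda>T. blinfun_apply T u"] by simp
    then have "Q (B (E v)) = B (Q (E v))" by (simp add: Q_def blinfun.diff_right)
    then show "E (B v) = B (E v)" by (metis QE Qinj)
  qed
qed

section \<open>Pseudo-inverses and square roots\<close>

context semi_inner_space
begin

text \<open>
  Over the complex numbers positivity implies self-adjointness: polarise using \<open>c + d\<close> and
  \<open>c + \<i> d\<close>.
\<close>

lemma positive_op_self_adjoint:
  assumes bd: "bounded_op V ip R" and pos: "positive_op V ip R"
  shows "self_adjoint_op V ip R"
  unfolding self_adjoint_op_def
proof (intro ballI)
  fix c d assume c: "c \<in> V" and d: "d \<in> V"
  have RV: "R x \<in> V" if "x \<in> V" for x using bd that by (simp add: bounded_op_def)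
  have Radd: "R (x + y) = R x + R y" if "x \<in> V" "y \<in> V" for x y
    using bd that by (simp add: bounded_op_def)
  have Rscale: "R (a *\<^sub>C x) = a *\<^sub>C R x" if "x \<in> V" for a x using bd that by (simp add: bounded_op_def)
  have im: "Im (ip (R x) x) = 0" if "x \<in> V" for x
    using pos that by (auto simp: positive_op_def complex_nonneg_Reals_iff)
  have *: "Im (ip (R c) y + ip (R y) c) = 0" if y: "y \<in> V" for y
    using im[OF mem(2)[OF c y]] im[OF c] im[OF y]
    by (simp add: Radd ip_add_left ip_add_right c y RV mem)
  have "ip (R d) c = cnj (ip (R c) d)"
    using *[OF d] *[OF mem(3)[OF d], of \<i>]
    by (simp add: Rscale ip_scaleC_left ip_scaleC_right c d RV mem complex_eq_iff)
  then show "ip (R c) d = ip c (R d)" using ip_commute[OF c RV[OF d]] by simp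
qed

text \<open>
  Penrose's argument: \<open>G S = G T\<close> and \<open>S G = T G\<close> follow by inserting \<open>G = G T G\<close> and moving the
  self-adjoint products across, and then \<open>S = S G S = T G T = T\<close>.
\<close>

lemma pseudo_inverse_unique:
  assumes nondeg: "\<And>x. x \<in> V \<Longrightarrow> (\<And>y. y \<in> V \<Longrightarrow> ip x y = 0) \<Longrightarrow> x = 0"
    and G: "\<And>c. c \<in> V \<Longrightarrow> G c \<in> V"
    and S: "\<And>c. c \<in> V \<Longrightarrow> S c \<in> V" "\<And>c. c \<in> V \<Longrightarrow> G (S (G c)) = G c" "\<And>c. c \<in> V \<Longrightarrow> S (G (S c)) = S c"
      "self_adjoint_op V ip (G \<circ> S)" "self_adjoint_op V ip (S \<circ> G)"
    and T: "\<And>c. c \<in> V \<Longrightarrow> T c \<in> V" "\<And>c. c \<in> V \<Longrightarrow> G (T (G c)) = G c" "\<And>c. c \<in> V \<Longrightarrow> T (G (T c)) = T c"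
      "self_adjoint_op V ip (G \<circ> T)" "self_adjoint_op V ip (T \<circ> G)"
    and c: "c \<in> V"
  shows "S c = T c"
proof -
  have eqI: "x = y" if "x \<in> V" "y \<in> V" "\<And>d. d \<in> V \<Longrightarrow> ip x d = ip y d" for x y
    using nondeg[of "x - y"] that by (simp add: mem ip_diff_left)
  have GS: "ip (G (S x)) y = ip x (G (S y))" and GT: "ip (G (T x)) y = ip x (G (T y))"
    and SG: "ip (S (G x)) y = ip x (S (G y))" and TG: "ip (T (G x)) y = ip x (T (G y))"
    if "x \<in> V" "y \<in> V" for x y
    using S(4,5) T(4,5) that by (simp_all add: self_adjoint_op_def)
  have 1: "G (S x) = G (T x)" if x: "x \<in> V" for x
  proof (rule eqI)
    fix d assume d: "d \<in> V"
    have "ip (G (S x)) d = ip x (G (T (G (S d))))"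
      using x d by (simp add: GS T(2) S(1))
    also have "\<dots> = ip (G (S (G (T x)))) d"
      using x d by (simp add: GS GT G S(1) T(1))
    also have "G (S (G (T x))) = G (T x)" using x by (simp add: S(2) T(1))
    finally show "ip (G (S x)) d = ip (G (T x)) d" .
  qed (simp_all add: x G S T)
  have 2: "S (G x) = T (G x)" if x: "x \<in> V" for x
  proof (rule eqI)
    fix d assume d: "d \<in> V"
    have "S (G x) = S (G (T (G x)))" using x by (simp add: T(2))
    then have "ip (S (G x)) d = ip x (T (G (S (G d))))"
      using x d by (simp add: SG TG G S(1) T(1))
    also have "\<dots> = ip x (T (G d))" using d by (simp add: S(2))
    also have "\<dots> = ip (T (G x)) d" using x d by (simp add: TG)
    finally show "ip (S (G x)) d = ip (T (G x)) d" .
  qed (simp_all add: x G S T)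
  have "S c = S (G (S c))" using c by (simp add: S(3))
  also have "\<dots> = S (G (T c))" using c by (simp add: 1)
  also have "\<dots> = T (G (T c))" using c by (simp add: 2 T(1))
  also have "\<dots> = T c" using c by (simp add: T(3))
  finally show ?thesis .
qed

end

lemma ell2_nondegenerate:
  assumes x: "x \<in> ell2 I" and zero: "ell2_inner I x x = 0"
  shows "x = 0"
proof
  fix i
  have sum: "(\<lambda>i. (cmod (x i))\<^sup>2) summable_on I" using x by (simp add: ell2_def)
  have "(\<Sum>\<^sub>\<infinity>i\<in>I. (cmod (x i))\<^sup>2) = 0"
    using ell2_norm_square[OF x] ell2.nrm_square[OF x] zero by simp
  then have "(cmod (x i))\<^sup>2 \<le> 0" if "i \<in> I"
    using finite_sum_le_infsum[OF sum, of "{i}"] that by simp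
  then show "x i = 0 i" using x by (cases "i \<in> I") (auto simp: ell2_def)
qed

section \<open>Frames of a closed subspace\<close>

text \<open>
  The Bessel inequality is only required on the closed span of the family; it extends to the whole space
  because the coefficients of a vector do not change under projection to that span.
\<close>

locale bessel_family =
  fixes I :: "'i set" and a :: "'i \<Rightarrow> 'h::complex_hilbert" and K :: real
  assumes K_pos: "0 < K"
    and bessel: "v \<in> closure (cspan {a i |i. i \<in> I}) \<Longrightarrow> finite F \<Longrightarrow> F \<subseteq> I \<Longrightarrow>
      (\<Sum>i\<in>F. (cmod (cinner v (a i)))\<^sup>2) \<le> K * (norm v)\<^sup>2"
begin

abbreviation J :: "'h set" where "J \<equiv> closure (cspan {a i |i. i \<in> I})"
abbreviation P :: "'h \<Rightarrow> 'h" where "P \<equiv> orth_proj cinner J"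
abbreviation n2 :: "('i \<Rightarrow> complex) \<Rightarrow> real" where "n2 \<equiv> ip_norm (ell2_inner I)"

definition analysis :: "'h \<Rightarrow> 'i \<Rightarrow> complex"
  where "analysis v = (\<lambda>i. if i \<in> I then cinner v (a i) else 0)"

definition synthesis :: "('i \<Rightarrow> complex) \<Rightarrow> 'h"
  where "synthesis c = (\<Sum>\<^sub>\<infinity>i\<in>I. c i *\<^sub>C a i)"

lemma csubspace_J: "csubspace J" by (intro csubspace_closure csubspace_cspan)

lemma closed_J: "cip.closed_csubspace J" by (simp add: cip_closed_csubspace csubspace_J)

lemma a_in_J: "i \<in> I \<Longrightarrow> a i \<in> J"
  by (intro subsetD[OF closure_subset] module.span_base[OF module_scaleC]) auto

lemma P_mem: "P v \<in> J" by (rule cip.orth_proj_mem[OF closed_J]) simp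

lemma cinner_P: "w \<in> J \<Longrightarrow> cinner (P v) w = cinner v w"
  by (rule cip.ip_orth_proj[OF closed_J]) simp_all

lemma eq_P: "p \<in> J \<Longrightarrow> (\<And>w. w \<in> J \<Longrightarrow> cinner p w = cinner v w) \<Longrightarrow> p = P v"
proof -
  assume p: "p \<in> J" and eq: "\<And>w. w \<in> J \<Longrightarrow> cinner p w = cinner v w"
  have "p - P v \<in> J" by (rule csubspaceD(5)[OF csubspace_J p P_mem])
  then have "cinner (p - P v) (p - P v) = 0" by (simp add: cinner_diff_left eq cinner_P)
  then show "p = P v" by (simp add: cinner_self)
qed

lemma P_id: "v \<in> J \<Longrightarrow> P v = v" by (rule eq_P[symmetric]) auto

lemma P_add: "P (v + w) = P v + P w"
  by (rule eq_P[symmetric]) (auto simp: cinner_add_left cinner_P P_mem intro: csubspaceD(2)[OF csubspace_J])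

lemma P_scaleC: "P (b *\<^sub>C v) = b *\<^sub>C P v"
  by (rule eq_P[symmetric]) (auto simp: cinner_scaleC_left cinner_P P_mem intro: csubspaceD(3)[OF csubspace_J])

lemma norm_P: "norm (P v) \<le> norm v"
  using cip.nrm_orth_proj_le[OF closed_J, of v] by simp

lemma P_adjoint: "cinner (P v) w = cinner v (P w)"
proof -
  have "cinner (P v) w = cnj (cinner w (P v))" by (rule cinner_commute)
  also have "cinner w (P v) = cinner (P w) (P v)" by (simp add: cinner_P P_mem)
  also have "cnj \<dots> = cinner (P v) (P w)" by (rule cinner_commute[symmetric])
  finally show ?thesis by (simp add: cinner_P P_mem)
qed

lemma analysis_P: "analysis (P v) = analysis v"
  by (auto simp: analysis_def cinner_P a_in_J)

lemma analysis_add: "analysis (v + w) = analysis v + analysis w"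
  by (auto simp: analysis_def cinner_add_left)

lemma analysis_scaleC: "analysis (b *\<^sub>C v) = b *\<^sub>C analysis v"
  by (auto simp: analysis_def cinner_scaleC_left scaleC_fun_def scaleC_complex_def)

lemma bessel_P: "finite F \<Longrightarrow> F \<subseteq> I \<Longrightarrow> (\<Sum>i\<in>F. (cmod (cinner v (a i)))\<^sup>2) \<le> K * (norm (P v))\<^sup>2"
proof -
  assume F: "finite F" "F \<subseteq> I"
  have "(\<Sum>i\<in>F. (cmod (cinner v (a i)))\<^sup>2) = (\<Sum>i\<in>F. (cmod (cinner (P v) (a i)))\<^sup>2)"
    using F(2) by (intro sum.cong) (auto simp: cinner_P a_in_J)
  then show ?thesis using bessel[OF P_mem F] by simp
qed

lemma analysis_summable: "(\<lambda>i. (cmod (cinner v (a i)))\<^sup>2) summable_on I"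
  by (rule nonneg_bdd_above_summable_on) (auto intro!: bdd_aboveI2 bessel_P)

lemma analysis_ell2: "analysis v \<in> ell2 I"
proof -
  have "(\<lambda>i. (cmod (analysis v i))\<^sup>2) summable_on I \<longleftrightarrow> (\<lambda>i. (cmod (cinner v (a i)))\<^sup>2) summable_on I"
    by (rule summable_on_cong) (simp add: analysis_def)
  then show ?thesis using analysis_summable by (simp add: ell2_def analysis_def)
qed

lemma analysis_norm: "(n2 (analysis v))\<^sup>2 = (\<Sum>\<^sub>\<infinity>i\<in>I. (cmod (cinner v (a i)))\<^sup>2)"
  unfolding ell2_norm_square[OF analysis_ell2] by (rule infsum_cong) (simp add: analysis_def)

lemma analysis_upper: "(n2 (analysis v))\<^sup>2 \<le> K * (norm (P v))\<^sup>2"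
  unfolding analysis_norm by (rule infsum_le_finite_sums[OF analysis_summable bessel_P])

lemma norm_analysis: "n2 (analysis v) \<le> sqrt K * norm v"
proof (rule power2_le_imp_le)
  have "K * (norm (P v))\<^sup>2 \<le> K * (norm v)\<^sup>2"
    using K_pos norm_P by (intro mult_left_mono power_mono) auto
  from order_trans[OF analysis_upper this] show "(n2 (analysis v))\<^sup>2 \<le> (sqrt K * norm v)\<^sup>2"
    using K_pos by (simp add: power_mult_distrib)
qed (use K_pos in simp)

lemma analysis_diff: "analysis (v - w) = analysis v - analysis w"
  by (auto simp: analysis_def cinner_diff_left)

lemma continuous_on_norm_analysis: "continuous_on UNIV (\<lambda>v. n2 (analysis v))"
proof -
  have "n2 (analysis v) - n2 (analysis w) \<le> sqrt K * norm (v - w)" for v w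
    using ell2.nrm_triangle[OF analysis_ell2[of "v - w"] analysis_ell2[of w]] norm_analysis[of "v - w"]
    by (simp add: analysis_diff)
  then have "dist (n2 (analysis v)) (n2 (analysis w)) \<le> sqrt K * dist v w" for v w
    by (smt (verit) dist_norm norm_minus_commute real_norm_def)
  then have "(sqrt K)-lipschitz_on UNIV (\<lambda>v. n2 (analysis v))"
    using K_pos by (intro lipschitz_onI) auto
  then show ?thesis by (rule lipschitz_on_continuous_on)
qed

lemma norm_finite_synthesis:
  assumes F: "finite F" "F \<subseteq> I"
  shows "norm (\<Sum>i\<in>F. c i *\<^sub>C a i) \<le> sqrt K * sqrt (\<Sum>i\<in>F. (cmod (c i))\<^sup>2)"
proof -
  define w where "w = (\<Sum>i\<in>F. c i *\<^sub>C a i)"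
  have cw: "cinner w y = (\<Sum>i\<in>F. c i * cinner (a i) y)" for y
    unfolding w_def using F(1)
    by (induction F rule: finite_induct) (simp_all add: cinner_add_left cinner_scaleC_left)
  have w: "w \<in> J"
    unfolding w_def using F
    by (induction F rule: finite_induct)
      (auto intro!: csubspaceD(1,2)[OF csubspace_J] csubspaceD(3)[OF csubspace_J a_in_J])
  have "(norm w)\<^sup>2 = cmod (cinner w w)" by (simp add: cinner_self norm_power)
  also have "\<dots> \<le> (\<Sum>i\<in>F. cmod (c i * cinner (a i) w))" unfolding cw by (rule norm_sum)
  also have "\<dots> = (\<Sum>i\<in>F. \<bar>cmod (c i)\<bar> * \<bar>cmod (cinner w (a i))\<bar>)"
    by (intro sum.cong refl) (metis abs_norm_cancel cinner_commute complex_mod_cnj norm_mult)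
  also have "\<dots> \<le> L2_set (\<lambda>i. cmod (c i)) F * L2_set (\<lambda>i. cmod (cinner w (a i))) F"
    by (rule L2_set_mult_ineq)
  also have "\<dots> \<le> sqrt (\<Sum>i\<in>F. (cmod (c i))\<^sup>2) * sqrt (K * (norm w)\<^sup>2)"
    unfolding L2_set_def
    by (intro mult_left_mono real_sqrt_le_mono bessel[OF w F]) (simp add: sum_nonneg)
  also have "\<dots> = sqrt K * sqrt (\<Sum>i\<in>F. (cmod (c i))\<^sup>2) * norm w" by (simp add: real_sqrt_mult)
  finally have "norm w * norm w \<le> sqrt K * sqrt (\<Sum>i\<in>F. (cmod (c i))\<^sup>2) * norm w"
    by (simp add: power2_eq_square)
  then have "norm w \<le> sqrt K * sqrt (\<Sum>i\<in>F. (cmod (c i))\<^sup>2)"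
    using K_pos by (cases "w = 0") (auto simp: sum_nonneg)
  then show ?thesis by (simp add: w_def)
qed

text \<open>
  The series need not converge absolutely.  By \<open>norm_finite_synthesis\<close> its finite partial sums satisfy
  the Cauchy criterion because those of \<open>\<Sum>\<^sub>i |c\<^sub>i|\<^sup>2\<close> do.
\<close>

lemma synthesis_summable:
  assumes c: "c \<in> ell2 I"
  shows "(\<lambda>i. c i *\<^sub>C a i) summable_on I"
proof -
  let ?q = "\<lambda>i. (cmod (c i))\<^sup>2" and ?t = "\<lambda>i. c i *\<^sub>C a i"
  have q: "?q summable_on I" using c by (simp add: ell2_def)
  have "\<exists>Q. eventually Q (finite_subsets_at_top I) \<and> (\<forall>F G. Q F \<and> Q G \<longrightarrow> dist (sum ?t F) (sum ?t G) < e)"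
    if e: "e > 0" for e
  proof -
    \<comment> \<open>Chosen so that \<open>sqrt K * sqrt d = e / 2\<close>.\<close>
    define d where "d = (e / 2)\<^sup>2 / K"
    have d: "0 < d" using e K_pos by (simp add: d_def)
    have "\<forall>\<^sub>F F in finite_subsets_at_top I. dist (sum ?q F) (infsum ?q I) < d"
      using infsum_tendsto[OF q] d by (rule tendstoD)
    then obtain F0 where F0: "finite F0" "F0 \<subseteq> I" "dist (sum ?q F0) (infsum ?q I) < d"
      by (auto simp: eventually_finite_subsets_at_top)
    have near: "dist (sum ?t F) (sum ?t F0) < e / 2" if F: "finite F" "F \<subseteq> I" "F0 \<subseteq> F" for F
    proof -
      have "sum ?q (F - F0) = sum ?q F - sum ?q F0" using F by (simp add: sum_diff)
      also have "\<dots> < d"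
        using finite_sum_le_infsum[OF q F(1,2)] F0(3) by (auto simp: dist_real_def)
      finally have lt: "sum ?q (F - F0) < d" .
      have "dist (sum ?t F) (sum ?t F0) = norm (sum ?t (F - F0))"
        using F by (simp add: dist_norm sum_diff)
      also have "\<dots> \<le> sqrt K * sqrt (sum ?q (F - F0))" using F by (intro norm_finite_synthesis) auto
      also have "\<dots> < sqrt K * sqrt d" using lt K_pos by simp
      also have "\<dots> = e / 2" using e K_pos by (simp add: d_def real_sqrt_mult[symmetric])
      finally show ?thesis .
    qed
    let ?Q = "\<lambda>F. finite F \<and> F \<subseteq> I \<and> F0 \<subseteq> F"
    have "eventually ?Q (finite_subsets_at_top I)"
      unfolding eventually_finite_subsets_at_top using F0 by blast
    moreover have "dist (sum ?t F) (sum ?t G) < e" if "?Q F" "?Q G" for F G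
      using near[of F] near[of G] that dist_triangle_half_l[of "sum ?t F" "sum ?t F0" e "sum ?t G"]
      by (simp add: dist_commute)
    ultimately show ?thesis by (intro exI[of _ ?Q]) blast
  qed
  then have "cauchy_filter (filtermap (sum ?t) (finite_subsets_at_top I))"
    by (simp add: cauchy_filter_metric_filtermap)
  moreover have "uniform_space_class.complete (UNIV :: 'h set)"
    by (meson Cauchy_convergent UNIV_I complete_def convergent_def)
  ultimately obtain L where "(sum ?t \<longlongrightarrow> L) (finite_subsets_at_top I)"
    using complete_uniform[where S = UNIV] by (force simp add: filterlim_def)
  then show ?thesis using summable_on_def has_sum_def by blast
qed

lemma cinner_synthesis:
  assumes c: "c \<in> ell2 I"
  shows "cinner (synthesis c) v = (\<Sum>\<^sub>\<infinity>i\<in>I. c i * cinner (a i) v)"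
proof -
  have "((\<lambda>i. cinner (c i *\<^sub>C a i) v) has_sum cinner (synthesis c) v) I"
    unfolding synthesis_def
    by (intro has_sum_bounded_linear[OF bounded_bilinear.bounded_linear_left[OF bounded_bilinear_cinner]]
        has_sum_infsum synthesis_summable c)
  then show ?thesis by (simp add: infsumI cinner_scaleC_left)
qed

lemma synthesis_adjoint:
  assumes c: "c \<in> ell2 I"
  shows "cinner (synthesis c) v = ell2_inner I c (analysis v)"
  unfolding cinner_synthesis[OF c] ell2_inner_def
  by (rule infsum_cong) (simp add: analysis_def cinner_commute[of "a _" v])

lemma synthesis_adjoint':
  assumes c: "c \<in> ell2 I"
  shows "cinner v (synthesis c) = ell2_inner I (analysis v) c"
  by (metis c cinner_commute synthesis_adjoint ell2.ip_commute analysis_ell2)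

lemma synthesis_add: "c \<in> ell2 I \<Longrightarrow> d \<in> ell2 I \<Longrightarrow> synthesis (c + d) = synthesis c + synthesis d"
  by (rule cinner_ext) (simp add: cinner_add_left synthesis_adjoint ell2.mem ell2.ip_add_left analysis_ell2)

lemma synthesis_scaleC: "c \<in> ell2 I \<Longrightarrow> synthesis (b *\<^sub>C c) = b *\<^sub>C synthesis c"
  by (rule cinner_ext) (simp add: cinner_scaleC_left synthesis_adjoint ell2.mem ell2.ip_scaleC_left analysis_ell2)

text \<open>
  The component orthogonal to \<open>J\<close> has zero coefficients, hence zero inner product with
  \<open>synthesis c\<close> by adjointness.
\<close>

lemma synthesis_mem: assumes c: "c \<in> ell2 I" shows "synthesis c \<in> J"
proof -
  define z where "z = synthesis c - P (synthesis c)"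
  have orth: "cinner z w = 0" if "w \<in> J" for w
    using that by (simp add: z_def cinner_diff_left cinner_P)
  have "analysis z = 0" by (auto simp: analysis_def orth a_in_J)
  then have "cinner (synthesis c) z = 0"
    using synthesis_adjoint[OF c, of z] by (simp add: ell2_inner_def)
  moreover have "cinner (P (synthesis c)) z = 0"
    using orth[OF P_mem, of "synthesis c"] cinner_commute[of "P (synthesis c)" z] by simp
  ultimately have "cinner z z = 0" unfolding z_def by (simp add: cinner_diff_left)
  then have "synthesis c = P (synthesis c)" by (simp add: cinner_self z_def)
  then show ?thesis using P_mem[of "synthesis c"] by simp
qed

lemma norm_synthesis: assumes c: "c \<in> ell2 I" shows "norm (synthesis c) \<le> sqrt K * n2 c"
proof -
  let ?v = "synthesis c"
  have "(norm ?v)\<^sup>2 = cmod (ell2_inner I c (analysis ?v))"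
    unfolding synthesis_adjoint[OF c, symmetric] by (simp add: cinner_self norm_power)
  also have "\<dots> \<le> n2 c * n2 (analysis ?v)" by (rule ell2.Cauchy_Schwarz[OF c analysis_ell2])
  also have "\<dots> \<le> n2 c * (sqrt K * norm ?v)" using c by (intro mult_left_mono norm_analysis) auto
  finally have "norm ?v * norm ?v \<le> (sqrt K * n2 c) * norm ?v" by (simp add: power2_eq_square mult_ac)
  then show ?thesis using K_pos c by (cases "?v = 0") auto
qed

lemma matrix_op_synthesis:
  assumes c: "c \<in> ell2 I"
  shows "matrix_op I (\<lambda>i j. cinner (a j) (b i)) c = (\<lambda>i. if i \<in> I then cinner (synthesis c) (b i) else 0)"
  by (auto simp: matrix_op_def cinner_synthesis[OF c] mult.commute)

section \<open>The frame operator\<close>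

definition frame_op :: "'h \<Rightarrow> 'h" where "frame_op v = synthesis (analysis v)"

lemma frame_op_mem: "frame_op v \<in> J" by (simp add: frame_op_def synthesis_mem analysis_ell2)

lemma cinner_frame_op: "cinner (frame_op v) w = ell2_inner I (analysis v) (analysis w)"
  by (simp add: frame_op_def synthesis_adjoint analysis_ell2)

lemma frame_op_adjoint: "cinner (frame_op v) w = cinner v (frame_op w)"
  by (simp add: frame_op_def synthesis_adjoint synthesis_adjoint' analysis_ell2)

lemma frame_op_scaleC: "frame_op (b *\<^sub>C v) = b *\<^sub>C frame_op v"
  by (simp add: frame_op_def analysis_scaleC synthesis_scaleC analysis_ell2)

lemma frame_op_P: "frame_op (P v) = frame_op v"
  by (simp add: frame_op_def analysis_P)

text \<open>
  On \<open>J\<close> this is \<open>1 - F / K\<close> for the frame operator \<open>F\<close>; on the orthogonal complement, where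
  \<open>F\<close> is not invertible, it is \<open>0\<close>.  So \<open>1 - defect\<close> is an invertible operator on the whole space
  that agrees with \<open>F / K\<close> on \<open>J\<close>.
\<close>

definition defect :: "'h \<Rightarrow> 'h" where "defect v = P v - (1 / K) *\<^sub>R frame_op v"

lemma defect_add: "defect (v + w) = defect v + defect w"
  by (simp add: defect_def P_add frame_op_def analysis_add synthesis_add analysis_ell2 algebra_simps)

lemma defect_scaleC: "defect (b *\<^sub>C v) = b *\<^sub>C defect v"
  by (simp add: defect_def P_scaleC frame_op_scaleC scaleR_scaleC scaleC_scaleC mult.commute
      module.scale_right_diff_distrib[OF module_scaleC])

lemma defect_adjoint: "cinner (defect v) w = cinner v (defect w)"
  by (simp add: defect_def cinner_diff_left cinner_diff_right P_adjoint scaleR_scaleC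
      cinner_scaleC_left cinner_scaleC_right frame_op_adjoint)

lemma Re_defect: "Re (cinner (defect v) v) = (norm (P v))\<^sup>2 - (1 / K) * (n2 (analysis v))\<^sup>2"
proof -
  have "cinner (P v) v = cinner (P v) (P v)"
    using P_adjoint[of v v] cinner_P[OF P_mem[of v], of v] by simp
  then show ?thesis
    by (simp add: defect_def cinner_diff_left scaleR_scaleC cinner_scaleC_left cinner_frame_op
        ell2.nrm_square[OF analysis_ell2] cinner_self del: of_real_power)
qed

end

text \<open>
  An upper frame bound may be enlarged until \<open>m \<le> K\<close>, which keeps \<open>1 - m / K\<close> in \<open>[0, 1)\<close> even
  if the closed span is zero.
\<close>

locale subspace_frame = bessel_family I a K
  for I :: "'i set" and a :: "'i \<Rightarrow> 'h::complex_hilbert" and K :: real +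
  fixes m :: real
  assumes m_pos: "0 < m" and m_le_K: "m \<le> K"
    and lower: "v \<in> closure (cspan {a i |i. i \<in> I}) \<Longrightarrow>
      m * (norm v)\<^sup>2 \<le> (\<Sum>\<^sub>\<infinity>i\<in>I. (cmod (cinner v (a i)))\<^sup>2)"
begin

lemma analysis_lower: "m * (norm (P v))\<^sup>2 \<le> (n2 (analysis v))\<^sup>2"
  using lower[OF P_mem] by (simp add: analysis_norm[symmetric] analysis_P)

text \<open>
  The quadratic form of the defect lies between \<open>0\<close> and \<open>1 - m / K\<close>.  The Cauchy--Schwarz inequality
  for this form, applied to \<open>v\<close> and \<open>defect v\<close>, turns this into a bound for the operator norm.
\<close>

lemma norm_defect: "norm (defect v) \<le> (1 - m / K) * norm v"
proof -
  let ?r = "1 - m / K"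
  have r: "0 \<le> ?r" using m_le_K K_pos by simp
  interpret q: semi_inner_space "UNIV :: 'h set" "\<lambda>v w. cinner (defect v) w"
  proof
    show "csubspace (UNIV :: 'h set)" by (simp add: csubspace_def)
    show "cinner (defect x) y = cnj (cinner (defect y) x)" for x y
      by (metis cinner_commute defect_adjoint)
    show "cinner (defect (x + y)) z = cinner (defect x) z + cinner (defect y) z" for x y z
      by (simp add: defect_add cinner_add_left)
    show "cinner (defect (b *\<^sub>C x)) y = b * cinner (defect x) y" for b x y
      by (simp add: defect_scaleC cinner_scaleC_left)
    show "0 \<le> Re (cinner (defect x) x)" for x
      using analysis_upper[of x] K_pos by (simp add: Re_defect field_simps)
  qed
  have le: "q.nrm x \<le> sqrt ?r * norm x" for x
  proof (rule power2_le_imp_le)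
    have "(q.nrm x)\<^sup>2 = (norm (P x))\<^sup>2 - (1 / K) * (n2 (analysis x))\<^sup>2"
      by (simp add: q.nrm_square Re_defect)
    also have "\<dots> \<le> (norm (P x))\<^sup>2 - (1 / K) * (m * (norm (P x))\<^sup>2)"
      using analysis_lower[of x] K_pos by (intro diff_left_mono mult_left_mono) auto
    also have "\<dots> = ?r * (norm (P x))\<^sup>2" by (simp add: algebra_simps)
    also have "\<dots> \<le> ?r * (norm x)\<^sup>2" using r norm_P by (intro mult_left_mono power_mono) auto
    also have "\<dots> = (sqrt ?r * norm x)\<^sup>2" using r by (simp add: power_mult_distrib)
    finally show "(q.nrm x)\<^sup>2 \<le> (sqrt ?r * norm x)\<^sup>2" .
  qed (use r in simp)
  have "(norm (defect v))\<^sup>2 = cmod (cinner (defect v) (defect v))" by (simp add: cinner_self norm_power)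
  also have "\<dots> \<le> q.nrm v * q.nrm (defect v)" by (rule q.Cauchy_Schwarz) simp_all
  also have "\<dots> \<le> (sqrt ?r * norm v) * (sqrt ?r * norm (defect v))"
    using r by (intro mult_mono le) auto
  also have "\<dots> = (sqrt ?r * sqrt ?r) * norm v * norm (defect v)" by (simp only: mult_ac)
  also have "sqrt ?r * sqrt ?r = ?r" using r by simp
  finally have "norm (defect v) * norm (defect v) \<le> ?r * norm v * norm (defect v)"
    by (simp add: power2_eq_square)
  then show ?thesis using r by (cases "defect v = 0") auto
qed

text \<open>
  Rescale the inverse square root of \<open>1 - defect\<close> by \<open>1 / sqrt K\<close>.  It preserves \<open>J\<close> because it
  commutes with the projection onto \<open>J\<close>.
\<close>

lemma inverse_sqrt_frame_op:
  obtains E where "\<And>v. v \<in> J \<Longrightarrow> E v \<in> J" "\<And>v. v \<in> J \<Longrightarrow> E (E (frame_op v)) = v"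
    "\<And>v. v \<in> J \<Longrightarrow> frame_op (E (E v)) = v"
    "\<And>v w. E (v + w) = E v + E w" "\<And>b v. E (b *\<^sub>C v) = b *\<^sub>C E v"
    "\<exists>L\<ge>0. \<forall>v. norm (E v) \<le> L * norm v"
    "\<And>v w. cinner (E v) w = cinner v (E w)" "\<And>v. 0 \<le> Re (cinner (E v) v)"
proof -
  let ?r = "1 - m / K"
  have r: "0 \<le> ?r" "?r < 1" using m_pos m_le_K K_pos by simp_all
  have bl: "bounded_linear defect"
  proof (rule bounded_linear_intro)
    show "defect (s *\<^sub>R x) = s *\<^sub>R defect x" for s x by (simp add: scaleR_scaleC defect_scaleC)
    show "norm (defect x) \<le> norm x * ?r" for x using norm_defect[of x] by (simp add: mult.commute)
  qed (rule defect_add)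
  have blP: "bounded_linear P"
  proof (rule bounded_linear_intro)
    show "P (s *\<^sub>R x) = s *\<^sub>R P x" for s x by (simp add: scaleR_scaleC P_scaleC)
    show "norm (P x) \<le> norm x * 1" for x using norm_P[of x] by simp
  qed (rule P_add)
  define X B where "X = Blinfun defect" and "B = Blinfun P"
  have X: "blinfun_apply X = defect" and B: "blinfun_apply B = P"
    by (simp_all add: X_def B_def bounded_linear_Blinfun_apply bl blP)
  have nX: "norm X \<le> ?r" by (rule norm_blinfun_bound[OF r(1)]) (simp add: X norm_defect)
  have comm: "X o\<^sub>L B = B o\<^sub>L X"
  proof (rule blinfun_eqI)
    fix v
    have "defect v \<in> J"
      unfolding defect_def scaleR_scaleC
      by (intro csubspaceD(5,3)[OF csubspace_J] P_mem frame_op_mem)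
    then show "(X o\<^sub>L B) v = (B o\<^sub>L X) v"
      by (simp add: X B P_id) (simp add: defect_def frame_op_P P_id P_mem)
  qed
  obtain E0 where E0: "\<And>v. E0 (E0 (v - defect v)) = v" "\<And>v. E0 (E0 v) - defect (E0 (E0 v)) = v"
    "\<And>v w. E0 (v + w) = E0 v + E0 w" "\<And>b v. E0 (b *\<^sub>C v) = b *\<^sub>C E0 v"
    "\<And>v. norm (E0 v) \<le> norm v / (1 - ?r)"
    "\<And>v w. cinner (E0 v) w = cinner v (E0 w)" "\<And>v. 0 \<le> Re (cinner (E0 v) v)"
    "\<And>B v. X o\<^sub>L B = B o\<^sub>L X \<Longrightarrow> E0 (blinfun_apply B v) = B (E0 v)"
    using inverse_square_root[OF nX r, unfolded X, OF defect_scaleC defect_adjoint] by blast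
  have diff_defect: "v - defect v = complex_of_real (1 / K) *\<^sub>C frame_op v" if "v \<in> J" for v
    by (simp add: defect_def P_id[OF that] scaleR_scaleC)
  define k where "k = complex_of_real (1 / sqrt K)"
  have kk: "k * k = complex_of_real (1 / K)"
    using K_pos by (simp add: k_def flip: of_real_mult of_real_divide)
  have k_pos: "0 \<le> Re k" "Im k = 0" "cnj k = k" using K_pos by (simp_all add: k_def)
  have E0_J: "E0 v \<in> J" if "v \<in> J" for v
  proof -
    have "P (E0 v) = E0 (P v)" using E0(8)[OF comm, of v] by (simp add: B)
    then show ?thesis using P_mem[of "E0 v"] by (simp add: P_id[OF that])
  qed
  show ?thesis
  proof (rule that[of "\<lambda>v. k *\<^sub>C E0 v"])
    fix v assume v: "v \<in> J"
    show "k *\<^sub>C E0 v \<in> J" by (intro csubspaceD(3)[OF csubspace_J] E0_J v)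
    have "k *\<^sub>C E0 (k *\<^sub>C E0 (frame_op v)) = E0 (E0 ((k * k) *\<^sub>C frame_op v))"
      by (simp add: E0(4) scaleC_scaleC)
    also have "\<dots> = v" unfolding kk diff_defect[OF v, symmetric] by (rule E0(1))
    finally show "k *\<^sub>C E0 (k *\<^sub>C E0 (frame_op v)) = v" .
    have "frame_op (k *\<^sub>C E0 (k *\<^sub>C E0 v)) = (k * k) *\<^sub>C frame_op (E0 (E0 v))"
      by (simp add: E0(4) scaleC_scaleC frame_op_scaleC)
    also have "\<dots> = v" unfolding kk diff_defect[OF E0_J[OF E0_J[OF v]], symmetric] by (rule E0(2))
    finally show "frame_op (k *\<^sub>C E0 (k *\<^sub>C E0 v)) = v" .
  next
    show "k *\<^sub>C E0 (v + w) = k *\<^sub>C E0 v + k *\<^sub>C E0 w" for v w by (simp add: E0(3) scaleC_add_right)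
    show "k *\<^sub>C E0 (b *\<^sub>C v) = b *\<^sub>C k *\<^sub>C E0 v" for b v by (simp add: E0(4) scaleC_scaleC mult.commute)
    have "norm (k *\<^sub>C E0 v) \<le> (cmod k / (1 - ?r)) * norm v" for v
      using mult_left_mono[OF E0(5)[of v], of "cmod k"] by (simp add: norm_scaleC mult_ac)
    moreover have "0 \<le> cmod k / (1 - ?r)" using m_pos K_pos by simp
    ultimately show "\<exists>L\<ge>0. \<forall>v. norm (k *\<^sub>C E0 v) \<le> L * norm v" by blast
    show "cinner (k *\<^sub>C E0 v) w = cinner v (k *\<^sub>C E0 w)" for v w
      by (simp add: cinner_scaleC_left cinner_scaleC_right E0(6) k_pos)
    show "0 \<le> Re (cinner (k *\<^sub>C E0 v) v)" for v
      using k_pos E0(7)[of v] by (simp add: cinner_scaleC_left)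
  qed
qed

end


section \<open>The Gramian formula in a single fibre\<close>

context bessel_family
begin

lemma gramian_synthesis:
  "c \<in> ell2 I \<Longrightarrow> matrix_op I (\<lambda>i j. cinner (a j) (a i)) c = analysis (synthesis c)"
  by (simp add: matrix_op_synthesis analysis_def)

lemma bounded_op_sandwich:
  assumes add: "\<And>v w. E (v + w) = E v + E w" and scale: "\<And>b v. E (b *\<^sub>C v) = b *\<^sub>C E v"
    and bd: "\<And>v. norm (E v) \<le> L * norm v" and L: "0 \<le> L"
  shows "bounded_op (ell2 I) (ell2_inner I) (\<lambda>c. analysis (E (synthesis c)))"
  unfolding bounded_op_def
proof (intro conjI ballI allI exI)
  fix c d b assume c: "c \<in> ell2 I"
  show "analysis (E (synthesis c)) \<in> ell2 I" by (rule analysis_ell2)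
  show "analysis (E (synthesis (c + d))) = analysis (E (synthesis c)) + analysis (E (synthesis d))"
    if "d \<in> ell2 I" using c that by (simp add: synthesis_add add analysis_add)
  show "analysis (E (synthesis (b *\<^sub>C c))) = b *\<^sub>C analysis (E (synthesis c))"
    using c by (simp add: synthesis_scaleC scale analysis_scaleC)
  have "n2 (analysis (E (synthesis c))) \<le> sqrt K * norm (E (synthesis c))" by (rule norm_analysis)
  also have "\<dots> \<le> sqrt K * (L * (sqrt K * n2 c))"
    using K_pos L bd[of "synthesis c"] norm_synthesis[OF c]
    by (intro mult_left_mono order_trans[OF bd[of "synthesis c"] mult_left_mono]) auto
  finally show "n2 (analysis (E (synthesis c))) \<le> (sqrt K * L * sqrt K) * n2 c" by (simp only: mult_ac)
qed

end

context subspace_frame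
begin

abbreviation gram :: "('i \<Rightarrow> complex) \<Rightarrow> 'i \<Rightarrow> complex"
  where "gram \<equiv> matrix_op I (\<lambda>i j. cinner (a j) (a i))"

text \<open>
  Writing \<open>A\<close>, \<open>T\<close>, \<open>F = T A\<close> for analysis, synthesis and frame operator and \<open>E\<close> for the inverse
  square root of \<open>F\<close> on \<open>J\<close>, the relations \<open>E E F = F E E = 1\<close> show that \<open>S = A E\<^sup>4 T\<close> satisfies
  the Penrose equations for \<open>G = A T\<close> and that \<open>R = A E\<^sup>3 T\<close> is a positive square root of \<open>S\<close>.
  This proves that the choices in the definition of \<open>sqrt_pinv\<close> are not void.  The properties listed
  hold for any positive square root of \<open>S\<close>, hence for the one chosen.
\<close>

lemma sqrt_pinv_gram:
  shows sqrt_pinv_mem: "c \<in> ell2 I \<Longrightarrow> sqrt_pinv I gram c \<in> ell2 I"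
    and sqrt_pinv_scaleC: "c \<in> ell2 I \<Longrightarrow> sqrt_pinv I gram (b *\<^sub>C c) = b *\<^sub>C sqrt_pinv I gram c"
    and sqrt_pinv_adjoint: "c \<in> ell2 I \<Longrightarrow> d \<in> ell2 I \<Longrightarrow>
      ell2_inner I (sqrt_pinv I gram c) d = ell2_inner I c (sqrt_pinv I gram d)"
    and sqrt_pinv_reconstruct: "u \<in> J \<Longrightarrow>
      synthesis (sqrt_pinv I gram (sqrt_pinv I gram (analysis u))) = u"
proof -
  obtain E where E_J: "\<And>v. v \<in> J \<Longrightarrow> E v \<in> J" and EEF: "\<And>v. v \<in> J \<Longrightarrow> E (E (frame_op v)) = v"
    and FEE: "\<And>v. v \<in> J \<Longrightarrow> frame_op (E (E v)) = v"
    and E_add: "\<And>v w. E (v + w) = E v + E w" and E_scaleC: "\<And>b v. E (b *\<^sub>C v) = b *\<^sub>C E v"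
    and "\<exists>L\<ge>0. \<forall>v. norm (E v) \<le> L * norm v"
    and E_adj: "\<And>v w. cinner (E v) w = cinner v (E w)" and E_pos: "\<And>v. 0 \<le> Re (cinner (E v) v)"
    using inverse_sqrt_frame_op by blast
  then obtain L where L: "0 \<le> L" and nE: "\<And>v. norm (E v) \<le> L * norm v" by blast
  let ?V = "ell2 I" and ?ip = "ell2_inner I" and ?T = synthesis and ?A = analysis
  have TA: "?T (?A v) = frame_op v" for v by (simp add: frame_op_def)
  have nE3: "norm (E (E (E v))) \<le> L ^ 3 * norm v" for v
  proof -
    have "norm (E (E (E v))) \<le> L * norm (E (E v))" by (rule nE)
    also have "\<dots> \<le> L * (L * norm (E v))" using nE L by (intro mult_left_mono)
    also have "\<dots> \<le> L * (L * (L * norm v))" using nE L by (intro mult_left_mono)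
    finally show ?thesis by (simp add: power3_eq_cube mult.assoc)
  qed
  have nE4: "norm (E (E (E (E v)))) \<le> (L * L ^ 3) * norm v" for v
    using order_trans[OF nE mult_left_mono[OF nE3 L]] by (simp add: mult.assoc)
  define S where "S c = ?A (E (E (E (E (?T c)))))" for c
  define R where "R c = ?A (E (E (E (?T c))))" for c
  have S_bd: "bounded_op ?V ?ip S"
    unfolding S_def by (rule bounded_op_sandwich[OF _ _ nE4]) (use L in \<open>simp_all add: E_add E_scaleC\<close>)
  have R_bd: "bounded_op ?V ?ip R"
    unfolding R_def by (rule bounded_op_sandwich[OF _ _ nE3]) (use L in \<open>simp_all add: E_add E_scaleC\<close>)
  have S_mem: "S c \<in> ?V" for c by (simp add: S_def analysis_ell2)
  have gram_mem: "gram c \<in> ?V" if "c \<in> ?V" for c using that by (simp add: gramian_synthesis analysis_ell2)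
  have GSG: "gram (S (gram c)) = gram c" if c: "c \<in> ?V" for c
    using c by (simp add: gramian_synthesis S_def analysis_ell2 TA EEF FEE E_J synthesis_mem)
  have SGS: "S (gram (S c)) = S c" if c: "c \<in> ?V" for c
    using c by (simp add: gramian_synthesis S_def analysis_ell2 TA EEF FEE E_J frame_op_mem synthesis_mem)
  have GS: "gram (S c) = ?A (E (E (?T c)))" if c: "c \<in> ?V" for c
    using c by (simp add: gramian_synthesis S_def analysis_ell2 TA FEE E_J synthesis_mem)
  have SG: "S (gram c) = ?A (E (E (?T c)))" if c: "c \<in> ?V" for c
    using c by (simp add: gramian_synthesis S_def analysis_ell2 TA EEF synthesis_mem)
  have AEET: "?ip (?A (E (E (?T c)))) d = ?ip c (?A (E (E (?T d))))" if c: "c \<in> ?V" and d: "d \<in> ?V" for c d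
    using c d by (simp add: synthesis_adjoint[symmetric] synthesis_adjoint'[symmetric] E_adj)
  define pinv where "pinv = pseudo_inverse ?V ?ip gram"
  have S_pinv: "bounded_op ?V ?ip S \<and> (\<forall>c\<in>?V. gram (S (gram c)) = gram c) \<and> (\<forall>c\<in>?V. S (gram (S c)) = S c) \<and>
      self_adjoint_op ?V ?ip (gram \<circ> S) \<and> self_adjoint_op ?V ?ip (S \<circ> gram)"
    using S_bd GSG SGS by (simp add: self_adjoint_op_def GS SG AEET)
  from exI[where P = "\<lambda>S. bounded_op ?V ?ip S \<and> (\<forall>c\<in>?V. gram (S (gram c)) = gram c) \<and>
      (\<forall>c\<in>?V. S (gram (S c)) = S c) \<and>
      self_adjoint_op ?V ?ip (gram \<circ> S) \<and> self_adjoint_op ?V ?ip (S \<circ> gram)", OF S_pinv]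
  have pinv: "bounded_op ?V ?ip pinv \<and> (\<forall>c\<in>?V. gram (pinv (gram c)) = gram c) \<and>
      (\<forall>c\<in>?V. pinv (gram (pinv c)) = pinv c) \<and>
      self_adjoint_op ?V ?ip (gram \<circ> pinv) \<and> self_adjoint_op ?V ?ip (pinv \<circ> gram)"
    unfolding pinv_def pseudo_inverse_def by (rule someI_ex)
  have nondeg: "x = 0" if "x \<in> ?V" "\<And>y. y \<in> ?V \<Longrightarrow> ?ip x y = 0" for x
    using that by (intro ell2_nondegenerate[of x I]) auto
  have pinv_mem: "pinv c \<in> ?V" if "c \<in> ?V" for c using pinv that by (simp add: bounded_op_def)
  have S_adj: "self_adjoint_op ?V ?ip (gram \<circ> S)" "self_adjoint_op ?V ?ip (S \<circ> gram)"
    using S_pinv by auto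
  have pinv_S: "pinv c = S c" if c: "c \<in> ?V" for c
    by (rule ell2.pseudo_inverse_unique[where I = I and G = gram, OF nondeg gram_mem pinv_mem _ _ _ _
          S_mem GSG SGS S_adj c]) (use pinv in auto)
  define sq where "sq = sqrt_pinv I gram"
  have R_pos: "positive_op ?V ?ip R"
    unfolding positive_op_def
  proof
    fix c assume c: "c \<in> ?V"
    have adj: "?ip (R c) c = cinner (E (E (E (?T c)))) (?T c)"
      using c by (simp add: R_def synthesis_adjoint')
    have "Im (?ip (R c) c) = 0"
    proof -
      have "cnj (?ip (R c) c) = cinner (?T c) (E (E (E (?T c))))"
        unfolding adj by (rule cinner_commute[symmetric])
      also have "\<dots> = ?ip (R c) c" unfolding adj by (simp add: E_adj)
      finally show ?thesis by (metis Im_complex_of_real Reals_cnj_iff complex_is_Real_iff)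
    qed
    moreover have "?ip (R c) c = cinner (E (E (?T c))) (E (?T c))" unfolding adj by (simp add: E_adj)
    ultimately show "?ip (R c) c \<in> \<real>\<^sub>\<ge>\<^sub>0" using E_pos[of "E (?T c)"] by (simp add: complex_nonneg_Reals_iff)
  qed
  have RR: "R (R c) = S c" if c: "c \<in> ?V" for c
    using c by (simp add: R_def S_def TA FEE E_J synthesis_mem)
  have R_sqrt: "bounded_op ?V ?ip R \<and> positive_op ?V ?ip R \<and> (\<forall>c\<in>?V. R (R c) = pinv c)"
    using R_bd R_pos RR pinv_S by simp
  from exI[where P = "\<lambda>R. bounded_op ?V ?ip R \<and> positive_op ?V ?ip R \<and> (\<forall>c\<in>?V. R (R c) = pinv c)",
      OF R_sqrt]
  have sq: "bounded_op ?V ?ip sq \<and> positive_op ?V ?ip sq \<and> (\<forall>c\<in>?V. sq (sq c) = pinv c)"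
    unfolding sq_def sqrt_pinv_def op_sqrt_def pinv_def[symmetric] by (rule someI_ex)
  show "sqrt_pinv I gram c \<in> ell2 I" "sqrt_pinv I gram (b *\<^sub>C c) = b *\<^sub>C sqrt_pinv I gram c"
    if "c \<in> ell2 I" using sq that by (simp_all add: sq_def bounded_op_def)
  show "?ip (sqrt_pinv I gram c) d = ?ip c (sqrt_pinv I gram d)" if "c \<in> ?V" "d \<in> ?V"
    using ell2.positive_op_self_adjoint[of I sq] sq that by (simp add: self_adjoint_op_def sq_def)
  show "synthesis (sqrt_pinv I gram (sqrt_pinv I gram (analysis u))) = u" if u: "u \<in> J"
  proof -
    have "sq (sq (?A u)) = S (?A u)" using sq pinv_S analysis_ell2 by simp
    then have "?T (sq (sq (?A u))) = frame_op (E (E (E (E (frame_op u)))))" by (simp add: S_def TA)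
    also have "\<dots> = u" by (simp add: u EEF FEE)
    finally show ?thesis by (simp add: sq_def)
  qed
qed

text \<open>
  This lemma and the next say that \<open>T R\<close> is a partial isometry onto \<open>J\<close>: it is a contraction, and
  \<open>R (A u)\<close> is a preimage of \<open>u\<close> with the same norm.
\<close>

lemma norm_sqrt_pinv_analysis:
  assumes u: "u \<in> J"
  shows "n2 (sqrt_pinv I gram (analysis u)) = norm u"
proof -
  let ?c = "sqrt_pinv I gram (analysis u)"
  have c: "?c \<in> ell2 I" by (simp add: sqrt_pinv_mem analysis_ell2)
  have "ell2_inner I ?c ?c = ell2_inner I (sqrt_pinv I gram ?c) (analysis u)"
    by (rule sqrt_pinv_adjoint[OF c analysis_ell2, symmetric])
  also have "\<dots> = cinner u u"
    by (simp add: synthesis_adjoint[OF sqrt_pinv_mem[OF c], symmetric] sqrt_pinv_reconstruct[OF u])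
  finally have "(n2 ?c)\<^sup>2 = (norm u)\<^sup>2"
    using ell2.nrm_square[OF c] by (simp add: cinner_self del: of_real_power)
  then show ?thesis using c by simp
qed

lemma norm_synthesis_sqrt_pinv:
  assumes c: "c \<in> ell2 I"
  shows "norm (synthesis (sqrt_pinv I gram c)) \<le> n2 c"
proof -
  let ?u = "synthesis (sqrt_pinv I gram c)"
  have u: "?u \<in> J" by (intro synthesis_mem sqrt_pinv_mem c)
  have "complex_of_real ((norm ?u)\<^sup>2) = cinner ?u ?u" by (rule cinner_self[symmetric])
  also have "\<dots> = ell2_inner I c (sqrt_pinv I gram (analysis ?u))"
    by (simp add: synthesis_adjoint sqrt_pinv_mem sqrt_pinv_adjoint analysis_ell2 c)
  finally have "(norm ?u)\<^sup>2 = cmod (ell2_inner I c (sqrt_pinv I gram (analysis ?u)))"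
    by (metis abs_of_nonneg norm_of_real zero_le_power2)
  also have "\<dots> \<le> n2 c * n2 (sqrt_pinv I gram (analysis ?u))"
    by (intro ell2.Cauchy_Schwarz c sqrt_pinv_mem analysis_ell2)
  also have "\<dots> = n2 c * norm ?u" by (simp add: norm_sqrt_pinv_analysis[OF u])
  finally have "norm ?u * norm ?u \<le> n2 c * norm ?u" by (simp add: power2_eq_square)
  then show ?thesis using c by (cases "?u = 0") auto
qed

end

text \<open>
  Adjointness gives \<open>\<langle>N c, d\<rangle> = \<langle>T R c, T' R' d\<rangle>\<close> for the operator \<open>N\<close> on the left-hand
  side.  As \<open>c\<close> and \<open>d\<close> run through the unit ball of \<open>\<ell>\<^sup>2\<close>, the vectors \<open>T R c\<close> and \<open>T' R' d\<close>
  run through the unit balls of the two closed spans.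
\<close>

theorem op_norm_gramian_eq_angle:
  fixes a b :: "'i \<Rightarrow> 'h::complex_hilbert"
  assumes a: "subspace_frame I a K m" and b: "subspace_frame I b K' m'"
  shows "op_norm (ell2 I) (ell2_inner I)
      (sqrt_pinv I (matrix_op I (\<lambda>i j. cinner (b j) (b i))) \<circ> matrix_op I (\<lambda>i j. cinner (a j) (b i))
        \<circ> sqrt_pinv I (matrix_op I (\<lambda>i j. cinner (a j) (a i))))
    = sup_cos_angle cinner (closure (cspan {a i |i. i \<in> I})) (closure (cspan {b i |i. i \<in> I}))"
proof -
  interpret A: subspace_frame I a K m by (rule a)
  interpret B: subspace_frame I b K' m' by (rule b)
  let ?RA = "sqrt_pinv I A.gram" and ?RB = "sqrt_pinv I B.gram"
  define N where "N c = ?RB (matrix_op I (\<lambda>i j. cinner (a j) (b i)) (?RA c))" for c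
  have N: "N c = ?RB (B.analysis (A.synthesis (?RA c)))" if "c \<in> ell2 I" for c
    by (simp add: N_def A.matrix_op_synthesis A.sqrt_pinv_mem that B.analysis_def)
  have N_mem: "N c \<in> ell2 I" if "c \<in> ell2 I" for c
    by (simp add: N that B.sqrt_pinv_mem B.analysis_ell2)
  have N_scaleC: "N (z *\<^sub>C c) = z *\<^sub>C N c" if "c \<in> ell2 I" for z c
    using that by (simp add: N ell2.mem A.sqrt_pinv_scaleC A.sqrt_pinv_mem A.synthesis_scaleC
        B.analysis_scaleC B.sqrt_pinv_scaleC B.analysis_ell2)
  have pairing: "ell2_inner I (?RB (B.analysis u)) d = cinner u (B.synthesis (?RB d))" if d: "d \<in> ell2 I" for u d
    using d by (simp add: B.sqrt_pinv_adjoint B.analysis_ell2 B.synthesis_adjoint' B.sqrt_pinv_mem)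
  let ?\<theta> = "sup_cos_angle cinner A.J B.J"
  note angle_le_iff = cip.sup_cos_angle_le_iff[OF subset_UNIV B.closed_J, where E = A.J, simplified]
  have \<theta>: "0 \<le> ?\<theta>" and angle: "\<And>u v. u \<in> A.J \<Longrightarrow> v \<in> B.J \<Longrightarrow> cmod (cinner u v) \<le> ?\<theta> * norm u * norm v"
    using angle_le_iff[of ?\<theta>] by auto
  let ?U = "{c \<in> ell2 I. A.n2 c \<le> 1}"
  have upper: "A.n2 (N c) \<le> ?\<theta>" if c: "c \<in> ?U" for c
  proof -
    let ?u = "A.synthesis (?RA c)" and ?d = "N c"
    have cV: "c \<in> ell2 I" and d: "?d \<in> ell2 I" using c N_mem by auto
    have u: "?u \<in> A.J" "norm ?u \<le> 1"
      using c A.norm_synthesis_sqrt_pinv[OF cV] by (auto intro: A.synthesis_mem A.sqrt_pinv_mem)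
    have v: "B.synthesis (?RB ?d) \<in> B.J" by (intro B.synthesis_mem B.sqrt_pinv_mem d)
    have "(A.n2 ?d)\<^sup>2 = Re (ell2_inner I ?d ?d)" by (rule ell2.nrm_square[OF d])
    also have "ell2_inner I ?d ?d = cinner ?u (B.synthesis (?RB ?d))"
      using pairing[OF d, of ?u] N[OF cV] by simp
    also have "Re \<dots> \<le> cmod \<dots>" by (rule complex_Re_le_cmod)
    also have "\<dots> \<le> ?\<theta> * norm ?u * norm (B.synthesis (?RB ?d))" by (rule angle[OF u(1) v])
    also have "\<dots> \<le> (?\<theta> * 1) * A.n2 ?d"
      using \<theta> u(2) B.norm_synthesis_sqrt_pinv[OF d] by (intro mult_mono mult_left_mono) auto
    finally have "A.n2 ?d * A.n2 ?d \<le> ?\<theta> * A.n2 ?d" by (simp add: power2_eq_square)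
    then show ?thesis using \<theta> ell2.nrm_nonneg[OF d] by (cases "A.n2 ?d = 0") auto
  qed
  have U0: "0 \<in> ?U" using ell2.mem(1) by auto
  have bdd: "bdd_above ((\<lambda>c. A.n2 (N c)) ` ?U)" using upper by (intro bdd_aboveI2)
  define C where "C = op_norm (ell2 I) (ell2_inner I) N"
  have C_le: "A.n2 (N c) \<le> C" if "c \<in> ?U" for c
    unfolding C_def op_norm_def by (rule cSUP_upper[OF that bdd])
  have C0: "0 \<le> C" using C_le[OF U0] ell2.nrm_nonneg[OF N_mem[of 0]] U0 by auto
  \<comment> \<open>The supremum runs over the unit ball only; homogeneity extends the bound.\<close>
  have C_bound: "A.n2 (N c) \<le> C * A.n2 c" if c: "c \<in> ell2 I" "A.n2 c \<noteq> 0" for c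
  proof -
    let ?s = "A.n2 c"
    have s: "0 < ?s" using c(2) ell2.nrm_nonneg[OF c(1)] by (metis order_less_le)
    let ?z = "complex_of_real (1 / ?s)"
    have "?z *\<^sub>C c \<in> ?U" using c s by (auto simp: ell2.mem ell2.nrm_scaleC norm_divide)
    then have "A.n2 (N (?z *\<^sub>C c)) \<le> C" by (rule C_le)
    then have "A.n2 (N c) / ?s \<le> C"
      using c s by (simp add: N_scaleC ell2.nrm_scaleC N_mem norm_divide)
    then show ?thesis using s by (simp add: field_simps)
  qed
  have "C \<le> ?\<theta>" unfolding C_def op_norm_def using U0 upper by (intro cSUP_least) blast+
  moreover have "?\<theta> \<le> C"
    unfolding angle_le_iff
  proof (intro conjI ballI C0)
    fix u v assume u: "u \<in> A.J" and v: "v \<in> B.J"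
    let ?c = "?RA (A.analysis u)" and ?d = "?RB (B.analysis v)"
    have c: "?c \<in> ell2 I" and d: "?d \<in> ell2 I"
      by (auto intro: A.sqrt_pinv_mem A.analysis_ell2 B.sqrt_pinv_mem B.analysis_ell2)
    have nc: "A.n2 ?c = norm u" and nd: "A.n2 ?d = norm v"
      using A.norm_sqrt_pinv_analysis[OF u] B.norm_sqrt_pinv_analysis[OF v] by auto
    show "cmod (cinner u v) \<le> C * norm u * norm v"
    proof (cases "u = 0")
      case False
      have "cinner u v = ell2_inner I (N ?c) ?d"
        using pairing[OF d, of u] c by (simp add: N A.sqrt_pinv_reconstruct[OF u] B.sqrt_pinv_reconstruct[OF v])
      then have "cmod (cinner u v) \<le> A.n2 (N ?c) * A.n2 ?d"
        using ell2.Cauchy_Schwarz[OF N_mem[OF c] d] by simp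
      also have "\<dots> \<le> (C * A.n2 ?c) * A.n2 ?d"
        using False nc d by (intro mult_right_mono C_bound c) auto
      finally show ?thesis by (simp add: nc nd)
    qed simp
  qed
  ultimately have "C = ?\<theta>" by (rule antisym)
  then show ?thesis unfolding C_def N_def comp_def .
qed

section \<open>From frames of the generated space to frames of the fibres\<close>

text \<open>
  As for real functions, the set where \<open>h < f\<close> is the test set; finiteness of the integral of \<open>f\<close>
  permits the subtraction.
\<close>

lemma AE_le_if_set_nn_integrals_le:
  fixes f h :: "'x \<Rightarrow> ennreal"
  assumes f [measurable]: "f \<in> borel_measurable M" and h [measurable]: "h \<in> borel_measurable M"
    and fin: "(\<integral>\<^sup>+x. f x \<partial>M) < \<infinity>"
    and le: "\<And>B. B \<in> sets M \<Longrightarrow> (\<integral>\<^sup>+x. f x * indicator B x \<partial>M) \<le> (\<integral>\<^sup>+x. h x * indicator B x \<partial>M)"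
  shows "AE x in M. f x \<le> h x"
proof -
  define B where "B = {x \<in> space M. h x < f x}"
  have B [measurable]: "B \<in> sets M" unfolding B_def by measurable
  have hf: "h x * indicator B x \<le> f x * indicator B x" for x
    by (auto simp: B_def indicator_def less_imp_le)
  have fB: "(\<integral>\<^sup>+x. f x * indicator B x \<partial>M) < \<infinity>"
    by (rule le_less_trans[OF nn_integral_mono fin]) (simp add: indicator_def)
  have "(\<integral>\<^sup>+x. h x * indicator B x \<partial>M) \<le> (\<integral>\<^sup>+x. f x * indicator B x \<partial>M)"
    by (intro nn_integral_mono hf)
  then have hB: "(\<integral>\<^sup>+x. h x * indicator B x \<partial>M) \<noteq> \<infinity>" using fB by (auto simp: top_unique)
  have "(\<integral>\<^sup>+x. f x * indicator B x - h x * indicator B x \<partial>M)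
      = (\<integral>\<^sup>+x. f x * indicator B x \<partial>M) - (\<integral>\<^sup>+x. h x * indicator B x \<partial>M)"
    by (rule nn_integral_diff) (use hB hf in auto)
  also have "\<dots> = 0" using le[OF B] fB by (simp add: diff_eq_0_iff_ennreal)
  finally have "AE x in M. f x * indicator B x - h x * indicator B x = 0"
    by (simp add: nn_integral_0_iff_AE)
  then show ?thesis
    using AE_space
  proof eventually_elim
    case (elim x)
    then show ?case
      by (cases "x \<in> B") (simp_all add: diff_eq_0_iff_ennreal, simp add: B_def not_less)
  qed
qed

text \<open>
  The Parseval identity for \<open>x \<mapsto> \<langle>f(x),\<phi>\<^sub>i(x)\<rangle>\<close> removes the determining set from the frame sum.
  The form with finite partial sums suits both frame inequalities: each of them obeys the upper bound,
  and the supremum of their integrals is at most the integral of their supremum.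
\<close>

lemma frame_sum_eq_SUP:
  fixes \<phi> :: "'i \<Rightarrow> 'x \<Rightarrow> 'h::{complex_hilbert, second_countable_topology}"
  assumes pd: "parseval_determining M N g" and \<phi>: "\<And>i. i \<in> I \<Longrightarrow> \<phi> i \<in> L2 M" and f: "f \<in> L2 M"
  shows "(\<Sum>\<^sub>\<infinity>i\<in>I. \<integral>\<^sup>+s. ennreal ((cmod (L2_inner M f (mult_op (g s) (\<phi> i))))\<^sup>2) \<partial>N)
    = (SUP F\<in>{F. finite F \<and> F \<subseteq> I}. \<integral>\<^sup>+x. (\<Sum>i\<in>F. ennreal ((cmod (cinner (f x) (\<phi> i x)))\<^sup>2)) \<partial>M)"
proof -
  have parseval: "(\<integral>\<^sup>+s. ennreal ((cmod (L2_inner M f (mult_op (g s) (\<phi> i))))\<^sup>2) \<partial>N)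
      = (\<integral>\<^sup>+x. ennreal ((cmod (cinner (f x) (\<phi> i x)))\<^sup>2) \<partial>M)" if "i \<in> I" for i
    using pd integrable_cinner[OF f \<phi>[OF that]]
    unfolding parseval_determining_def L2_inner_mult_op by blast
  have meas: "(\<lambda>x. ennreal ((cmod (cinner (f x) (\<phi> i x)))\<^sup>2)) \<in> borel_measurable M" if "i \<in> I" for i
  proof -
    note [measurable] = L2_measurable[OF f] L2_measurable[OF \<phi>[OF that]]
    show ?thesis by measurable
  qed
  have "(\<Sum>\<^sub>\<infinity>i\<in>I. \<integral>\<^sup>+s. ennreal ((cmod (L2_inner M f (mult_op (g s) (\<phi> i))))\<^sup>2) \<partial>N)
      = (SUP F\<in>{F. finite F \<and> F \<subseteq> I}. \<Sum>i\<in>F. \<integral>\<^sup>+s. ennreal ((cmod (L2_inner M f (mult_op (g s) (\<phi> i))))\<^sup>2) \<partial>N)"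
    by (rule nonneg_infsum_complete) simp
  also have "\<dots> = (SUP F\<in>{F. finite F \<and> F \<subseteq> I}. \<integral>\<^sup>+x. (\<Sum>i\<in>F. ennreal ((cmod (cinner (f x) (\<phi> i x)))\<^sup>2)) \<partial>M)"
  proof (rule SUP_cong[OF refl])
    fix F assume "F \<in> {F. finite F \<and> F \<subseteq> I}"
    then have F: "F \<subseteq> I" by simp
    have "(\<Sum>i\<in>F. \<integral>\<^sup>+s. ennreal ((cmod (L2_inner M f (mult_op (g s) (\<phi> i))))\<^sup>2) \<partial>N)
        = (\<Sum>i\<in>F. \<integral>\<^sup>+x. ennreal ((cmod (cinner (f x) (\<phi> i x)))\<^sup>2) \<partial>M)"
      using F parseval by (intro sum.cong) auto
    also have "\<dots> = (\<integral>\<^sup>+x. (\<Sum>i\<in>F. ennreal ((cmod (cinner (f x) (\<phi> i x)))\<^sup>2)) \<partial>M)"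
      using F meas by (intro nn_integral_sum[symmetric]) auto
    finally show "(\<Sum>i\<in>F. \<integral>\<^sup>+s. ennreal ((cmod (L2_inner M f (mult_op (g s) (\<phi> i))))\<^sup>2) \<partial>N)
        = (\<integral>\<^sup>+x. (\<Sum>i\<in>F. ennreal ((cmod (cinner (f x) (\<phi> i x)))\<^sup>2)) \<partial>M)" .
  qed
  finally show ?thesis .
qed

text \<open>
  The frame inequalities hold for \<open>u\<close> multiplied by the indicator of any measurable set, which lies in
  the generated space as well.
\<close>

lemma AE_frame_bounds_section:
  fixes \<phi> :: "'i \<Rightarrow> 'x \<Rightarrow> 'h::{complex_hilbert, second_countable_topology}"
  assumes pd: "parseval_determining M N g" and I: "countable I" and \<phi>: "\<And>i. i \<in> I \<Longrightarrow> \<phi> i \<in> L2 M"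
    and mK: "0 \<le> m" "0 \<le> K"
    and frame: "\<And>f. f \<in> generated_space M N g I \<phi> \<Longrightarrow>
      ennreal (m * (ip_norm (L2_inner M) f)\<^sup>2)
        \<le> (\<Sum>\<^sub>\<infinity>i\<in>I. \<integral>\<^sup>+s. ennreal ((cmod (L2_inner M f (mult_op (g s) (\<phi> i))))\<^sup>2) \<partial>N) \<and>
      (\<Sum>\<^sub>\<infinity>i\<in>I. \<integral>\<^sup>+s. ennreal ((cmod (L2_inner M f (mult_op (g s) (\<phi> i))))\<^sup>2) \<partial>N)
        \<le> ennreal (K * (ip_norm (L2_inner M) f)\<^sup>2)"
    and u: "u \<in> L2 M" "\<And>x. u x \<in> range_fun I \<phi> x"
  shows "AE x in M. (\<forall>F\<in>{F. finite F \<and> F \<subseteq> I}.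
        (\<Sum>i\<in>F. ennreal ((cmod (cinner (u x) (\<phi> i x)))\<^sup>2)) \<le> ennreal (K * (norm (u x))\<^sup>2)) \<and>
      ennreal (m * (norm (u x))\<^sup>2)
        \<le> (SUP F\<in>{F. finite F \<and> F \<subseteq> I}. \<Sum>i\<in>F. ennreal ((cmod (cinner (u x) (\<phi> i x)))\<^sup>2))"
proof -
  let ?W = "{F. finite F \<and> F \<subseteq> I}"
  have W: "countable ?W" by (rule countable_Collect_finite_subset[OF I])
  define s where "s F x = (\<Sum>i\<in>F. ennreal ((cmod (cinner (u x) (\<phi> i x)))\<^sup>2))" for F x
  note [measurable] = L2_measurable[OF u(1)]
  have meas [measurable]: "s F \<in> borel_measurable M" if "F \<in> ?W" for F
    unfolding s_def
  proof (rule borel_measurable_sum)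
    fix i assume "i \<in> F"
    then have [measurable]: "\<phi> i \<in> borel_measurable M" using that \<phi> L2_measurable by auto
    show "(\<lambda>x. ennreal ((cmod (cinner (u x) (\<phi> i x)))\<^sup>2)) \<in> borel_measurable M" by measurable
  qed
  have norm_scaled: "(\<integral>\<^sup>+x. ennreal (b * (norm (u x))\<^sup>2) * indicator B x \<partial>M)
      = ennreal (b * (ip_norm (L2_inner M) (\<lambda>x. indicator B x *\<^sub>C u x))\<^sup>2)"
    and cut: "(\<lambda>x. indicator B x *\<^sub>C u x) \<in> generated_space M N g I \<phi>"
    if B [measurable]: "B \<in> sets M" and b: "0 \<le> b" for B b
  proof -
    let ?f = "\<lambda>x. indicator B x *\<^sub>C u x"
    have f: "?f \<in> L2 M"
      by (rule L2_dominated[OF u(1), where C = 1]) (measurable, simp add: norm_scaleC indicator_def)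
    have "(\<integral>\<^sup>+x. ennreal (b * (norm (u x))\<^sup>2) * indicator B x \<partial>M)
        = (\<integral>\<^sup>+x. ennreal b * ennreal ((norm (?f x))\<^sup>2) \<partial>M)"
      by (intro nn_integral_cong) (auto simp: indicator_def norm_scaleC ennreal_mult b scaleC_one)
    also have "\<dots> = ennreal b * (\<integral>\<^sup>+x. ennreal ((norm (?f x))\<^sup>2) \<partial>M)"
      by (intro nn_integral_cmult) measurable
    also have "\<dots> = ennreal (b * (ip_norm (L2_inner M) ?f)\<^sup>2)"
      by (simp add: L2_norm_square[OF f, symmetric] ennreal_mult b)
    finally show "(\<integral>\<^sup>+x. ennreal (b * (norm (u x))\<^sup>2) * indicator B x \<partial>M)
      = ennreal (b * (ip_norm (L2_inner M) ?f)\<^sup>2)" .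
    have "?f x \<in> range_fun I \<phi> x" for x by (rule csubspaceD(3)[OF csubspace_range_fun u(2)])
    then show "?f \<in> generated_space M N g I \<phi>"
      using f generated_space_iff[where I = I and \<phi> = \<phi>, OF pd I \<phi>] by auto
  qed
  have bounds: "ennreal (m * (ip_norm (L2_inner M) (\<lambda>x. indicator B x *\<^sub>C u x))\<^sup>2)
        \<le> (SUP F\<in>?W. \<integral>\<^sup>+x. s F x * indicator B x \<partial>M)"
      "F \<in> ?W \<Longrightarrow> (\<integral>\<^sup>+x. s F x * indicator B x \<partial>M)
        \<le> ennreal (K * (ip_norm (L2_inner M) (\<lambda>x. indicator B x *\<^sub>C u x))\<^sup>2)"
    if B: "B \<in> sets M" for B F
  proof -
    let ?f = "\<lambda>x. indicator B x *\<^sub>C u x"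
    have f: "?f \<in> generated_space M N g I \<phi>" by (rule cut[OF B order_refl])
    then have fL2: "?f \<in> L2 M" by (simp add: generated_space_def ip_closure_def)
    have "(\<Sum>i\<in>F. ennreal ((cmod (cinner (?f x) (\<phi> i x)))\<^sup>2)) = s F x * indicator B x" for F x
      by (simp add: s_def indicator_def scaleC_one)
    then have eq: "(\<Sum>\<^sub>\<infinity>i\<in>I. \<integral>\<^sup>+s. ennreal ((cmod (L2_inner M ?f (mult_op (g s) (\<phi> i))))\<^sup>2) \<partial>N)
        = (SUP F\<in>?W. \<integral>\<^sup>+x. s F x * indicator B x \<partial>M)"
      using frame_sum_eq_SUP[where I = I and \<phi> = \<phi>, OF pd \<phi> fL2] by simp
    show "ennreal (m * (ip_norm (L2_inner M) ?f)\<^sup>2) \<le> (SUP F\<in>?W. \<integral>\<^sup>+x. s F x * indicator B x \<partial>M)"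
      using frame[OF f] unfolding eq by blast
    assume F: "F \<in> ?W"
    have "(\<integral>\<^sup>+x. s F x * indicator B x \<partial>M) \<le> (SUP F\<in>?W. \<integral>\<^sup>+x. s F x * indicator B x \<partial>M)"
      by (rule SUP_upper[OF F])
    also have "\<dots> \<le> ennreal (K * (ip_norm (L2_inner M) ?f)\<^sup>2)"
      using frame[OF f] unfolding eq by blast
    finally show "(\<integral>\<^sup>+x. s F x * indicator B x \<partial>M) \<le> ennreal (K * (ip_norm (L2_inner M) ?f)\<^sup>2)" .
  qed
  have "AE x in M. \<forall>F\<in>?W. s F x \<le> ennreal (K * (norm (u x))\<^sup>2)"
    unfolding AE_ball_countable[OF W]
  proof
    fix F assume F: "F \<in> ?W"
    note [measurable] = meas[OF F]
    show "AE x in M. s F x \<le> ennreal (K * (norm (u x))\<^sup>2)"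
    proof (rule AE_le_if_set_nn_integrals_le)
      show "(\<integral>\<^sup>+x. s F x \<partial>M) < \<infinity>"
        using le_less_trans[OF bounds(2)[OF sets.top F] ennreal_less_top]
        by (simp cong: nn_integral_cong)
      show "(\<integral>\<^sup>+x. s F x * indicator B x \<partial>M) \<le> (\<integral>\<^sup>+x. ennreal (K * (norm (u x))\<^sup>2) * indicator B x \<partial>M)"
        if "B \<in> sets M" for B
        using bounds(2)[OF that F] norm_scaled[OF that mK(2)] by simp
    qed measurable
  qed
  moreover have "AE x in M. ennreal (m * (norm (u x))\<^sup>2) \<le> (SUP F\<in>?W. s F x)"
  proof (rule AE_le_if_set_nn_integrals_le)
    show "(\<integral>\<^sup>+x. ennreal (m * (norm (u x))\<^sup>2) \<partial>M) < \<infinity>"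
      using norm_scaled[OF sets.top mK(1)] by (simp cong: nn_integral_cong)
    show "(\<lambda>x. SUP F\<in>?W. s F x) \<in> borel_measurable M"
      by (rule borel_measurable_SUP[OF W meas])
    show "(\<integral>\<^sup>+x. ennreal (m * (norm (u x))\<^sup>2) * indicator B x \<partial>M)
        \<le> (\<integral>\<^sup>+x. (SUP F\<in>?W. s F x) * indicator B x \<partial>M)" if B: "B \<in> sets M" for B
    proof -
      have "(\<integral>\<^sup>+x. ennreal (m * (norm (u x))\<^sup>2) * indicator B x \<partial>M)
          \<le> (SUP F\<in>?W. \<integral>\<^sup>+x. s F x * indicator B x \<partial>M)"
        using bounds(1)[OF B] norm_scaled[OF B mK(1)] by simp
      also have "\<dots> \<le> (\<integral>\<^sup>+x. (SUP F\<in>?W. s F x) * indicator B x \<partial>M)"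
        by (intro SUP_least nn_integral_mono mult_right_mono SUP_upper) auto
      finally show ?thesis .
    qed
  qed measurable
  ultimately show ?thesis unfolding s_def by eventually_elim blast
qed

text \<open>
  Both inequalities define closed sets of vectors: the upper one for each finite index set, and the
  lower one, once the upper one is known, because the norm of the analysis operator is continuous.
\<close>

lemma subspace_frame_if_dense:
  fixes a :: "'i \<Rightarrow> 'h::complex_hilbert"
  assumes m: "0 < m" "m \<le> K"
    and D: "D \<subseteq> closure (cspan {a i |i. i \<in> I})" "closure (cspan {a i |i. i \<in> I}) \<subseteq> closure D"
    and upper: "\<And>v F. v \<in> D \<Longrightarrow> finite F \<Longrightarrow> F \<subseteq> I \<Longrightarrow>
      (\<Sum>i\<in>F. ennreal ((cmod (cinner v (a i)))\<^sup>2)) \<le> ennreal (K * (norm v)\<^sup>2)"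
    and lower: "\<And>v. v \<in> D \<Longrightarrow> ennreal (m * (norm v)\<^sup>2)
      \<le> (SUP F\<in>{F. finite F \<and> F \<subseteq> I}. \<Sum>i\<in>F. ennreal ((cmod (cinner v (a i)))\<^sup>2))"
  shows "subspace_frame I a K m"
proof -
  interpret bessel_family I a K
  proof
    show "0 < K" using m by simp
    fix v F assume v: "v \<in> closure (cspan {a i |i. i \<in> I})" and F: "finite F" "F \<subseteq> I"
    have "D \<subseteq> {v. (\<Sum>i\<in>F. (cmod (cinner v (a i)))\<^sup>2) \<le> K * (norm v)\<^sup>2}"
    proof clarify
      fix v assume "v \<in> D"
      from upper[OF this F] show "(\<Sum>i\<in>F. (cmod (cinner v (a i)))\<^sup>2) \<le> K * (norm v)\<^sup>2"
        using m by (simp add: sum_ennreal)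
    qed
    moreover have "closed {v. (\<Sum>i\<in>F. (cmod (cinner v (a i)))\<^sup>2) \<le> K * (norm v)\<^sup>2}"
      by (intro closed_Collect_le continuous_intros)
    ultimately have "closure D \<subseteq> {v. (\<Sum>i\<in>F. (cmod (cinner v (a i)))\<^sup>2) \<le> K * (norm v)\<^sup>2}"
      by (rule closure_minimal)
    then show "(\<Sum>i\<in>F. (cmod (cinner v (a i)))\<^sup>2) \<le> K * (norm v)\<^sup>2" using v D(2) by blast
  qed
  show ?thesis
  proof
    fix v assume v: "v \<in> J"
    have "D \<subseteq> {v. sqrt m * norm v \<le> n2 (analysis v)}"
    proof clarify
      fix w assume w: "w \<in> D"
      have "(SUP F\<in>{F. finite F \<and> F \<subseteq> I}. \<Sum>i\<in>F. ennreal ((cmod (cinner w (a i)))\<^sup>2))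
          \<le> ennreal ((n2 (analysis w))\<^sup>2)"
        unfolding analysis_norm
        by (intro SUP_least) (auto simp: sum_ennreal intro!: ennreal_leI finite_sum_le_infsum analysis_summable)
      then have "m * (norm w)\<^sup>2 \<le> (n2 (analysis w))\<^sup>2"
        using lower[OF w] by (metis (no_types, lifting) ennreal_le_iff order_trans zero_le_power2)
      then have "(sqrt m * norm w)\<^sup>2 \<le> (n2 (analysis w))\<^sup>2" using m by (simp add: power_mult_distrib)
      then show "sqrt m * norm w \<le> n2 (analysis w)" by (rule power2_le_imp_le) (simp add: analysis_ell2)
    qed
    moreover have "closed {v. sqrt m * norm v \<le> n2 (analysis v)}"
      by (intro closed_Collect_le continuous_intros continuous_on_norm_analysis)
    ultimately have "closure D \<subseteq> {v. sqrt m * norm v \<le> n2 (analysis v)}"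
      by (rule closure_minimal)
    then have "sqrt m * norm v \<le> n2 (analysis v)" using v D(2) by blast
    then have "(sqrt m * norm v)\<^sup>2 \<le> (n2 (analysis v))\<^sup>2" using m by (intro power_mono) auto
    then show "m * (norm v)\<^sup>2 \<le> (\<Sum>\<^sub>\<infinity>i\<in>I. (cmod (cinner v (a i)))\<^sup>2)"
      using m by (simp add: power_mult_distrib analysis_norm)
  qed (use m in auto)
qed

text \<open>
  The frame inequalities hold almost everywhere simultaneously for countably many sections, whose values
  are dense in each fibre.
\<close>

theorem AE_subspace_frame_fibres:
  fixes \<phi> :: "'i \<Rightarrow> 'x \<Rightarrow> 'h::{complex_hilbert, second_countable_topology}"
  assumes pd: "parseval_determining M N g" and I: "countable I" and \<phi>: "\<And>i. i \<in> I \<Longrightarrow> \<phi> i \<in> L2 M"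
    and frame: "generates_frame M N g I \<phi>"
  shows "\<exists>K m. AE x in M. subspace_frame I (\<lambda>i. \<phi> i x) K m"
proof -
  obtain m K0 where mK0: "0 < m" "0 < K0"
    and b: "\<And>f. f \<in> generated_space M N g I \<phi> \<Longrightarrow>
      ennreal (m * (ip_norm (L2_inner M) f)\<^sup>2)
        \<le> (\<Sum>\<^sub>\<infinity>i\<in>I. \<integral>\<^sup>+s. ennreal ((cmod (L2_inner M f (mult_op (g s) (\<phi> i))))\<^sup>2) \<partial>N) \<and>
      (\<Sum>\<^sub>\<infinity>i\<in>I. \<integral>\<^sup>+s. ennreal ((cmod (L2_inner M f (mult_op (g s) (\<phi> i))))\<^sup>2) \<partial>N)
        \<le> ennreal (K0 * (ip_norm (L2_inner M) f)\<^sup>2)"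
    using frame unfolding generates_frame_def Let_def by blast
  \<comment> \<open>If the generated space is zero, nothing prevents \<open>K0 < m\<close>.\<close>
  define K where "K = max K0 m"
  have mK: "0 \<le> m" "0 \<le> K" "m \<le> K" "K0 \<le> K" using mK0 by (auto simp: K_def)
  have b': "ennreal (m * (ip_norm (L2_inner M) f)\<^sup>2)
        \<le> (\<Sum>\<^sub>\<infinity>i\<in>I. \<integral>\<^sup>+s. ennreal ((cmod (L2_inner M f (mult_op (g s) (\<phi> i))))\<^sup>2) \<partial>N) \<and>
      (\<Sum>\<^sub>\<infinity>i\<in>I. \<integral>\<^sup>+s. ennreal ((cmod (L2_inner M f (mult_op (g s) (\<phi> i))))\<^sup>2) \<partial>N)
        \<le> ennreal (K * (ip_norm (L2_inner M) f)\<^sup>2)" if "f \<in> generated_space M N g I \<phi>" for f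
  proof -
    have "ennreal (K0 * (ip_norm (L2_inner M) f)\<^sup>2) \<le> ennreal (K * (ip_norm (L2_inner M) f)\<^sup>2)"
      using mK by (intro ennreal_leI mult_right_mono) auto
    then show ?thesis using b[OF that] order_trans by blast
  qed
  obtain Q where Q: "dense_sections M I \<phi> Q"
    using dense_sections_exist[where I = I and \<phi> = \<phi>, OF I \<phi>] by blast
  have "AE x in M. \<forall>u\<in>Q. (\<forall>F\<in>{F. finite F \<and> F \<subseteq> I}.
        (\<Sum>i\<in>F. ennreal ((cmod (cinner (u x) (\<phi> i x)))\<^sup>2)) \<le> ennreal (K * (norm (u x))\<^sup>2)) \<and>
      ennreal (m * (norm (u x))\<^sup>2)
        \<le> (SUP F\<in>{F. finite F \<and> F \<subseteq> I}. \<Sum>i\<in>F. ennreal ((cmod (cinner (u x) (\<phi> i x)))\<^sup>2))"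
    unfolding AE_ball_countable[OF dense_sectionsD(1)[OF Q]]
  proof
    fix u assume "u \<in> Q"
    then show "AE x in M. (\<forall>F\<in>{F. finite F \<and> F \<subseteq> I}.
        (\<Sum>i\<in>F. ennreal ((cmod (cinner (u x) (\<phi> i x)))\<^sup>2)) \<le> ennreal (K * (norm (u x))\<^sup>2)) \<and>
      ennreal (m * (norm (u x))\<^sup>2)
        \<le> (SUP F\<in>{F. finite F \<and> F \<subseteq> I}. \<Sum>i\<in>F. ennreal ((cmod (cinner (u x) (\<phi> i x)))\<^sup>2))"
      by (intro AE_frame_bounds_section[OF pd I \<phi> mK(1,2) b'] dense_sectionsD(2,3)[OF Q])
  qed
  then have "AE x in M. subspace_frame I (\<lambda>i. \<phi> i x) K m"
  proof eventually_elim
    case (elim x)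
    show ?case
    proof (rule subspace_frame_if_dense[where D = "(\<lambda>u. u x) ` Q"])
      show "(\<lambda>u. u x) ` Q \<subseteq> closure (cspan {\<phi> i x |i. i \<in> I})"
        "closure (cspan {\<phi> i x |i. i \<in> I}) \<subseteq> closure ((\<lambda>u. u x) ` Q)"
        using dense_sectionsD(3,4)[OF Q] by (auto simp: range_fun_def)
    qed (use elim mK0 mK in auto)
  qed
  then show ?thesis by blast
qed

text \<open>
  Needed for the Gramian formula: the operator norm is only known to agree almost everywhere with the
  measurable fibre angle, and the essential supremum of a non-measurable function is infinite.
\<close>

lemma (in complete_measure) borel_measurable_AE_eq:
  assumes h: "h \<in> borel_measurable M" and ae: "AE x in M. f x = h x"
  shows "f \<in> borel_measurable M"
proof (rule measurableI)
  fix A :: "'b :: topological_space set" assume A: "A \<in> sets borel"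
  show "f -` A \<inter> space M \<in> sets M"
  proof (rule in_sets_AE)
    show "AE x in M. x \<in> h -` A \<inter> space M \<longleftrightarrow> x \<in> f -` A \<inter> space M"
      using ae by eventually_elim simp
    show "h -` A \<inter> space M \<in> sets M" using measurable_sets[OF h A] .
  qed simp
qed simp

section \<open>The two angle formulas\<close>

theorem theorem3p1:
  fixes M :: "'x measure" and N :: "'s measure"
    and g :: "'s \<Rightarrow> 'x \<Rightarrow> complex"
    and I :: "'i set"
    and \<phi> \<psi> :: "'i \<Rightarrow> 'x \<Rightarrow> 'h::{complex_hilbert, second_countable_topology}"
  assumes "sigma_finite_measure M" and "complete_measure M"
    and "ip_separable (L2 M :: ('x \<Rightarrow> complex) set) (L2_inner M)"
    and "sigma_finite_measure N"
    and "parseval_determining M N g"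
    and "countable I"
    and "\<And>i. i \<in> I \<Longrightarrow> \<phi> i \<in> L2 M"
    and "\<And>i. i \<in> I \<Longrightarrow> \<psi> i \<in> L2 M"
  shows "ennreal (sup_cos_angle (L2_inner M)
            (generated_space M N g I \<phi>) (generated_space M N g I \<psi>))
        = ess_sup_on M (fiber_support M I \<phi> \<inter> fiber_support M I \<psi>)
            (\<lambda>x. sup_cos_angle cinner (range_fun I \<phi> x) (range_fun I \<psi> x))
      \<and> (generates_frame M N g I \<phi> \<and> generates_frame M N g I \<psi> \<longrightarrow>
          ennreal (sup_cos_angle (L2_inner M)
            (generated_space M N g I \<phi>) (generated_space M N g I \<psi>))
        = ess_sup_on M (fiber_support M I \<phi> \<inter> fiber_support M I \<psi>)
            (\<lambda>x. op_norm (ell2 I) (ell2_inner I)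
              (sqrt_pinv I (gramian I \<psi> \<psi> x) \<circ> gramian I \<phi> \<psi> x
                \<circ> sqrt_pinv I (gramian I \<phi> \<phi> x))))"
proof (intro conjI impI)
  note pd = assms(5) and I = assms(6) and \<phi> = assms(7) and \<psi> = assms(8)
  let ?\<Omega> = "fiber_support M I \<phi> \<inter> fiber_support M I \<psi>"
  let ?\<theta> = "\<lambda>x. sup_cos_angle cinner (range_fun I \<phi> x) (range_fun I \<psi> x)"
  let ?op = "\<lambda>x. op_norm (ell2 I) (ell2_inner I)
      (sqrt_pinv I (gramian I \<psi> \<psi> x) \<circ> gramian I \<phi> \<psi> x \<circ> sqrt_pinv I (gramian I \<phi> \<phi> x))"
  show part1: "ennreal (sup_cos_angle (L2_inner M) (generated_space M N g I \<phi>) (generated_space M N g I \<psi>))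
      = ess_sup_on M ?\<Omega> ?\<theta>"
    by (rule angle_eq_ess_sup_fibre_angles[OF pd I \<phi> \<psi>])
  assume frames: "generates_frame M N g I \<phi> \<and> generates_frame M N g I \<psi>"
  obtain K m where "AE x in M. subspace_frame I (\<lambda>i. \<phi> i x) K m"
    using AE_subspace_frame_fibres[where I = I and \<phi> = \<phi>, OF pd I \<phi>] frames by blast
  moreover obtain K' m' where "AE x in M. subspace_frame I (\<lambda>i. \<psi> i x) K' m'"
    using AE_subspace_frame_fibres[where I = I and \<phi> = \<psi>, OF pd I \<psi>] frames by blast
  ultimately have ae: "AE x in M. ?op x = ?\<theta> x"
    by eventually_elim (simp only: gramian_def range_fun_def op_norm_gramian_eq_angle)
  have \<theta>_meas: "?\<theta> \<in> borel_measurable M" by (rule borel_measurable_fibre_angle[OF I \<phi> \<psi>])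
  have op_meas: "?op \<in> borel_measurable M"
    by (rule complete_measure.borel_measurable_AE_eq[OF assms(2) \<theta>_meas ae])
  have \<Omega>: "?\<Omega> \<in> sets M" using fiber_support_sets[OF I] \<phi> \<psi> by blast
  have "ess_sup_on M ?\<Omega> ?\<theta> = ess_sup_on M ?\<Omega> ?op"
    unfolding ess_sup_on_def
  proof (rule esssup_AE_cong)
    show "AE x in restrict_space M ?\<Omega>. ennreal (?\<theta> x) = ennreal (?op x)"
      using ae \<Omega> by (subst AE_restrict_space_iff) (auto simp: sets.Int_space_eq2)
  qed (intro measurable_compose[OF _ measurable_ennreal] measurable_restrict_space1 \<theta>_meas op_meas)+
  with part1 show "ennreal (sup_cos_angle (L2_inner M) (generated_space M N g I \<phi>) (generated_space M N g I \<psi>))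
      = ess_sup_on M ?\<Omega> ?op" by simp
qed

end
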